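(* Let $\mathcal{P}$ be a weakly compact family of probability measures on $\Omega=C([0,\infty);\mathbb{R}^k)$ with upper capacity $c$, let $Y$ be a $d$-dimensional continuous $\mathcal{P}$-semimartingale with decomposition $Y=M^P+A^P$ under each $P\in\mathcal{P}$, and let $Q\subset\mathbb{R}^d$ be an open set satisfying the exterior ball condition. Let $\tau_Q,\tau_{\overline Q}$ be the exit times of $Y$ from $Q$ and $\overline{Q}$, and for $\omega\in\Omega$ let $\Omega^\omega=\{\omega'\in\Omega:\omega'_t=\omega_t\text{ on }[0,\tau_Q(\omega)]\}$. Suppose that $Y$ is quasi-continuous on $\Omega\times[0,\infty)$ and that for each $P\in\mathcal{P}$ and for $P$-a.s. $\omega$ such that $\tau_Q(\omega)<\infty$, there exist a stopping time $\sigma^\omega$ and constants $\lambda^\omega,\varepsilon^\omega>0$ (which may depend on $P$ and $\omega$ but are uniform over $\omega'\in\Omega^\omega$) such that for all $\omega'\in\Omega^\omega$: (i) $\sigma^\omega(\omega')>0$; (ii) on the interval of $t\in[0,\sigma^\omega(\omega')\wedge(\tau_{\overline Q}(\omega')-\tau_Q(\omega'))]$, (a) $d\langle M^P\rangle_{\tau_Q(\omega)+t}(\omega')\ge\lambda^\omega\,\mathrm{tr}[d\langle M^P\rangle_{\tau_Q(\omega)+t}(\omega')]\,I_{d\times d}$ and $\mathrm{tr}[d\langle M^P\rangle_{\tau_Q(\omega)+t}(\omega')]>0$; (b) $\mathrm{tr}[d\langle M^P\rangle_{\tau_Q(\omega)+t}(\omega')]\ge\varepsilon^\omega\,|dA^P_{\tau_Q(\omega)+t}(\omega')|$.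 Then $\tau_Q=\tau_{\overline Q}$ q.s.
   Context: $\Omega=C([0,\infty);\mathbb{R}^k)$ carries the metric $\rho(\omega^1,\omega^2)=\sum_{N\ge1}2^{-N}[(\sup_{t\in[0,N]}|\omega^1_t-\omega^2_t|)\wedge1]$; $B_t(\omega)=\omega_t$ and $\mathcal{F}_t=\sigma\{B_s:s\le t\}$. A stopping time is a map $\tau:\Omega\to[0,\infty]$ with $\{\tau\le t\}\in\mathcal{F}_t$ for all $t\ge 0$. $c(A)=\sup_{P\in\mathcal{P}}P(A)$ for Borel $A$; a property holds q.s. (quasi-surely) if it holds $P$-a.s. for every $P\in\mathcal{P}$. An $(\mathcal{F}_t)$-adapted process $Y$ is a $\mathcal{P}$-semimartingale if it is a semimartingale under each $P\in\mathcal{P}$. Under $P$ we write $Y=M^P+A^P$ with $M^P$ a $d$-dimensional continuous local martingale and $A^P$ a $d$-dimensional finite-variation process; $\langle M^P\rangle$ is the matrix-valued quadratic variation of $M^P$ under $P$. A process $F$ is quasi-continuous on $\Omega\times[0,\infty)$ if for each $\varepsilon>0$ there is an open $G\subset\Omega$ with $c(G)<\varepsilon$ such that $(\omega,t)\mapsto F_t(\omega)$ is continuous on $G^c\times[0,\infty)$. For $D\subset\mathbb{R}^d$, $\tau_D(\omega)=\inf\{t\ge0:Y_t(\omega)\in D^c\}$ (with $\inf\emptyset=\infty$). An open set $O\subset\mathbb{R}^d$ satisfies the exterior ball condition if for every $x\in\partial O$ there is an open ball $U(z,r)\subset O^c$ with $x\in\partial U(z,r)$. Inequalities between differentials are inequalities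 between Lebesgue–Stieltjes measures in $t$ on the indicated interval: $d\mu_1\ge d\mu_2$ means $\mu_1(A)\ge\mu_2(A)$ for every Borel $A$ in the interval (in the order of symmetric matrices in the matrix-valued case). $|dA^P|$ is the total variation measure of $dA^P$. $\mathrm{tr}[d\langle M^P\rangle]>0$ means that the function $t\mapsto\mathrm{tr}[\langle M^P\rangle]$ generating the measure is strictly increasing on the interval. *)

theory Defs
  imports "HOL-Probability.Probability"
begin

section \<open>The path space\<close>

text \<open>Paths live on \<open>[0,\<infinity>)\<close>; they are represented by total functions on the reals that are
  frozen at their initial value for negative times, so that equality of paths is equality on
  \<open>[0,\<infinity>)\<close>.\<close>

typedef (overloaded) 'k::finite cpath =
  "{w :: real \<Rightarrow> real ^ 'k. continuous_on {0..} w \<and> (\<forall>t<0. w t = w 0)}"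
  morphisms coord Abs_cpath
  by (rule exI[of _ "\<lambda>_. 0"]) simp

lemma continuous_on_coord: "continuous_on {0..} (coord w)"
  using coord[of w] by simp

lemma cpath_eqI:
  assumes "\<And>t. 0 \<le> t \<Longrightarrow> coord v t = coord w t"
  shows "v = w"
proof -
  have "coord v t = coord w t" for t
    using assms[of t] assms[of 0] coord[of v] coord[of w] by (cases "0 \<le> t") auto
  thus ?thesis by (simp add: coord_inject[symmetric] fun_eq_iff)
qed

definition sup_dist :: "real \<Rightarrow> 'k::finite cpath \<Rightarrow> 'k cpath \<Rightarrow> real" where
  "sup_dist T v w = (SUP t\<in>{0..T}. norm (coord v t - coord w t))"

lemma bdd_above_sup_dist:
  "bdd_above ((\<lambda>t. norm (coord v t - coord w t)) ` {0..T})"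
proof -
  have "continuous_on {0..T} (\<lambda>t. norm (coord v t - coord w t))"
    by (intro continuous_intros continuous_on_subset[OF continuous_on_coord]) auto
  hence "compact ((\<lambda>t. norm (coord v t - coord w t)) ` {0..T})"
    by (rule compact_continuous_image) simp
  thus ?thesis by (intro bounded_imp_bdd_above compact_imp_bounded)
qed

lemma norm_le_sup_dist:
  "0 \<le> t \<Longrightarrow> t \<le> T \<Longrightarrow> norm (coord v t - coord w t) \<le> sup_dist T v w"
  unfolding sup_dist_def by (intro cSUP_upper bdd_above_sup_dist) auto

lemma sup_dist_nonneg: "0 \<le> T \<Longrightarrow> 0 \<le> sup_dist T v w"
  by (rule order_trans[OF norm_ge_zero norm_le_sup_dist[of 0]]) auto

lemma sup_dist_triangle:
  assumes "0 \<le> T"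
  shows "sup_dist T u w \<le> sup_dist T u v + sup_dist T v w"
  unfolding sup_dist_def[of T u w]
proof (rule cSUP_least)
  show "{0..T} \<noteq> {}" using assms by simp
  fix t assume t: "t \<in> {0..T}"
  have "norm (coord u t - coord w t) \<le> norm (coord u t - coord v t) + norm (coord v t - coord w t)"
    using norm_triangle_ineq[of "coord u t - coord v t" "coord v t - coord w t"] by simp
  also have "\<dots> \<le> sup_dist T u v + sup_dist T v w"
    using t by (intro add_mono norm_le_sup_dist) auto
  finally show "norm (coord u t - coord w t) \<le> sup_dist T u v + sup_dist T v w" .
qed

lemma sup_dist_commute: "sup_dist T v w = sup_dist T w v"
  unfolding sup_dist_def by (simp add: norm_minus_commute)

instantiation cpath :: (finite) metric_space
begin

definition dist_cpath :: "'a cpath \<Rightarrow> 'a cpath \<Rightarrow> real" where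
  "dist_cpath v w = (\<Sum>n. (1/2) ^ Suc n * min (sup_dist (real (Suc n)) v w) 1)"

definition uniformity_cpath :: "('a cpath \<times> 'a cpath) filter" where
  "uniformity_cpath = (INF e\<in>{0<..}. principal {(x, y). dist x y < e})"

definition open_cpath :: "'a cpath set \<Rightarrow> bool" where
  "open_cpath U \<longleftrightarrow> (\<forall>x\<in>U. \<forall>\<^sub>F (x', y) in uniformity. x' = x \<longrightarrow> y \<in> U)"

lemma summable_dist_cpath:
  fixes v w :: "'a cpath"
  shows "summable (\<lambda>n. (1/2) ^ Suc n * min (sup_dist (real (Suc n)) v w) 1 :: real)"
proof (rule summable_comparison_test')
  have "summable (\<lambda>n. (1/2::real) ^ n)" by (rule summable_geometric) simp
  thus "summable (\<lambda>n. (1/2::real) ^ Suc n)" by (simp only: summable_Suc_iff)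
  show "norm ((1/2) ^ Suc n * min (sup_dist (real (Suc n)) v w) 1) \<le> (1/2::real) ^ Suc n" for n
    using sup_dist_nonneg[of "real (Suc n)" v w]
    by (simp add: abs_mult min_def abs_of_nonneg del: of_nat_Suc)
qed

instance
proof
  fix u v w :: "'a cpath"
  let ?d = "\<lambda>v w n. (1/2) ^ Suc n * min (sup_dist (real (Suc n)) v w) 1 :: real"
  have nn: "0 \<le> ?d v w n" for v w :: "'a cpath" and n
    using sup_dist_nonneg[of "real (Suc n)" v w] by (simp del: of_nat_Suc)
  show "(dist v w = 0) = (v = w)"
  proof
    assume "dist v w = 0"
    hence z: "?d v w n = 0" for n
      using suminf_eq_zero_iff[OF summable_dist_cpath[of v w] nn] unfolding dist_cpath_def by blast
    show "v = w"
    proof (rule cpath_eqI)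
      fix t :: real assume t: "0 \<le> t"
      obtain n where n: "t \<le> real (Suc n)"
        by (meson real_arch_simple le_SucI of_nat_le_iff order_trans)
      have "sup_dist (real (Suc n)) v w = 0" using z[of n] by (simp add: min_def split: if_splits)
      thus "coord v t = coord w t" using norm_le_sup_dist[OF t n, of v w] by simp
    qed
  next
    assume "v = w"
    thus "dist v w = 0" unfolding dist_cpath_def sup_dist_def by simp
  qed
  have "dist v w \<le> (\<Sum>n. ?d v u n + ?d w u n)"
    unfolding dist_cpath_def
  proof (rule suminf_le[OF _ summable_dist_cpath])
    show "summable (\<lambda>n. ?d v u n + ?d w u n)" by (intro summable_add summable_dist_cpath)
    fix n
    have "sup_dist (real (Suc n)) v w \<le> sup_dist (real (Suc n)) v u + sup_dist (real (Suc n)) w u"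
      using sup_dist_triangle[of "real (Suc n)" v w u] by (simp add: sup_dist_commute[of _ u w])
    hence "min (sup_dist (real (Suc n)) v w) 1
        \<le> min (sup_dist (real (Suc n)) v u) 1 + min (sup_dist (real (Suc n)) w u) 1"
      using sup_dist_nonneg[of "real (Suc n)" v u] sup_dist_nonneg[of "real (Suc n)" w u]
      by (auto simp: min_def simp del: of_nat_Suc)
    hence "(1/2) ^ Suc n * min (sup_dist (real (Suc n)) v w) 1
        \<le> (1/2) ^ Suc n * (min (sup_dist (real (Suc n)) v u) 1 + min (sup_dist (real (Suc n)) w u) 1)"
      by (rule mult_left_mono) simp
    thus "?d v w n \<le> ?d v u n + ?d w u n" by (simp add: distrib_left)
  qed
  also have "\<dots> = dist v u + dist w u"
    unfolding dist_cpath_def by (intro suminf_add[symmetric] summable_dist_cpath)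
  finally show "dist v w \<le> dist v u + dist w u" .
qed (simp_all add: uniformity_cpath_def open_cpath_def)

end

section \<open>Weak topology, capacity, quasi-continuity\<close>

text \<open>The coarsest topology on the Borel probability measures making all maps
  \<open>P \<mapsto> \<integral>f dP\<close>, \<open>f\<close> bounded continuous, continuous.\<close>

definition weak_topology :: "'a::metric_space measure topology" where
  "weak_topology = topology_generated_by
     {{P. prob_space P \<and> sets P = sets borel \<and> integral\<^sup>L P f \<in> U} | (f :: 'a \<Rightarrow> real) U.
        continuous_on UNIV f \<and> bounded (range f) \<and> open U}"

lemma topspace_weak_topology:
  "topspace (weak_topology :: 'a::metric_space measure topology)
    = {P. prob_space P \<and> sets P = sets borel}"
proof -
  have "\<exists>S\<in>{{P. prob_space P \<and> sets P = sets borel \<and> integral\<^sup>L P f \<in> U} | (f :: 'a \<Rightarrow> real) U.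
        continuous_on UNIV f \<and> bounded (range f) \<and> open U}. P \<in> S"
    if "prob_space P" "sets P = sets borel" for P :: "'a measure"
    using that
    by (intro bexI[of _ "{P. prob_space P \<and> sets P = sets borel \<and>
           integral\<^sup>L P (\<lambda>_::'a. 0::real) \<in> UNIV}"])
       (auto intro!: exI[of _ "\<lambda>_::'a. 0::real"] exI[of _ "UNIV :: real set"])
  thus ?thesis unfolding weak_topology_def topology_generated_by_topspace by auto
qed

definition upper_capacity :: "'a measure set \<Rightarrow> 'a set \<Rightarrow> ennreal" where
  "upper_capacity \<P> B = (SUP P\<in>\<P>. emeasure P B)"

definition quasi_surely :: "'a measure set \<Rightarrow> ('a \<Rightarrow> bool) \<Rightarrow> bool" where
  "quasi_surely \<P> \<phi> \<longleftrightarrow> (\<forall>P\<in>\<P>. AE \<omega> in P. \<phi> \<omega>)"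

definition quasi_continuous ::
  "'a::metric_space measure set \<Rightarrow> (real \<Rightarrow> 'a \<Rightarrow> 'b::metric_space) \<Rightarrow> bool" where
  "quasi_continuous \<P> F \<longleftrightarrow>
     (\<forall>\<epsilon>>0. \<exists>G. open G \<and> upper_capacity \<P> G < ennreal \<epsilon> \<and>
        continuous_on ((- G) \<times> {0..}) (\<lambda>(\<omega>, t). F t \<omega>))"

section \<open>Filtration, exit times\<close>

text \<open>The index set is \<open>[0,\<infinity>]\<close>, with the \<open>\<sigma>\<close>-algebra generated by all coordinates at \<open>\<infinity>\<close>, so that
  \<^const>\<open>stopping_time\<close> covers stopping times with values in \<open>[0,\<infinity>]\<close>: the condition it
  imposes at \<open>\<infinity>\<close> is vacuous.\<close>

definition \<F> :: "ennreal \<Rightarrow> 'k::finite cpath measure" where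
  "\<F> t = sigma UNIV
     {(\<lambda>\<omega>. coord \<omega> s) -` U | s U. 0 \<le> s \<and> ennreal s \<le> t \<and> U \<in> sets borel}"

definition adapted :: "(real \<Rightarrow> 'k::finite cpath \<Rightarrow> 'b::topological_space) \<Rightarrow> bool" where
  "adapted X \<longleftrightarrow> (\<forall>t\<ge>0. X t \<in> borel_measurable (\<F> (ennreal t)))"

definition exit_time :: "(real \<Rightarrow> 'w \<Rightarrow> 'b) \<Rightarrow> 'b set \<Rightarrow> 'w \<Rightarrow> ennreal" where
  "exit_time Y D \<omega> = (INF t\<in>{t. 0 \<le> t \<and> Y t \<omega> \<in> - D}. ennreal t)"

definition paths_agreeing_upto :: "ennreal \<Rightarrow> 'k::finite cpath \<Rightarrow> 'k cpath set" where
  "paths_agreeing_upto T \<omega> = {\<omega>'. \<forall>t\<ge>0. ennreal t \<le> T \<longrightarrow> coord \<omega>' t = coord \<omega> t}"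

definition exterior_ball_condition :: "'b::real_normed_vector set \<Rightarrow> bool" where
  "exterior_ball_condition S \<longleftrightarrow>
     (\<forall>x\<in>frontier S. \<exists>z r. 0 < r \<and> ball z r \<subseteq> - S \<and> x \<in> frontier (ball z r))"

section \<open>Semimartingales\<close>

definition martingale ::
  "'k::finite cpath measure \<Rightarrow> (real \<Rightarrow> 'k cpath \<Rightarrow> real) \<Rightarrow> bool" where
  "martingale P X \<longleftrightarrow> adapted X \<and> (\<forall>t\<ge>0. integrable P (X t)) \<and>
     (\<forall>s t. 0 \<le> s \<longrightarrow> s \<le> t \<longrightarrow>
        (AE \<omega> in P. real_cond_exp P (\<F> (ennreal s)) (X t) \<omega> = X s \<omega>))"

definition stopped :: "(real \<Rightarrow> 'w \<Rightarrow> 'b) \<Rightarrow> ('w \<Rightarrow> ennreal) \<Rightarrow> real \<Rightarrow> 'w \<Rightarrow> 'b" where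
  "stopped X T t \<omega> = X (enn2real (min (ennreal t) (T \<omega>))) \<omega>"

text \<open>The initial value is subtracted before localizing, so \<open>X 0\<close> need not be integrable. Path
  properties of the processes attached to a measure \<open>P\<close> are required \<open>P\<close>-almost surely: for the
  raw filtration \<^const>\<open>\<F>\<close>, versions for which they hold on every path need not exist.\<close>

definition continuous_local_martingale ::
  "'k::finite cpath measure \<Rightarrow> (real \<Rightarrow> 'k cpath \<Rightarrow> real) \<Rightarrow> bool" where
  "continuous_local_martingale P X \<longleftrightarrow> adapted X \<and>
     (AE \<omega> in P. continuous_on {0..} (\<lambda>t. X t \<omega>)) \<and>
     (\<exists>T :: nat \<Rightarrow> 'k cpath \<Rightarrow> ennreal.
        (\<forall>n. stopping_time \<F> (T n)) \<and>
        (AE \<omega> in P. incseq (\<lambda>n. T n \<omega>) \<and> (\<lambda>n. T n \<omega>) \<longlonglongrightarrow> \<infinity>) \<and>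
        (\<forall>n. martingale P (\<lambda>t \<omega>. stopped X (T n) t \<omega> - X 0 \<omega>)))"

definition vec_continuous_local_martingale ::
  "'k::finite cpath measure \<Rightarrow> (real \<Rightarrow> 'k cpath \<Rightarrow> real ^ 'd) \<Rightarrow> bool" where
  "vec_continuous_local_martingale P X \<longleftrightarrow>
     (\<forall>i. continuous_local_martingale P (\<lambda>t \<omega>. X t \<omega> $ i))"

definition variation_sums :: "(real \<Rightarrow> 'b::real_normed_vector) \<Rightarrow> real \<Rightarrow> real set" where
  "variation_sums f t =
     {\<Sum>i<n. norm (f (p (Suc i)) - f (p i)) | n p. mono p \<and> range p \<subseteq> {0..t}}"

definition finite_variation :: "(real \<Rightarrow> 'b::real_normed_vector) \<Rightarrow> bool" where
  "finite_variation f \<longleftrightarrow> (\<forall>t\<ge>0. bdd_above (variation_sums f t))"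

definition finite_variation_process ::
  "'k::finite cpath measure \<Rightarrow> (real \<Rightarrow> 'k cpath \<Rightarrow> 'b::real_normed_vector) \<Rightarrow> bool" where
  "finite_variation_process P X \<longleftrightarrow> adapted X \<and> (AE \<omega> in P. finite_variation (\<lambda>t. X t \<omega>))"

definition semimartingale_decomposition ::
  "'k::finite cpath measure \<Rightarrow> (real \<Rightarrow> 'k cpath \<Rightarrow> real ^ 'd) \<Rightarrow>
    (real \<Rightarrow> 'k cpath \<Rightarrow> real ^ 'd) \<Rightarrow> (real \<Rightarrow> 'k cpath \<Rightarrow> real ^ 'd) \<Rightarrow> bool" where
  "semimartingale_decomposition P Y M A \<longleftrightarrow>
     vec_continuous_local_martingale P M \<and> finite_variation_process P A \<and>
     (AE \<omega> in P. \<forall>t\<ge>0. Y t \<omega> = M t \<omega> + A t \<omega>)"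

text \<open>\<open>C\<close> is a version of the matrix-valued process \<open>\<langle>M\<rangle>\<close> under \<open>P\<close>: the (unique up to
  indistinguishability) continuous finite-variation process null at 0 that compensates
  \<open>M M\<^sup>T\<close>.\<close>

definition quadratic_variation ::
  "'k::finite cpath measure \<Rightarrow> (real \<Rightarrow> 'k cpath \<Rightarrow> real ^ 'd) \<Rightarrow>
    (real \<Rightarrow> 'k cpath \<Rightarrow> real ^ 'd ^ 'd) \<Rightarrow> bool" where
  "quadratic_variation P M C \<longleftrightarrow>
     finite_variation_process P C \<and>
     (AE \<omega> in P. C 0 \<omega> = 0 \<and> continuous_on {0..} (\<lambda>t. C t \<omega>)) \<and>
     (\<forall>i j. continuous_local_martingale P (\<lambda>t \<omega>. M t \<omega> $ i * M t \<omega> $ j - C t \<omega> $ i $ j))"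

section \<open>Lebesgue--Stieltjes measures\<close>

text \<open>A function on \<open>[0,\<infinity>)\<close> is extended by its value at 0 to the negative axis, so its differential
  has no atom at 0. \<open>diff_measure f\<close> is the signed measure \<open>df\<close>, as the difference of the measures
  generated by the positive and negative variation of \<open>f\<close>; it is meant to be evaluated at bounded
  Borel sets, where both parts are finite, and for \<open>f\<close> continuous of finite variation.\<close>

definition total_variation :: "(real \<Rightarrow> 'b::real_normed_vector) \<Rightarrow> real \<Rightarrow> real" where
  "total_variation f t = Sup (variation_sums f (max 0 t))"

definition abs_diff_measure :: "(real \<Rightarrow> 'b::real_normed_vector) \<Rightarrow> real measure" where
  "abs_diff_measure f = interval_measure (total_variation f)"

definition diff_measure :: "(real \<Rightarrow> real) \<Rightarrow> real set \<Rightarrow> real" where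
  "diff_measure f B =
     measure (interval_measure (\<lambda>t. (total_variation f t + f (max 0 t)) / 2)) B -
     measure (interval_measure (\<lambda>t. (total_variation f t - f (max 0 t)) / 2)) B"

definition matrix_diff_measure :: "(real \<Rightarrow> real ^ 'd ^ 'd) \<Rightarrow> real set \<Rightarrow> real ^ 'd ^ 'd" where
  "matrix_diff_measure C B = (\<chi> i j. diff_measure (\<lambda>t. C t $ i $ j) B)"

definition matrix_le :: "real ^ 'd ^ 'd \<Rightarrow> real ^ 'd ^ 'd \<Rightarrow> bool" where
  "matrix_le R S \<longleftrightarrow> (\<forall>x. 0 \<le> x \<bullet> ((S - R) *v x))"

text \<open>On an unbounded interval \<open>J\<close> the entries of \<open>dC\<close> need not be finite; the inequalities between
  measures are therefore tested on the bounded Borel subsets of \<open>J\<close>, which determine them.\<close>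

definition bounded_borel_subsets :: "real set \<Rightarrow> real set set" where
  "bounded_borel_subsets J = {B \<in> sets borel. bounded B \<and> B \<subseteq> J}"

definition uniformly_elliptic_on :: "real \<Rightarrow> real set \<Rightarrow> (real \<Rightarrow> real ^ 'd ^ 'd) \<Rightarrow> bool" where
  "uniformly_elliptic_on l J C \<longleftrightarrow>
     (\<forall>B\<in>bounded_borel_subsets J.
        matrix_le ((l * trace (matrix_diff_measure C B)) *\<^sub>R mat 1) (matrix_diff_measure C B)) \<and>
     strict_mono_on J (\<lambda>t. trace (C t))"

definition drift_dominated_on ::
  "real \<Rightarrow> real set \<Rightarrow> (real \<Rightarrow> real ^ 'd ^ 'd) \<Rightarrow> (real \<Rightarrow> real ^ 'd) \<Rightarrow> bool" where
  "drift_dominated_on e J C A \<longleftrightarrow>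
     (\<forall>B\<in>bounded_borel_subsets J.
        trace (matrix_diff_measure C B) \<ge> e * measure (abs_diff_measure A) B)"

end

theory Submission
  imports Defs
begin

text \<open>Fix \<open>P\<close>, let \<open>\<tau>\<close> be the exit time from \<open>Q\<close>, and suppose that \<open>Y\<close> stays in the closure
  of \<open>Q\<close> for a while after \<open>\<tau>\<close>; then \<open>x = Y\<^sub>\<tau>\<close> is a boundary point, touched by a ball \<open>U(z, r)\<close>. Let
  \<open>S > \<tau>\<close> be the first time at which one of the inequalities in the hypothesis, applied to the
  increments since \<open>\<tau>\<close>, fails, or these increments exceed \<open>\<delta>\<close>, or \<open>Y\<close> leaves the closure of \<open>Q\<close>. With
  \<open>v = x - z\<close>, \<open>y = Y\<^sub>S - x\<close>, \<open>m = M\<^sub>S - M\<^sub>\<tau>\<close>, \<open>s\<close> the increment of the trace of \<open>\<langle>M\<rangle>\<close>,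
  \<open>U = \<bar>Y\<^sub>S - z\<bar>\<^sup>2 - r\<^sup>2 = \<bar>y\<bar>\<^sup>2 + 2 v \<bullet> y\<close> is nonnegative and small, and optional sampling of \<open>M\<close> and of
  \<open>M M\<^sup>T - \<langle>M\<rangle>\<close> gives \<open>E[U] \<le> K E[s]\<close>, hence \<open>E[U\<^sup>2]\<close>, \<open>E[\<bar>y\<bar>\<^sup>4]\<close> and so \<open>E[(v \<bullet> m)\<^sup>2]\<close> are at most
  \<open>o(1) E[s]\<close> as \<open>\<delta> \<rightarrow> 0\<close>. But ellipticity gives \<open>E[(v \<bullet> m)\<^sup>2] \<ge> \<lambda> r\<^sup>2 E[s]\<close>. So \<open>s = 0\<close>, although the trace
  is strictly increasing.\<close>

section \<open>Optional sampling for continuous martingales\<close>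

text \<open>The ellipticity and drift constants, the radius and the length of time granted by the
  hypothesis vary with the path, and whether the inequalities hold after \<tau> is not known at
  \<tau>; so expectations cannot be restricted to the paths on which they hold. Instead all
  constants are fixed, at stage k as 1/(k+1); an event \<open>B\<close> records only what is known
  at \<tau>; and the inequalities are enforced by stopping at S, which on some paths equals \<tau>.
  What probability yields at each stage is that almost surely on \<open>B\<close>, if the trace has
  nonzero increments after \<tau>, then failures accumulate at \<tau>. A path that violates the
  theorem contradicts this at a large enough k. There are two small parameters: \<delta>, determined
  by the constants of the stage, and the error \<eta> of a measurably chosen approximate centre,
  which tends to 0 while \<delta> stays fixed. S is an infimum over countably many times, so what is
  guaranteed is that {S < t}, rather than {S \<le> t}, is known at t. Optional sampling is therefore
  developed for such times and for weights in the corresponding right-limit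
  \<sigma>-algebra.\<close>

locale filtered_prob_space = prob_space P for P :: "'a measure" +
  fixes H :: "real \<Rightarrow> 'a measure"
  assumes subalgebra_H: "0 \<le> t \<Longrightarrow> subalgebra P (H t)"
    and H_mono: "0 \<le> s \<Longrightarrow> s \<le> t \<Longrightarrow> subalgebra (H t) (H s)"
begin

lemma space_H: "0 \<le> t \<Longrightarrow> space (H t) = space P"
  using subalgebra_H by (auto simp: subalgebra_def)

lemma measurable_H_mono: "0 \<le> s \<Longrightarrow> s \<le> t \<Longrightarrow> f \<in> measurable (H s) L \<Longrightarrow> f \<in> measurable (H t) L"
  by (rule measurable_from_subalg[OF H_mono])

lemma measurable_H_P: "0 \<le> s \<Longrightarrow> f \<in> measurable (H s) L \<Longrightarrow> f \<in> measurable P L"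
  by (rule measurable_from_subalg[OF subalgebra_H])

definition continuous_adapted :: "(real \<Rightarrow> 'a \<Rightarrow> 'b::metric_space) \<Rightarrow> bool" where
  "continuous_adapted X \<longleftrightarrow> (\<forall>t\<ge>0. X t \<in> borel_measurable (H t)) \<and>
     (\<forall>\<omega>\<in>space P. continuous_on {0..} (\<lambda>t. X t \<omega>))"

definition continuous_martingale :: "(real \<Rightarrow> 'a \<Rightarrow> real) \<Rightarrow> bool" where
  "continuous_martingale N \<longleftrightarrow> continuous_adapted N \<and> (\<forall>t\<ge>0. integrable P (N t)) \<and>
     (\<forall>s t. 0 \<le> s \<longrightarrow> s \<le> t \<longrightarrow> (AE \<omega> in P. real_cond_exp P (H s) (N t) \<omega> = N s \<omega>))"

text \<open>The strict inequality describes stopping times of the right-continuous version of the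
  filtration. An infimum of random times qualifies as soon as the existence of one of them below t
  is decided by countably many events of \<open>H t\<close>.\<close>

definition optional_time :: "('a \<Rightarrow> real) \<Rightarrow> bool" where
  "optional_time \<rho> \<longleftrightarrow> (\<forall>\<omega>\<in>space P. 0 \<le> \<rho> \<omega>) \<and> (\<forall>t\<ge>0. Measurable.pred (H t) (\<lambda>\<omega>. \<rho> \<omega> < t))"

text \<open>\<open>past \<rho> Z\<close> says that \<open>Z\<close> is measurable with respect to the \<open>\<sigma>\<close>-algebra \<open>H\<^bsub>\<rho>+\<^esub>\<close>.\<close>

definition past :: "('a \<Rightarrow> real) \<Rightarrow> ('a \<Rightarrow> real) \<Rightarrow> bool" where
  "past \<rho> Z \<longleftrightarrow> (\<forall>t\<ge>0. (\<lambda>\<omega>. if \<rho> \<omega> < t then Z \<omega> else 0) \<in> borel_measurable (H t))"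

section \<open>Measurability of processes sampled at random times\<close>

lemma optional_time_min_const:
  assumes "optional_time \<rho>" "0 \<le> t"
  shows "(\<lambda>\<omega>. min (\<rho> \<omega>) t) \<in> borel_measurable (H t)"
proof (rule borel_measurableI_less)
  fix u
  have p: "Measurable.pred (H u) (\<lambda>\<omega>. \<rho> \<omega> < u)" if "0 \<le> u"
    using assms that by (auto simp: optional_time_def)
  consider "u < 0" | "0 \<le> u" "u \<le> t" | "t < u" by linarith
  thus "{\<omega> \<in> space (H t). min (\<rho> \<omega>) t < u} \<in> sets (H t)"
  proof cases
    case 1
    hence "{\<omega> \<in> space (H t). min (\<rho> \<omega>) t < u} = {}"
      using assms by (fastforce simp: optional_time_def space_H)
    thus ?thesis by (simp only: sets.empty_sets)
  next
    case 2
    have "Measurable.pred (H t) (\<lambda>\<omega>. \<rho> \<omega> < u)" by (rule measurable_H_mono[OF 2 p[OF 2(1)]])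
    moreover have "{\<omega> \<in> space (H t). min (\<rho> \<omega>) t < u} = {\<omega> \<in> space (H t). \<rho> \<omega> < u}"
      using 2 by auto
    ultimately show ?thesis by (simp add: pred_def)
  next
    case 3
    hence "{\<omega> \<in> space (H t). min (\<rho> \<omega>) t < u} = space (H t)" by auto
    thus ?thesis by simp
  qed
qed

lemma optional_time_pred:
  "optional_time \<rho> \<Longrightarrow> 0 \<le> t \<Longrightarrow> Measurable.pred (H t) (\<lambda>\<omega>. \<rho> \<omega> < t)"
  by (simp add: optional_time_def)

lemma optional_time_nonneg: "optional_time \<rho> \<Longrightarrow> \<omega> \<in> space P \<Longrightarrow> 0 \<le> \<rho> \<omega>"
  by (simp add: optional_time_def)

lemma optional_time_min:
  assumes "optional_time \<rho>" "optional_time \<sigma>"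
  shows "optional_time (\<lambda>\<omega>. min (\<rho> \<omega>) (\<sigma> \<omega>))"
  using assms unfolding optional_time_def min_less_iff_disj
  by (intro conjI ballI allI impI pred_intros_logic) simp_all

text \<open>The random time is approximated from below by grid times: these stay below t, so every
  sampled value is known at t, and continuity of the path gives the limit.\<close>

lemma path_at_measurable:
  fixes X :: "real \<Rightarrow> 'a \<Rightarrow> 'b::metric_space"
  assumes X: "continuous_adapted X" and t: "0 \<le> t" and m: "\<rho> \<in> borel_measurable (H t)"
    and b: "\<And>\<omega>. \<omega> \<in> space P \<Longrightarrow> 0 \<le> \<rho> \<omega>" "\<And>\<omega>. \<omega> \<in> space P \<Longrightarrow> \<rho> \<omega> \<le> t"
  shows "(\<lambda>\<omega>. X (\<rho> \<omega>) \<omega>) \<in> borel_measurable (H t)"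
proof -
  define \<kappa> where "\<kappa> = (\<lambda>m \<omega>. nat \<lfloor>\<rho> \<omega> * (real m + 1)\<rfloor>)"
  show ?thesis
  proof (rule borel_measurable_LIMSEQ_metric)
    fix m :: nat
    have [measurable]: "\<kappa> m \<in> measurable (H t) (count_space UNIV)"
      unfolding \<kappa>_def using m by measurable
    \<comment> \<open>At the actual value of \<open>\<kappa>\<close> the cap at t is void; it makes
      each branch of the countable composition measurable in \<open>H t\<close>.\<close>
    show "(\<lambda>\<omega>. X (min t (real (\<kappa> m \<omega>) / (real m + 1))) \<omega>) \<in> borel_measurable (H t)"
    proof (rule measurable_compose_countable[where f="\<lambda>k \<omega>. X (min t (real k / (real m + 1))) \<omega>"])
      fix k :: nat
      have p: "0 \<le> min t (real k / (real m + 1))" using t by simp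
      have "X (min t (real k / (real m + 1))) \<in> borel_measurable (H (min t (real k / (real m + 1))))"
        using X p unfolding continuous_adapted_def by blast
      thus "X (min t (real k / (real m + 1))) \<in> borel_measurable (H t)"
        by (rule measurable_H_mono[OF p min.cobounded1])
    qed simp
  next
    fix \<omega> assume "\<omega> \<in> space (H t)"
    hence w: "\<omega> \<in> space P" using t by (simp add: space_H)
    let ?x = "\<lambda>m. min t (real (\<kappa> m \<omega>) / (real m + 1))"
    have le: "\<rho> \<omega> - 1 / (real m + 1) \<le> ?x m" "?x m \<le> \<rho> \<omega>" for m
    proof -
      have "0 \<le> \<rho> \<omega> * (real m + 1)" using b(1)[OF w] by simp
      hence k: "real (\<kappa> m \<omega>) \<le> \<rho> \<omega> * (real m + 1)" "\<rho> \<omega> * (real m + 1) \<le> real (\<kappa> m \<omega>) + 1"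
        unfolding \<kappa>_def by linarith+
      have 1: "real (\<kappa> m \<omega>) / (real m + 1) \<le> \<rho> \<omega>" "\<rho> \<omega> \<le> (real (\<kappa> m \<omega>) + 1) / (real m + 1)"
        using k by (auto simp: divide_le_eq le_divide_eq)
      thus "?x m \<le> \<rho> \<omega>" by simp
      have "0 \<le> 1 / (real m + 1)" by simp
      thus "\<rho> \<omega> - 1 / (real m + 1) \<le> ?x m" using 1 b(2)[OF w]
        unfolding add_divide_distrib by linarith
    qed
    have x: "?x \<longlonglongrightarrow> \<rho> \<omega>"
    proof (rule tendsto_sandwich[OF _ _ _ tendsto_const])
      show "(\<lambda>m. \<rho> \<omega> - 1 / (real m + 1)) \<longlonglongrightarrow> \<rho> \<omega>"
        using LIMSEQ_inverse_real_of_nat_add_minus[of "\<rho> \<omega>"]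
        by (simp add: inverse_eq_divide add.commute)
      show "\<forall>\<^sub>F m in sequentially. \<rho> \<omega> - 1 / (real m + 1) \<le> ?x m"
        "\<forall>\<^sub>F m in sequentially. ?x m \<le> \<rho> \<omega>"
        by (intro always_eventually allI le)+
    qed
    have "0 \<le> ?x m" for m using t by simp
    hence pos: "\<forall>\<^sub>F m in sequentially. ?x m \<in> {0..}" by simp
    have "continuous_on {0..} (\<lambda>t. X t \<omega>)" using X w by (simp add: continuous_adapted_def)
    thus "(\<lambda>m. X (?x m) \<omega>) \<longlonglongrightarrow> X (\<rho> \<omega>) \<omega>"
      by (rule continuous_on_tendsto_compose[OF _ x _ pos]) (simp add: b(1)[OF w])
  qed
qed

lemma path_at_optional_measurable:
  assumes X: "continuous_adapted X" and \<rho>: "optional_time \<rho>" and t: "0 \<le> t"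
  shows "(\<lambda>\<omega>. X (min (\<rho> \<omega>) t) \<omega>) \<in> borel_measurable (H t)"
  by (rule path_at_measurable[OF X t optional_time_min_const[OF \<rho> t]])
    (use t optional_time_nonneg[OF \<rho>] in auto)

lemma path_at_optional_measurable_P:
  assumes X: "continuous_adapted X" and \<rho>: "optional_time \<rho>" and K: "\<And>\<omega>. \<rho> \<omega> \<le> K" "0 \<le> K"
  shows "(\<lambda>\<omega>. X (\<rho> \<omega>) \<omega>) \<in> borel_measurable P"
proof -
  have "(\<lambda>\<omega>. X (min (\<rho> \<omega>) K) \<omega>) \<in> borel_measurable P"
    by (rule measurable_H_P[OF K(2) path_at_optional_measurable[OF X \<rho> K(2)]])
  thus ?thesis using K(1) by (simp add: min_absorb1)
qed

section \<open>Weights known at a random time\<close>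

lemma past_path:
  fixes f :: "'b::metric_space \<Rightarrow> real"
  assumes X: "continuous_adapted X" and \<rho>: "optional_time \<rho>"
    and f: "f \<in> borel_measurable borel"
  shows "past \<rho> (\<lambda>\<omega>. f (X (\<rho> \<omega>) \<omega>))"
  unfolding past_def
proof (intro allI impI)
  fix t :: real assume t: "0 \<le> t"
  note [measurable] = optional_time_pred[OF \<rho> t] f
    path_at_optional_measurable[OF X \<rho> t]
  have "(\<lambda>\<omega>. if \<rho> \<omega> < t then f (X (\<rho> \<omega>) \<omega>) else 0) =
      (\<lambda>\<omega>. if \<rho> \<omega> < t then f (X (min (\<rho> \<omega>) t) \<omega>) else 0)" by (auto simp: min_def)
  thus "(\<lambda>\<omega>. if \<rho> \<omega> < t then f (X (\<rho> \<omega>) \<omega>) else 0) \<in> borel_measurable (H t)" by simp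
qed

lemma past_mult:
  assumes "past \<rho> Z" "past \<rho> W"
  shows "past \<rho> (\<lambda>\<omega>. Z \<omega> * W \<omega>)"
  unfolding past_def
proof (intro allI impI)
  fix t :: real assume "0 \<le> t"
  hence [measurable]: "(\<lambda>\<omega>. if \<rho> \<omega> < t then Z \<omega> else 0) \<in> borel_measurable (H t)"
    "(\<lambda>\<omega>. if \<rho> \<omega> < t then W \<omega> else 0) \<in> borel_measurable (H t)"
    using assms by (auto simp: past_def)
  have "(\<lambda>\<omega>. if \<rho> \<omega> < t then Z \<omega> * W \<omega> else 0) =
      (\<lambda>\<omega>. (if \<rho> \<omega> < t then Z \<omega> else 0) * (if \<rho> \<omega> < t then W \<omega> else 0))" by auto
  thus "(\<lambda>\<omega>. if \<rho> \<omega> < t then Z \<omega> * W \<omega> else 0) \<in> borel_measurable (H t)" by simp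
qed

lemma past_less_const:
  assumes "optional_time \<rho>"
  shows "past \<rho> (\<lambda>\<omega>. if \<rho> \<omega> < K then 1 else 0)"
  unfolding past_def
proof (intro allI impI)
  fix t :: real assume t: "0 \<le> t"
  note [measurable] = optional_time_pred[OF assms t] optional_time_min_const[OF assms t]
  have "(\<lambda>\<omega>. if \<rho> \<omega> < t then (if min (\<rho> \<omega>) t < K then 1 else 0) else (0::real)) \<in> borel_measurable (H t)"
    by measurable
  moreover have "(\<lambda>\<omega>. if \<rho> \<omega> < t then (if min (\<rho> \<omega>) t < K then 1 else 0) else (0::real)) =
    (\<lambda>\<omega>. if \<rho> \<omega> < t then (if \<rho> \<omega> < K then 1 else 0) else 0)" by (intro ext) auto
  ultimately show "(\<lambda>\<omega>. if \<rho> \<omega> < t then (if \<rho> \<omega> < K then 1 else 0) else (0::real)) \<in> borel_measurable (H t)"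
    by (simp only:)
qed

lemma past_mono:
  assumes Z: "past \<rho> Z" and \<sigma>: "optional_time \<sigma>" and le: "\<And>\<omega>. \<rho> \<omega> \<le> \<sigma> \<omega>"
  shows "past \<sigma> Z"
  unfolding past_def
proof (intro allI impI)
  fix t :: real assume t: "0 \<le> t"
  note [measurable] = optional_time_pred[OF \<sigma> t]
  have [measurable]: "(\<lambda>\<omega>. if \<rho> \<omega> < t then Z \<omega> else 0) \<in> borel_measurable (H t)"
    using Z t by (auto simp: past_def)
  have "(\<lambda>\<omega>. if \<sigma> \<omega> < t then Z \<omega> else 0) =
      (\<lambda>\<omega>. if \<sigma> \<omega> < t then (if \<rho> \<omega> < t then Z \<omega> else 0) else 0)"
    using le by (intro ext) (auto intro: le_less_trans)
  thus "(\<lambda>\<omega>. if \<sigma> \<omega> < t then Z \<omega> else 0) \<in> borel_measurable (H t)" by simp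
qed

text \<open>This serves localization, where the weight is known at \<rho> but the process is
  followed only until \<sigma>. On \<rho> < \<sigma> the minimum is \<rho>, elsewhere the weight is
  0, and before t the comparison of \<rho> with \<sigma> is decided by the two times truncated at
  t.\<close>

lemma past_restrict_less:
  assumes Z: "past \<rho> Z" and \<rho>: "optional_time \<rho>" and \<sigma>: "optional_time \<sigma>"
  shows "past (\<lambda>\<omega>. min (\<rho> \<omega>) (\<sigma> \<omega>)) (\<lambda>\<omega>. if \<rho> \<omega> < \<sigma> \<omega> then Z \<omega> else 0)"
  unfolding past_def
proof (intro allI impI)
  fix t :: real assume t: "0 \<le> t"
  note [measurable] = optional_time_min_const[OF \<rho> t] optional_time_min_const[OF \<sigma> t]
  have [measurable]: "(\<lambda>\<omega>. if \<rho> \<omega> < t then Z \<omega> else 0) \<in> borel_measurable (H t)"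
    using Z t by (auto simp: past_def)
  have *: "(\<lambda>\<omega>. if min (\<rho> \<omega>) (\<sigma> \<omega>) < t then (if \<rho> \<omega> < \<sigma> \<omega> then Z \<omega> else 0) else 0) =
      (\<lambda>\<omega>. if min (\<rho> \<omega>) t < min (\<sigma> \<omega>) t then (if \<rho> \<omega> < t then Z \<omega> else 0) else 0)"
    by (intro ext) (auto simp: min_def)
  show "(\<lambda>\<omega>. if min (\<rho> \<omega>) (\<sigma> \<omega>) < t then (if \<rho> \<omega> < \<sigma> \<omega> then Z \<omega> else 0) else 0)
    \<in> borel_measurable (H t)" unfolding * by measurable
qed

section \<open>Martingales tested against bounded weights, and sampling\<close>

lemma martingale_test:
  assumes N: "continuous_martingale N" and st: "0 \<le> s" "s \<le> t"
    and V: "V \<in> borel_measurable (H s)" and b: "\<And>\<omega>. \<bar>V \<omega>\<bar> \<le> w"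
  shows "integrable P (\<lambda>\<omega>. V \<omega> * N t \<omega>)"
    "(\<integral>\<omega>. V \<omega> * N t \<omega> \<partial>P) = (\<integral>\<omega>. V \<omega> * N s \<omega> \<partial>P)"
proof -
  interpret finite_measure_subalgebra P "H s"
    by unfold_locales (rule subalgebra_H[OF st(1)])
  have i: "integrable P (N t)" "integrable P (N s)" using N st by (auto simp: continuous_martingale_def)
  note [measurable] = borel_measurable_integrable[OF i(1)] borel_measurable_integrable[OF i(2)]
    measurable_H_P[OF st(1) V]
  show int: "integrable P (\<lambda>\<omega>. V \<omega> * N t \<omega>)"
  proof (rule Bochner_Integration.integrable_bound[OF integrable_mult_right[OF i(1), of w]])
    show "AE \<omega> in P. norm (V \<omega> * N t \<omega>) \<le> norm (w * N t \<omega>)"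
    proof (rule AE_I2)
      fix \<omega>
      have "\<bar>V \<omega>\<bar> \<le> \<bar>w\<bar>" using b[of \<omega>] by linarith
      thus "norm (V \<omega> * N t \<omega>) \<le> norm (w * N t \<omega>)" by (simp add: abs_mult mult_right_mono)
    qed
  qed measurable
  have "(\<integral>\<omega>. V \<omega> * N t \<omega> \<partial>P) = (\<integral>\<omega>. V \<omega> * real_cond_exp P (H s) (N t) \<omega> \<partial>P)"
    by (rule real_cond_exp_intg(2)[OF int V, symmetric]) measurable
  also have "\<dots> = (\<integral>\<omega>. V \<omega> * N s \<omega> \<partial>P)"
  proof (rule integral_cong_AE)
    have "AE \<omega> in P. real_cond_exp P (H s) (N t) \<omega> = N s \<omega>"
      using N st by (auto simp: continuous_martingale_def)
    thus "AE \<omega> in P. V \<omega> * real_cond_exp P (H s) (N t) \<omega> = V \<omega> * N s \<omega>" by auto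
    have [measurable]: "real_cond_exp P (H s) (N t) \<in> borel_measurable P"
      by (rule measurable_H_P[OF st(1)]) simp
    show "(\<lambda>\<omega>. V \<omega> * real_cond_exp P (H s) (N t) \<omega>) \<in> borel_measurable P" by measurable
  qed measurable
  finally show "(\<integral>\<omega>. V \<omega> * N t \<omega> \<partial>P) = (\<integral>\<omega>. V \<omega> * N s \<omega> \<partial>P)" .
qed

text \<open>A tangent line replaces conditional Jensen: the convex function max 0 (|x| - c)
  dominates V x - c |V| for every slope V in {-1, 0, 1}, and the slope chosen at time s gives
  equality at \<open>N s\<close>. The martingale identity with weight V then yields the
  inequality.\<close>

lemma excess_submartingale:
  assumes N: "continuous_martingale N" and st: "0 \<le> s" "s \<le> t"
    and B: "Measurable.pred (H s) B" and c: "0 \<le> c"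
  shows "(\<integral>\<omega>. (if B \<omega> then max 0 (\<bar>N s \<omega>\<bar> - c) else 0) \<partial>P)
    \<le> (\<integral>\<omega>. (if B \<omega> then max 0 (\<bar>N t \<omega>\<bar> - c) else 0) \<partial>P)"
proof -
  define V where "V = (\<lambda>\<omega>. if B \<omega> \<and> c < \<bar>N s \<omega>\<bar> then sgn (N s \<omega>) else 0)"
  note [measurable] = B
  have [measurable]: "N s \<in> borel_measurable (H s)"
    using N st by (auto simp: continuous_martingale_def continuous_adapted_def)
  have V[measurable]: "V \<in> borel_measurable (H s)" unfolding V_def by measurable
  have b: "\<bar>V \<omega>\<bar> \<le> 1" for \<omega> by (auto simp: V_def abs_sgn_eq)
  note [measurable] = measurable_H_P[OF st(1) V] measurable_H_P[OF st(1) B]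
  have i: "integrable P (N t)" "integrable P (N s)" using N st by (auto simp: continuous_martingale_def)
  note [measurable] = borel_measurable_integrable[OF i(1)] borel_measurable_integrable[OF i(2)]
  have iV: "integrable P (\<lambda>\<omega>. c * \<bar>V \<omega>\<bar>)"
    using c b by (intro integrable_const_bound[of _ c]) (auto simp: abs_mult mult_left_le)
  have "(\<integral>\<omega>. (if B \<omega> then max 0 (\<bar>N s \<omega>\<bar> - c) else 0) \<partial>P) = (\<integral>\<omega>. V \<omega> * N s \<omega> - c * \<bar>V \<omega>\<bar> \<partial>P)"
    by (rule Bochner_Integration.integral_cong) (use c in \<open>auto simp: V_def sgn_if\<close>)
  also have "\<dots> = (\<integral>\<omega>. V \<omega> * N t \<omega> - c * \<bar>V \<omega>\<bar> \<partial>P)"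
    using martingale_test[OF N st V b] martingale_test[OF N st(1) order_refl V b] iV by simp
  also have "\<dots> \<le> (\<integral>\<omega>. (if B \<omega> then max 0 (\<bar>N t \<omega>\<bar> - c) else 0) \<partial>P)"
  proof (rule integral_mono)
    show "integrable P (\<lambda>\<omega>. V \<omega> * N t \<omega> - c * \<bar>V \<omega>\<bar>)"
      using martingale_test[OF N st V b] iV by simp
    show "integrable P (\<lambda>\<omega>. if B \<omega> then max 0 (\<bar>N t \<omega>\<bar> - c) else 0)"
      by (rule Bochner_Integration.integrable_bound[OF i(1)]) (use c in auto)
    fix \<omega>
    show "V \<omega> * N t \<omega> - c * \<bar>V \<omega>\<bar> \<le> (if B \<omega> then max 0 (\<bar>N t \<omega>\<bar> - c) else 0)"
      by (auto simp: V_def sgn_if)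
  qed
  finally show ?thesis .
qed

text \<open>The random time is approximated from above by times with values in a grid of mesh \<open>1/(m+1)\<close>.
  The sampled variables are uniformly integrable because \<open>x \<mapsto> (\<bar>x\<bar> - c)\<^sup>+\<close> is convex, so that its
  expectation along the martingale is largest at the terminal time.\<close>

lemma optional_sampling:
  assumes N: "continuous_martingale N" and S: "optional_time S" and K: "\<And>\<omega>. S \<omega> \<le> K" "0 \<le> K"
    and W: "past S W" and w: "\<And>\<omega>. \<bar>W \<omega>\<bar> \<le> w"
  shows "integrable P (\<lambda>\<omega>. N (S \<omega>) \<omega>)" "integrable P (\<lambda>\<omega>. W \<omega> * N (S \<omega>) \<omega>)"
    "(\<integral>\<omega>. W \<omega> * N (S \<omega>) \<omega> \<partial>P) = (\<integral>\<omega>. W \<omega> * N (K + 1) \<omega> \<partial>P)"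
proof -
  \<comment> \<open>The added 1 puts the grid time strictly above S even if S lies on the grid.
    Hence the level k is decided by the strict inequalities for S at two neighbouring grid points,
    and a weight in the past of S is measurable at the grid time.\<close>
  define \<kappa> where "\<kappa> = (\<lambda>m \<omega>. nat \<lfloor>S \<omega> * (real m + 1)\<rfloor> + 1)"
  define g where "g = (\<lambda>m k. real k / (real m + 1))"
  define L where "L = (\<lambda>m. nat \<lfloor>K * (real m + 1)\<rfloor> + 1)"
  define Ns where "Ns = (\<lambda>m \<omega>. N (g m (\<kappa> m \<omega>)) \<omega>)"
  define pos where "pos = (\<lambda>c x::real. max 0 (\<bar>x\<bar> - c))"
  define clip where "clip = (\<lambda>c x::real. max (- c) (min c x))"
  have Na: "continuous_adapted N" using N by (simp add: continuous_martingale_def)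
  have g0: "0 \<le> g m k" for m k by (simp add: g_def)
  have w0: "0 \<le> w" using w[of undefined] by linarith
  have [measurable]: "S \<in> borel_measurable P"
  proof -
    have "(\<lambda>\<omega>. min (S \<omega>) K) \<in> borel_measurable P"
      by (rule measurable_H_P[OF K(2) optional_time_min_const[OF S K(2)]])
    thus ?thesis using K(1) by (simp add: min_absorb1)
  qed
  have \<kappa>m[measurable]: "\<kappa> m \<in> measurable P (count_space UNIV)" for m unfolding \<kappa>_def by measurable
  have NP[measurable]: "N t \<in> borel_measurable P" if "0 \<le> t" for t
    using N that by (simp add: continuous_martingale_def borel_measurable_integrable)
  have NsP[measurable]: "Ns m \<in> borel_measurable P" for m
    unfolding Ns_def
    by (rule measurable_compose_countable[where f="\<lambda>k \<omega>. N (g m k) \<omega>"]) (use g0 in measurable)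
  have NSP[measurable]: "(\<lambda>\<omega>. N (S \<omega>) \<omega>) \<in> borel_measurable P"
    by (rule path_at_optional_measurable_P[OF Na S K])
  have WP[measurable]: "W \<in> borel_measurable P"
  proof -
    have "(\<lambda>\<omega>. if S \<omega> < K + 1 then W \<omega> else 0) \<in> borel_measurable P"
      by (rule measurable_H_P[of "K + 1"]) (use W K(2) in \<open>simp_all add: past_def\<close>)
    moreover have "S \<omega> < K + 1" for \<omega> using K(1)[of \<omega>] by simp
    ultimately show ?thesis by simp
  qed
  \<comment> \<open>A grid time overshoots S by at most one mesh, which is at most 1; hence the
    common terminal time K + 1.\<close>
  have gL: "g m k \<le> K + 1" if "k \<le> L m" for m k
  proof -
    have "0 \<le> K * (real m + 1)" using K(2) by simp
    hence "real (L m) \<le> K * (real m + 1) + 1" unfolding L_def by linarith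
    also have "\<dots> \<le> (K + 1) * (real m + 1)" by (simp add: algebra_simps)
    finally show ?thesis using that unfolding g_def by (simp add: divide_le_eq)
  qed
  have kL: "\<kappa> m \<omega> \<le> L m" for m \<omega>
    unfolding \<kappa>_def L_def using K(1)[of \<omega>]
    by (auto intro!: nat_mono floor_mono mult_right_mono)
  have S_grid: "S \<omega> < g m (\<kappa> m \<omega>)" "g m (\<kappa> m \<omega>) \<le> S \<omega> + 1 / (real m + 1)"
    if "\<omega> \<in> space P" for m \<omega>
  proof -
    have "0 \<le> S \<omega> * (real m + 1)" using optional_time_nonneg[OF S that] by simp
    hence k: "S \<omega> * (real m + 1) < real (\<kappa> m \<omega>)" "real (\<kappa> m \<omega>) \<le> S \<omega> * (real m + 1) + 1"
      unfolding \<kappa>_def by linarith+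
    thus "S \<omega> < g m (\<kappa> m \<omega>)" by (simp add: g_def less_divide_eq)
    have "g m (\<kappa> m \<omega>) \<le> (S \<omega> * (real m + 1) + 1) / (real m + 1)"
      unfolding g_def using k by (intro divide_right_mono) auto
    thus "g m (\<kappa> m \<omega>) \<le> S \<omega> + 1 / (real m + 1)" by (simp add: add_divide_distrib)
  qed
  have lim: "(\<lambda>m. Ns m \<omega>) \<longlonglongrightarrow> N (S \<omega>) \<omega>" if "\<omega> \<in> space P" for \<omega>
  proof -
    have "(\<lambda>m. g m (\<kappa> m \<omega>)) \<longlonglongrightarrow> S \<omega>"
    proof (rule tendsto_sandwich[OF _ _ tendsto_const])
      show "\<forall>\<^sub>F m in sequentially. S \<omega> \<le> g m (\<kappa> m \<omega>)"
        "\<forall>\<^sub>F m in sequentially. g m (\<kappa> m \<omega>) \<le> S \<omega> + 1 / (real m + 1)"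
        by (intro always_eventually allI less_imp_le[OF S_grid(1)[OF that]] S_grid(2)[OF that])+
      show "(\<lambda>m. S \<omega> + 1 / (real m + 1)) \<longlonglongrightarrow> S \<omega>"
        using LIMSEQ_inverse_real_of_nat_add[of "S \<omega>"] by (simp add: inverse_eq_divide add.commute)
    qed
    moreover have "continuous_on {0..} (\<lambda>t. N t \<omega>)" using Na that by (simp add: continuous_adapted_def)
    moreover have "\<forall>\<^sub>F m in sequentially. g m (\<kappa> m \<omega>) \<in> {0..}" using g0 by simp
    ultimately show ?thesis unfolding Ns_def
      using continuous_on_tendsto_compose[of "{0..}" "\<lambda>t. N t \<omega>"] optional_time_nonneg[OF S that] by simp
  qed
  have lvl: "\<kappa> m \<omega> = k \<longleftrightarrow> k \<noteq> 0 \<and> S \<omega> < g m k \<and> \<not> S \<omega> < g m (k - 1)" if "\<omega> \<in> space P" for m k \<omega>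
  proof -
    have 0: "0 \<le> S \<omega> * (real m + 1)" using optional_time_nonneg[OF S that] by simp
    have "\<kappa> m \<omega> = k \<longleftrightarrow> k \<noteq> 0 \<and> \<lfloor>S \<omega> * (real m + 1)\<rfloor> = int (k - 1)"
      unfolding \<kappa>_def using 0 by (cases k) (auto simp: nat_eq_iff)
    also have "\<dots> \<longleftrightarrow> k \<noteq> 0 \<and> real (k - 1) \<le> S \<omega> * (real m + 1) \<and> S \<omega> * (real m + 1) < real k"
      by (cases k) (auto simp: floor_eq_iff)
    also have "\<dots> \<longleftrightarrow> k \<noteq> 0 \<and> S \<omega> < g m k \<and> \<not> S \<omega> < g m (k - 1)"
      unfolding g_def by (auto simp: less_divide_eq not_less divide_le_eq)
    finally show ?thesis .
  qed
  have lvl_pred: "Measurable.pred (H (g m k)) (\<lambda>\<omega>. \<kappa> m \<omega> = k)" for m k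
  proof -
    have [measurable]: "Measurable.pred (H (g m k)) (\<lambda>\<omega>. S \<omega> < g m k)"
      by (rule optional_time_pred[OF S g0])
    have [measurable]: "Measurable.pred (H (g m k)) (\<lambda>\<omega>. S \<omega> < g m (k - 1))"
      by (rule measurable_H_mono[OF g0 _ optional_time_pred[OF S g0]])
        (auto simp: g_def divide_right_mono)
    have "Measurable.pred (H (g m k)) (\<lambda>\<omega>. k \<noteq> 0 \<and> S \<omega> < g m k \<and> \<not> S \<omega> < g m (k - 1))"
      by measurable
    thus ?thesis by (rule measurable_cong[THEN iffD1, rotated]) (simp add: space_H[OF g0] lvl)
  qed
  have lvl_W: "(\<lambda>\<omega>. if \<kappa> m \<omega> = k then W \<omega> else 0) \<in> borel_measurable (H (g m k))" for m k
  proof -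
    note [measurable] = lvl_pred
    have [measurable]: "(\<lambda>\<omega>. if S \<omega> < g m k then W \<omega> else 0) \<in> borel_measurable (H (g m k))"
      using W g0 by (auto simp: past_def)
    have "(\<lambda>\<omega>. if \<kappa> m \<omega> = k then (if S \<omega> < g m k then W \<omega> else 0) else 0) \<in> borel_measurable (H (g m k))"
      by measurable
    thus ?thesis by (rule measurable_cong[THEN iffD1, rotated]) (simp add: space_H[OF g0] lvl)
  qed
  have split: "f (\<kappa> m \<omega>) = (\<Sum>k\<le>L m. if \<kappa> m \<omega> = k then f k else 0)" for f :: "nat \<Rightarrow> real" and m \<omega>
    using kL[of m \<omega>] by simp
  have iN: "integrable P (N t)" if "0 \<le> t" for t using N that by (auto simp: continuous_martingale_def)
  have iK: "integrable P (N (K + 1))" using K(2) by (intro iN) simp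
  have excess: "(\<integral>\<omega>. pos c (Ns m \<omega>) \<partial>P) \<le> (\<integral>\<omega>. pos c (N (K + 1) \<omega>) \<partial>P)"
    "integrable P (\<lambda>\<omega>. pos c (Ns m \<omega>))" if "0 \<le> c" for c m
  proof -
    have i: "integrable P (\<lambda>\<omega>. if \<kappa> m \<omega> = k then pos c (N t \<omega>) else 0)" if "0 \<le> t" for k t
    proof (rule Bochner_Integration.integrable_bound[OF iN[OF that]])
      note [measurable] = NP[OF that]
      show "(\<lambda>\<omega>. if \<kappa> m \<omega> = k then pos c (N t \<omega>) else 0) \<in> borel_measurable P"
        unfolding pos_def by measurable
      show "AE \<omega> in P. norm (if \<kappa> m \<omega> = k then pos c (N t \<omega>) else 0) \<le> norm (N t \<omega>)"
        using \<open>0 \<le> c\<close> by (intro AE_I2) (simp add: pos_def)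
    qed
    have "(\<integral>\<omega>. pos c (Ns m \<omega>) \<partial>P) = (\<Sum>k\<le>L m. \<integral>\<omega>. (if \<kappa> m \<omega> = k then pos c (N (g m k) \<omega>) else 0) \<partial>P)"
      unfolding Ns_def
      by (subst split, rule Bochner_Integration.integral_sum[OF i[OF g0]])
    also have "\<dots> \<le> (\<Sum>k\<le>L m. \<integral>\<omega>. (if \<kappa> m \<omega> = k then pos c (N (K + 1) \<omega>) else 0) \<partial>P)"
      unfolding pos_def using gL that
      by (intro sum_mono excess_submartingale[OF N g0 _ lvl_pred]) auto
    also have "\<dots> = (\<integral>\<omega>. (\<Sum>k\<le>L m. if \<kappa> m \<omega> = k then pos c (N (K + 1) \<omega>) else 0) \<partial>P)"
      using K(2) by (intro Bochner_Integration.integral_sum[symmetric] i) simp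
    also have "\<dots> = (\<integral>\<omega>. pos c (N (K + 1) \<omega>) \<partial>P)"
      by (subst split[symmetric]) simp
    finally show "(\<integral>\<omega>. pos c (Ns m \<omega>) \<partial>P) \<le> (\<integral>\<omega>. pos c (N (K + 1) \<omega>) \<partial>P)" .
    show "integrable P (\<lambda>\<omega>. pos c (Ns m \<omega>))"
      unfolding Ns_def by (subst split, rule Bochner_Integration.integrable_sum[OF i[OF g0]])
  qed
  have grid: "(\<integral>\<omega>. W \<omega> * Ns m \<omega> \<partial>P) = (\<integral>\<omega>. W \<omega> * N (K + 1) \<omega> \<partial>P)" for m
  proof -
    have b: "\<bar>if \<kappa> m \<omega> = k then W \<omega> else 0\<bar> \<le> w" for k \<omega> using w[of \<omega>] w0 by auto
    note t = martingale_test[OF N g0 _ lvl_W b]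
    have "(\<integral>\<omega>. W \<omega> * Ns m \<omega> \<partial>P) = (\<integral>\<omega>. (\<Sum>k\<le>L m. (if \<kappa> m \<omega> = k then W \<omega> else 0) * N (g m k) \<omega>) \<partial>P)"
    proof (rule Bochner_Integration.integral_cong[OF refl])
      fix \<omega>
      show "W \<omega> * Ns m \<omega> = (\<Sum>k\<le>L m. (if \<kappa> m \<omega> = k then W \<omega> else 0) * N (g m k) \<omega>)"
        unfolding Ns_def split[of "\<lambda>k. W \<omega> * N (g m k) \<omega>" m \<omega>] by (intro sum.cong) auto
    qed
    also have "\<dots> = (\<Sum>k\<le>L m. \<integral>\<omega>. (if \<kappa> m \<omega> = k then W \<omega> else 0) * N (g m k) \<omega> \<partial>P)"
      by (rule Bochner_Integration.integral_sum[OF t(1)]) simp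
    also have "\<dots> = (\<Sum>k\<le>L m. \<integral>\<omega>. (if \<kappa> m \<omega> = k then W \<omega> else 0) * N (K + 1) \<omega> \<partial>P)"
      using gL by (intro sum.cong t(2)[symmetric]) auto
    also have "\<dots> = (\<integral>\<omega>. (\<Sum>k\<le>L m. (if \<kappa> m \<omega> = k then W \<omega> else 0) * N (K + 1) \<omega>) \<partial>P)"
      using gL by (intro Bochner_Integration.integral_sum[symmetric] t(1)) auto
    also have "\<dots> = (\<integral>\<omega>. W \<omega> * N (K + 1) \<omega> \<partial>P)"
      using kL by (simp add: sum_distrib_right[symmetric])
    finally show ?thesis .
  qed
  \<comment> \<open>Fatou's lemma: the first moments along the grid are bounded by that of the
    terminal value, which is \<open>excess\<close> at c = 0.\<close>
  show iS: "integrable P (\<lambda>\<omega>. N (S \<omega>) \<omega>)"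
  proof (rule integrableI_bounded)
    have "(\<integral>\<^sup>+\<omega>. ennreal (norm (N (S \<omega>) \<omega>)) \<partial>P) = (\<integral>\<^sup>+\<omega>. liminf (\<lambda>m. ennreal (norm (Ns m \<omega>))) \<partial>P)"
    proof (rule nn_integral_cong)
      fix \<omega> assume "\<omega> \<in> space P"
      hence "(\<lambda>m. ennreal (norm (Ns m \<omega>))) \<longlonglongrightarrow> ennreal (norm (N (S \<omega>) \<omega>))"
        by (intro tendsto_ennrealI tendsto_norm lim)
      from lim_imp_Liminf[OF sequentially_bot this]
      show "ennreal (norm (N (S \<omega>) \<omega>)) = liminf (\<lambda>m. ennreal (norm (Ns m \<omega>)))" by (rule sym)
    qed
    also have "\<dots> \<le> liminf (\<lambda>m. \<integral>\<^sup>+\<omega>. ennreal (norm (Ns m \<omega>)) \<partial>P)"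
      by (rule nn_integral_liminf) measurable
    also have "\<dots> \<le> ennreal (\<integral>\<omega>. \<bar>N (K + 1) \<omega>\<bar> \<partial>P)"
    proof (rule Liminf_le[OF sequentially_bot always_eventually], rule allI)
      fix m
      have p: "pos 0 = (\<lambda>x. \<bar>x\<bar>)" by (auto simp: pos_def)
      note e = excess[OF order_refl, of m, unfolded p]
      show "(\<integral>\<^sup>+\<omega>. ennreal (norm (Ns m \<omega>)) \<partial>P) \<le> ennreal (\<integral>\<omega>. \<bar>N (K + 1) \<omega>\<bar> \<partial>P)"
        using e by (simp add: nn_integral_eq_integral ennreal_leI)
    qed
    also have "\<dots> < \<infinity>" by simp
    finally show "(\<integral>\<^sup>+\<omega>. ennreal (norm (N (S \<omega>) \<omega>)) \<partial>P) < \<infinity>" .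
  qed measurable
  have mono_bound: "norm (W \<omega> * x) \<le> norm (w * y)" if "\<bar>x\<bar> \<le> \<bar>y\<bar>" for \<omega> x y
    using w[of \<omega>] w0 that by (auto simp: abs_mult intro!: mult_mono)
  show iWS: "integrable P (\<lambda>\<omega>. W \<omega> * N (S \<omega>) \<omega>)"
    by (rule Bochner_Integration.integrable_bound[OF integrable_mult_right[OF iS, of w]])
      (use mono_bound in auto)
  let ?I = "\<integral>\<omega>. W \<omega> * N (K + 1) \<omega> \<partial>P"
  have iNs: "integrable P (Ns m)" for m
    using excess(2)[OF order_refl, of m] by (simp add: pos_def integrable_abs_iff)
  \<comment> \<open>Truncation separates the two limits. For fixed c the clipped variables are
    bounded and converge under the integral; clipping costs \<open>pos c\<close>, whose expectation
    is bounded uniformly in m by its terminal value and tends to 0 as c grows.\<close>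
  have close: "\<bar>(\<integral>\<omega>. W \<omega> * clip c (N (S \<omega>) \<omega>) \<partial>P) - ?I\<bar> \<le> w * (\<integral>\<omega>. pos c (N (K + 1) \<omega>) \<partial>P)"
    if c: "0 \<le> c" for c
  proof (rule tendsto_upperbound)
    have [measurable]: "clip c \<in> borel_measurable borel" unfolding clip_def by measurable
    have cc: "continuous_on UNIV (clip c)" unfolding clip_def by (intro continuous_intros)
    have cb: "\<bar>clip c x\<bar> \<le> c" for x using c by (auto simp: clip_def)
    show "(\<lambda>m. \<bar>(\<integral>\<omega>. W \<omega> * clip c (Ns m \<omega>) \<partial>P) - ?I\<bar>)
      \<longlonglongrightarrow> \<bar>(\<integral>\<omega>. W \<omega> * clip c (N (S \<omega>) \<omega>) \<partial>P) - ?I\<bar>"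
    proof (intro tendsto_intros integral_dominated_convergence[where w="\<lambda>_. w * c"])
      show "AE \<omega> in P. (\<lambda>m. W \<omega> * clip c (Ns m \<omega>)) \<longlonglongrightarrow> W \<omega> * clip c (N (S \<omega>) \<omega>)"
        by (intro AE_I2 tendsto_intros continuous_on_tendsto_compose[OF cc] lim) auto
      show "AE \<omega> in P. norm (W \<omega> * clip c (Ns m \<omega>)) \<le> w * c" for m
        using w w0 cb by (auto simp: abs_mult intro!: mult_mono)
    qed auto
    show "\<forall>\<^sub>F m in sequentially. \<bar>(\<integral>\<omega>. W \<omega> * clip c (Ns m \<omega>) \<partial>P) - ?I\<bar>
       \<le> w * (\<integral>\<omega>. pos c (N (K + 1) \<omega>) \<partial>P)"
    proof (rule always_eventually, rule allI)
      fix m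
      have i1: "integrable P (\<lambda>\<omega>. W \<omega> * clip c (Ns m \<omega>))"
        by (rule integrable_const_bound[of _ "w * c"])
          (use w w0 cb in \<open>auto simp: abs_mult intro!: mult_mono\<close>)
      have i2: "integrable P (\<lambda>\<omega>. W \<omega> * Ns m \<omega>)"
        by (rule Bochner_Integration.integrable_bound[OF integrable_mult_right[OF iNs, of w m]])
          (use mono_bound in auto)
      have "\<bar>(\<integral>\<omega>. W \<omega> * clip c (Ns m \<omega>) \<partial>P) - ?I\<bar> = \<bar>\<integral>\<omega>. W \<omega> * clip c (Ns m \<omega>) - W \<omega> * Ns m \<omega> \<partial>P\<bar>"
        using i1 i2 by (simp add: grid)
      also have "\<dots> \<le> (\<integral>\<omega>. \<bar>W \<omega> * clip c (Ns m \<omega>) - W \<omega> * Ns m \<omega>\<bar> \<partial>P)"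
        by (rule integral_abs_bound)
      also have "\<dots> \<le> (\<integral>\<omega>. w * pos c (Ns m \<omega>) \<partial>P)"
      proof (rule integral_mono)
        show "integrable P (\<lambda>\<omega>. w * pos c (Ns m \<omega>))" using excess(2)[OF c] by simp
        show "integrable P (\<lambda>\<omega>. \<bar>W \<omega> * clip c (Ns m \<omega>) - W \<omega> * Ns m \<omega>\<bar>)" using i1 i2 by simp
        fix \<omega>
        have "\<bar>clip c x - x\<bar> = pos c x" for x using c by (auto simp: clip_def pos_def)
        hence "\<bar>W \<omega> * clip c (Ns m \<omega>) - W \<omega> * Ns m \<omega>\<bar> = \<bar>W \<omega>\<bar> * pos c (Ns m \<omega>)"
          by (simp add: right_diff_distrib[symmetric] abs_mult)
        also have "\<dots> \<le> w * pos c (Ns m \<omega>)" using w[of \<omega>] by (intro mult_right_mono) (auto simp: pos_def)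
        finally show "\<bar>W \<omega> * clip c (Ns m \<omega>) - W \<omega> * Ns m \<omega>\<bar> \<le> w * pos c (Ns m \<omega>)" .
      qed
      also have "\<dots> \<le> w * (\<integral>\<omega>. pos c (N (K + 1) \<omega>) \<partial>P)"
        using excess(1)[OF c, of m] w0 by (simp add: mult_left_mono)
      finally show "\<bar>(\<integral>\<omega>. W \<omega> * clip c (Ns m \<omega>) \<partial>P) - ?I\<bar> \<le> w * (\<integral>\<omega>. pos c (N (K + 1) \<omega>) \<partial>P)" .
    qed
  qed simp
  have pos0: "(\<lambda>n. \<integral>\<omega>. pos (real n) (N (K + 1) \<omega>) \<partial>P) \<longlonglongrightarrow> (\<integral>\<omega>. 0 \<partial>P)"
  proof (rule integral_dominated_convergence[where w="\<lambda>\<omega>. \<bar>N (K + 1) \<omega>\<bar>"])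
    have [measurable]: "pos (real n) \<in> borel_measurable borel" for n unfolding pos_def by measurable
    show "(\<lambda>\<omega>. pos (real n) (N (K + 1) \<omega>)) \<in> borel_measurable P" for n
      using borel_measurable_integrable[OF iK] by measurable
    show "AE \<omega> in P. (\<lambda>n. pos (real n) (N (K + 1) \<omega>)) \<longlonglongrightarrow> 0"
    proof (rule AE_I2)
      fix \<omega>
      obtain n0 :: nat where "\<bar>N (K + 1) \<omega>\<bar> \<le> real n0" using real_arch_simple by blast
      hence "\<forall>n\<ge>n0. pos (real n) (N (K + 1) \<omega>) = 0" by (auto simp: pos_def)
      thus "(\<lambda>n. pos (real n) (N (K + 1) \<omega>)) \<longlonglongrightarrow> 0"
        by (intro tendsto_eventually) (auto simp: eventually_sequentially)
    qed
  qed (use iK in \<open>auto simp: pos_def\<close>)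
  have "(\<lambda>n. \<integral>\<omega>. W \<omega> * clip (real n) (N (S \<omega>) \<omega>) \<partial>P) \<longlonglongrightarrow> (\<integral>\<omega>. W \<omega> * N (S \<omega>) \<omega> \<partial>P)"
  proof (rule integral_dominated_convergence[where w="\<lambda>\<omega>. norm (w * N (S \<omega>) \<omega>)"])
    have [measurable]: "clip (real n) \<in> borel_measurable borel" for n unfolding clip_def by measurable
    show "(\<lambda>\<omega>. W \<omega> * clip (real n) (N (S \<omega>) \<omega>)) \<in> borel_measurable P" for n by measurable
    show "integrable P (\<lambda>\<omega>. norm (w * N (S \<omega>) \<omega>))" using iS by simp
    show "AE \<omega> in P. norm (W \<omega> * clip (real n) (N (S \<omega>) \<omega>)) \<le> norm (w * N (S \<omega>) \<omega>)" for n
      by (intro AE_I2 mono_bound) (auto simp: clip_def)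
    show "AE \<omega> in P. (\<lambda>n. W \<omega> * clip (real n) (N (S \<omega>) \<omega>)) \<longlonglongrightarrow> W \<omega> * N (S \<omega>) \<omega>"
    proof (rule AE_I2)
      fix \<omega>
      obtain n0 :: nat where "\<bar>N (S \<omega>) \<omega>\<bar> \<le> real n0" using real_arch_simple by blast
      hence "\<forall>n\<ge>n0. clip (real n) (N (S \<omega>) \<omega>) = N (S \<omega>) \<omega>" by (auto simp: clip_def)
      thus "(\<lambda>n. W \<omega> * clip (real n) (N (S \<omega>) \<omega>)) \<longlonglongrightarrow> W \<omega> * N (S \<omega>) \<omega>"
        by (intro tendsto_eventually) (auto simp: eventually_sequentially)
    qed
  qed measurable
  hence l1: "(\<lambda>n. \<bar>(\<integral>\<omega>. W \<omega> * clip (real n) (N (S \<omega>) \<omega>) \<partial>P) - ?I\<bar>)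
      \<longlonglongrightarrow> \<bar>(\<integral>\<omega>. W \<omega> * N (S \<omega>) \<omega> \<partial>P) - ?I\<bar>" by (intro tendsto_intros)
  have "\<bar>(\<integral>\<omega>. W \<omega> * N (S \<omega>) \<omega> \<partial>P) - ?I\<bar> \<le> w * 0"
    by (rule LIMSEQ_le[OF l1 tendsto_mult_left[OF pos0[unfolded Bochner_Integration.integral_zero]]])
      (use close in auto)
  thus "(\<integral>\<omega>. W \<omega> * N (S \<omega>) \<omega> \<partial>P) = ?I" by simp
qed

end

section \<open>Lebesgue--Stieltjes measures of intervals\<close>

lemma variation_sumsI:
  assumes "mono p" "range p \<subseteq> {0..t}"
  shows "(\<Sum>i<n. norm (f (p (Suc i)) - f (p i))) \<in> variation_sums f t"
  unfolding variation_sums_def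
  by (rule CollectI, rule exI[of _ n], rule exI[of _ p]) (simp add: assms)

lemma variation_sumsE:
  assumes "x \<in> variation_sums f t"
  obtains n p where "mono p" "range p \<subseteq> {0..t}" "x = (\<Sum>i<n. norm (f (p (Suc i)) - f (p i)))"
  using assms unfolding variation_sums_def mem_Collect_eq by (elim exE conjE)

lemma variation_sums_nonempty: "0 \<le> t \<Longrightarrow> variation_sums f t \<noteq> {}"
  using variation_sumsI[of "\<lambda>_. 0" t f 0] by (auto simp: mono_def)

lemma sum_lessThan_add: "(\<Sum>i<m + n. g i) = (\<Sum>i<m. g i) + (\<Sum>i<n. g (m + i))"
  for g :: "nat \<Rightarrow> 'a::comm_monoid_add"
  by (induction n) (auto simp: add.assoc)

text \<open>The hypothesis on g fits both uses: a path restarted at \<tau>, and a single entry of a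
  restarted matrix path, whose increments are bounded by those of the matrix.\<close>

lemma finite_variation_shift:
  assumes "finite_variation f" "0 \<le> \<tau>"
    and g: "\<And>s t. norm (g s - g t) \<le> norm (f (\<tau> + s) - f (\<tau> + t))"
  shows "finite_variation g"
  unfolding finite_variation_def
proof (intro allI impI)
  fix t :: real assume "0 \<le> t"
  hence "bdd_above (variation_sums f (\<tau> + t))" using assms by (simp add: finite_variation_def)
  then obtain b where b: "\<And>x. x \<in> variation_sums f (\<tau> + t) \<Longrightarrow> x \<le> b" by (auto simp: bdd_above_def)
  show "bdd_above (variation_sums g t)"
  proof (rule bdd_aboveI)
    fix x assume "x \<in> variation_sums g t"
    then obtain n p where p: "mono p" "range p \<subseteq> {0..t}" and x: "x = (\<Sum>i<n. norm (g (p (Suc i)) - g (p i)))"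
      by (rule variation_sumsE)
    have "x \<le> (\<Sum>i<n. norm (f (\<tau> + p (Suc i)) - f (\<tau> + p i)))" unfolding x by (rule sum_mono) (rule g)
    also have "\<dots> \<le> b"
    proof (rule b)
      have "mono (\<lambda>i. \<tau> + p i)" "range (\<lambda>i. \<tau> + p i) \<subseteq> {0..\<tau> + t}"
        using p \<open>0 \<le> \<tau>\<close> by (auto simp: mono_def image_subset_iff)
      thus "(\<Sum>i<n. norm (f (\<tau> + p (Suc i)) - f (\<tau> + p i))) \<in> variation_sums f (\<tau> + t)"
        by (rule variation_sumsI[of "\<lambda>i. \<tau> + p i"])
    qed
    finally show "x \<le> b" .
  qed
qed

text \<open>Appending p to an arbitrary partition of [0, t] gives a partition of [0, T]; the
  increment that links the two pieces is dropped.\<close>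

lemma total_variation_concat:
  assumes f: "finite_variation f" and t: "0 \<le> t" "t \<le> T"
    and p: "mono p" "range p \<subseteq> {t..T}"
  shows "total_variation f t + (\<Sum>i<n. norm (f (p (Suc i)) - f (p i))) \<le> total_variation f T"
proof -
  let ?s = "\<Sum>i<n. norm (f (p (Suc i)) - f (p i))"
  have "total_variation f t \<le> total_variation f T - ?s"
    unfolding total_variation_def[of f t]
  proof (rule cSup_least)
    show "variation_sums f (max 0 t) \<noteq> {}" by (rule variation_sums_nonempty) simp
  next
    fix x assume "x \<in> variation_sums f (max 0 t)"
    hence "x \<in> variation_sums f t" using t by simp
    then obtain m q where q: "mono q" "range q \<subseteq> {0..t}" and x: "x = (\<Sum>i<m. norm (f (q (Suc i)) - f (q i)))"
      by (rule variation_sumsE)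
    \<comment> \<open>Index m still belongs to q and p starts at \<open>Suc m\<close>, which leaves
      m increments of q, one linking increment and n increments of p.\<close>
    define r where "r = (\<lambda>i. if i \<le> m then q i else p (i - Suc m))"
    have qt: "0 \<le> q i" "q i \<le> t" for i using range_subsetD[OF q(2), of i] by auto
    have pt: "t \<le> p i" "p i \<le> T" for i using range_subsetD[OF p(2), of i] by auto
    have "mono r"
    proof (rule monoI)
      fix i j :: nat assume "i \<le> j"
      thus "r i \<le> r j"
        using monoD[OF q(1), of i j] monoD[OF p(1), of "i - Suc m" "j - Suc m"] order_trans[OF qt(2)[of i] pt(1)[of "j - Suc m"]]
        by (auto simp: r_def)
    qed
    moreover have "range r \<subseteq> {0..T}"
    proof (intro image_subsetI)
      fix i show "r i \<in> {0..T}" using qt[of i] pt[of "i - Suc m"] t by (auto simp: r_def)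
    qed
    ultimately have "(\<Sum>i<Suc m + n. norm (f (r (Suc i)) - f (r i))) \<in> variation_sums f (max 0 T)"
      using t by (intro variation_sumsI) auto
    moreover have "bdd_above (variation_sums f (max 0 T))" using f by (simp add: finite_variation_def)
    ultimately have le: "(\<Sum>i<Suc m + n. norm (f (r (Suc i)) - f (r i))) \<le> total_variation f T"
      unfolding total_variation_def by (rule cSup_upper)
    have "(\<Sum>i<Suc m + n. norm (f (r (Suc i)) - f (r i))) =
        (\<Sum>i<Suc m. norm (f (r (Suc i)) - f (r i))) + (\<Sum>i<n. norm (f (r (Suc (Suc m + i))) - f (r (Suc m + i))))"
      by (rule sum_lessThan_add)
    also have "(\<Sum>i<n. norm (f (r (Suc (Suc m + i))) - f (r (Suc m + i)))) = ?s"
      by (intro sum.cong) (auto simp: r_def Suc_diff_le)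
    also have "(\<Sum>i<Suc m. norm (f (r (Suc i)) - f (r i))) = x + norm (f (p 0) - f (q m))"
      unfolding x by (auto simp: r_def intro!: sum.cong)
    finally show "x \<le> total_variation f T - ?s" using le norm_ge_zero[of "f (p 0) - f (q m)"] by linarith
  qed
  thus ?thesis by simp
qed

lemma total_variation_increment:
  assumes f: "finite_variation f" and st: "0 \<le> s" "s \<le> t"
  shows "total_variation f s + norm (f t - f s) \<le> total_variation f t"
proof -
  have "mono (\<lambda>i::nat. if i = 0 then s else t :: real)" using st by (auto simp: mono_def)
  moreover have "range (\<lambda>i::nat. if i = 0 then s else t) \<subseteq> {s..t}" using st by auto
  ultimately show ?thesis
    using total_variation_concat[OF f st, of "\<lambda>i. if i = 0 then s else t" 1] by simp
qed

text \<open>A partition of [0, T] that almost attains the total variation is cut at a moving point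
  t. The sum \<open>up t\<close> beyond the cut is continuous in t, and by concatenation it bounds
  the variation on [0, t] from above by what is left of the variation on [0, T]. At t = a this bound
  is within e of the variation on [0, a].\<close>

lemma total_variation_right_continuous:
  assumes f: "finite_variation f" and c: "continuous_on {0..} f"
  shows "continuous (at_right a) (total_variation f)"
proof (cases "a < 0")
  case True
  have "\<forall>\<^sub>F t in at_right a. total_variation f t = total_variation f a"
    using eventually_at_right_less[of a] eventually_at_right[OF True]
    by (auto simp: eventually_at_right_field total_variation_def max_def intro!: exI[of _ 0] True)
  thus ?thesis by (simp add: continuous_within tendsto_eventually)
next
  case False
  hence a: "0 \<le> a" by simp
  define T where "T = a + 1"
  show ?thesis
    unfolding continuous_within
  proof (rule order_tendstoI)
    fix l assume "l < total_variation f a"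
    moreover have "\<forall>\<^sub>F t in at_right a. total_variation f a \<le> total_variation f t"
      using eventually_at_right_less[of a]
    proof eventually_elim
      case (elim t)
      show ?case using total_variation_increment[OF f a, of t] elim norm_ge_zero[of "f t - f a"] by linarith
    qed
    ultimately show "\<forall>\<^sub>F t in at_right a. l < total_variation f t" by (auto elim: eventually_mono)
  next
    fix u assume u: "total_variation f a < u"
    define e where "e = u - total_variation f a"
    have "total_variation f T - e < Sup (variation_sums f (max 0 T))" using u by (simp add: e_def total_variation_def)
    moreover have "variation_sums f (max 0 T) \<noteq> {}" by (rule variation_sums_nonempty) simp
    ultimately obtain x where "x \<in> variation_sums f (max 0 T)" and xl: "total_variation f T - e < x"
      using less_cSupD by metis
    hence "x \<in> variation_sums f T" using a by (simp add: T_def)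
    then obtain n p where p: "mono p" "range p \<subseteq> {0..T}" and x: "x = (\<Sum>i<n. norm (f (p (Suc i)) - f (p i)))"
      by (rule variation_sumsE)
    define up where "up = (\<lambda>t. \<Sum>i<n. norm (f (max (p (Suc i)) t) - f (max (p i) t)))"
    have pT: "0 \<le> p i" "p i \<le> T" for i using range_subsetD[OF p(2), of i] by auto
    have low: "(\<Sum>i<n. norm (f (min (p (Suc i)) a) - f (min (p i) a))) \<le> total_variation f a"
      unfolding total_variation_def
    proof (rule cSup_upper)
      have "mono (\<lambda>i. min (p i) a)" using p(1) by (auto simp: mono_def min_le_iff_disj)
      moreover have "range (\<lambda>i. min (p i) a) \<subseteq> {0..max 0 a}" using pT a by auto
      ultimately show "(\<Sum>i<n. norm (f (min (p (Suc i)) a) - f (min (p i) a))) \<in> variation_sums f (max 0 a)"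
        by (rule variation_sumsI)
      show "bdd_above (variation_sums f (max 0 a))" using f by (simp add: finite_variation_def)
    qed
    have "x \<le> (\<Sum>i<n. norm (f (min (p (Suc i)) a) - f (min (p i) a))) + up a"
      unfolding x up_def sum.distrib[symmetric]
    proof (rule sum_mono)
      fix i
      have m: "p i \<le> p (Suc i)" using p(1) by (simp add: mono_def)
      have "norm (f (p (Suc i)) - f (p i)) \<le> norm (f a - f (p i)) + norm (f (p (Suc i)) - f a)"
        using norm_triangle_ineq[of "f a - f (p i)" "f (p (Suc i)) - f a"] by simp
      thus "norm (f (p (Suc i)) - f (p i)) \<le> norm (f (min (p (Suc i)) a) - f (min (p i) a))
          + norm (f (max (p (Suc i)) a) - f (max (p i) a))"
        using m by (auto simp: min_def max_def)
    qed
    hence ua: "total_variation f T - e < total_variation f a + up a" using xl low by linarith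
    have "continuous_on {0..} up" unfolding up_def
      by (intro continuous_intros continuous_on_compose2[OF c]) auto
    hence "(up \<longlongrightarrow> up a) (at a within {0..})" using a by (simp add: continuous_on_def)
    hence "(up \<longlongrightarrow> up a) (at_right a)" by (rule tendsto_within_subset) (use a in auto)
    moreover have "total_variation f T - total_variation f a - e < up a" using ua by simp
    ultimately have "\<forall>\<^sub>F t in at_right a. total_variation f T - total_variation f a - e < up t"
      by (rule order_tendstoD)
    moreover have "\<forall>\<^sub>F t in at_right a. t < T"
      unfolding eventually_at_right_field by (intro exI[of _ T]) (auto simp: T_def)
    ultimately show "\<forall>\<^sub>F t in at_right a. total_variation f t < u"
      using eventually_at_right_less[of a]
    proof eventually_elim
      case (elim t)
      have "mono (\<lambda>i. max (p i) t)" by (intro monoI max.mono monoD[OF p(1)]) auto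
      moreover have "range (\<lambda>i. max (p i) t) \<subseteq> {t..T}" using pT elim by auto
      ultimately have "total_variation f t + up t \<le> total_variation f T"
        unfolding up_def using elim a by (intro total_variation_concat[OF f]) auto
      thus ?case using elim by (simp add: e_def)
    qed
  qed
qed

lemma total_variation_mono:
  assumes "finite_variation f" "s \<le> t"
  shows "total_variation f s + norm (f (max 0 t) - f (max 0 s)) \<le> total_variation f t"
  using total_variation_increment[OF assms(1), of "max 0 s" "max 0 t"] assms(2)
  by (simp add: total_variation_def)

lemma abs_diff_measure_Ioc:
  assumes "finite_variation f" "continuous_on {0..} f" "0 \<le> t"
  shows "norm (f t - f 0) \<le> measure (abs_diff_measure f) {0<..t}"
proof -
  have "measure (abs_diff_measure f) {0<..t} = total_variation f t - total_variation f 0"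
    unfolding abs_diff_measure_def
  proof (rule measure_interval_measure_Ioc)
    show "total_variation f x \<le> total_variation f y" if "x \<le> y" for x y
      using total_variation_mono[OF assms(1) that] norm_ge_zero[of "f (max 0 y) - f (max 0 x)"] by linarith
  qed (use assms total_variation_right_continuous in auto)
  thus ?thesis using total_variation_increment[OF assms(1) order_refl assms(3)] by simp
qed

text \<open>The two generating functions are nondecreasing because an increment of f is at most the
  increment of its total variation, which cancels in the difference. Half-open intervals are those
  on which \<open>interval_measure\<close> returns the increment of a right-continuous
  function.\<close>

lemma diff_measure_Ioc:
  assumes "finite_variation f" "continuous_on {0..} f" "0 \<le> t"
  shows "diff_measure f {0<..t} = f t - f 0"
proof -
  have c: "continuous (at_right a) (\<lambda>t. f (max 0 t))" for a
  proof -
    have "continuous_on UNIV (\<lambda>t. f (max 0 t))"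
      by (intro continuous_on_compose2[OF assms(2)] continuous_intros) auto
    thus ?thesis by (metis continuous_on_eq_continuous_within UNIV_I continuous_within_subset subset_UNIV)
  qed
  have ineq: "\<bar>f (max 0 y) - f (max 0 x)\<bar> \<le> total_variation f y - total_variation f x" if "x \<le> y" for x y
    using total_variation_mono[OF assms(1) that] by simp
  have "measure (interval_measure (\<lambda>t. (total_variation f t + f (max 0 t)) / 2)) {0<..t}
      = (total_variation f t + f (max 0 t)) / 2 - (total_variation f 0 + f (max 0 0)) / 2"
  proof (rule measure_interval_measure_Ioc[OF assms(3)])
    show "(total_variation f x + f (max 0 x)) / 2 \<le> (total_variation f y + f (max 0 y)) / 2" if "x \<le> y" for x y
      using ineq[OF that] by simp
  qed (intro continuous_intros total_variation_right_continuous[OF assms(1,2)] c; simp)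
  moreover have "measure (interval_measure (\<lambda>t. (total_variation f t - f (max 0 t)) / 2)) {0<..t}
      = (total_variation f t - f (max 0 t)) / 2 - (total_variation f 0 - f (max 0 0)) / 2"
  proof (rule measure_interval_measure_Ioc[OF assms(3)])
    show "(total_variation f x - f (max 0 x)) / 2 \<le> (total_variation f y - f (max 0 y)) / 2" if "x \<le> y" for x y
      using ineq[OF that] by simp
  qed (intro continuous_intros total_variation_right_continuous[OF assms(1,2)] c; simp)
  ultimately show ?thesis using assms(3) by (simp add: diff_measure_def field_simps)
qed

section \<open>Boundary points with an exterior ball\<close>

text \<open>The inequality \<open>dist x z \<le> r\<close>, in fact an equality, makes the set closed.\<close>

definition touching :: "'b::metric_space set \<Rightarrow> real \<Rightarrow> 'b set" where
  "touching Q r = {x \<in> frontier Q. \<exists>z. dist x z \<le> r \<and> (\<forall>y\<in>Q. r \<le> dist z y)}"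

text \<open>The admissible centres form a closed set Z, and in a Heine-Borel space the distance to Z
  is attained; so the existence of a centre within r becomes a closed condition on
  \<open>infdist\<close>. Closedness makes touching a Borel event.\<close>

lemma closed_touching: "closed (touching Q r)" for Q :: "'b::heine_borel set"
proof -
  define Z where "Z = {z. \<forall>y\<in>Q. r \<le> dist z y}"
  have "Z = (\<Inter>y\<in>Q. {z. r \<le> dist z y})" by (auto simp: Z_def)
  moreover have "closed {z. r \<le> dist z y}" for y :: 'b
    by (intro closed_Collect_le continuous_intros)
  ultimately have Z: "closed Z" by (simp add: closed_INT)
  show ?thesis
  proof (cases "Z = {}")
    case True
    hence "touching Q r = {}" unfolding touching_def Z_def by fastforce
    thus ?thesis by simp
  next
    case False
    have "touching Q r = frontier Q \<inter> {x. infdist x Z \<le> r}"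
    proof (intro equalityI subsetI)
      fix x assume "x \<in> touching Q r"
      then obtain z where z: "x \<in> frontier Q" "dist x z \<le> r" "z \<in> Z" by (auto simp: touching_def Z_def)
      thus "x \<in> frontier Q \<inter> {x. infdist x Z \<le> r}" using infdist_le[OF z(3), of x] by simp
    next
      fix x assume x: "x \<in> frontier Q \<inter> {x. infdist x Z \<le> r}"
      obtain z where "z \<in> Z" "infdist x Z = dist x z" using infdist_attains_inf[OF Z False] by blast
      thus "x \<in> touching Q r" using x by (auto simp: touching_def Z_def)
    qed
    moreover have "closed {x. infdist x Z \<le> r}" by (intro closed_Collect_le continuous_intros)
    ultimately show ?thesis by (simp add: closed_Int)
  qed
qed

text \<open>A smaller ball, internally tangent at x with its centre on the segment from x to z, is
  still exterior. Hence radii may be taken from one sequence tending to 0.\<close>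

lemma exterior_ball_touching:
  fixes Q :: "'b::euclidean_space set"
  assumes "exterior_ball_condition Q" "x \<in> frontier Q"
  shows "\<exists>r0>0. \<forall>r. 0 < r \<longrightarrow> r \<le> r0 \<longrightarrow> x \<in> touching Q r"
proof -
  obtain z r0 where r0: "0 < r0" and b: "ball z r0 \<subseteq> - Q" and "x \<in> frontier (ball z r0)"
    using assms unfolding exterior_ball_condition_def by blast
  hence xz: "dist x z = r0" by (simp add: frontier_ball dist_commute)
  have "x \<in> touching Q r" if r: "0 < r" "r \<le> r0" for r
  proof -
    define z' where "z' = x + (r / r0) *\<^sub>R (z - x)"
    have xz': "dist x z' = r"
      using xz r0 r by (simp add: z'_def dist_norm norm_minus_commute)
    have "z - z' = (1 - r / r0) *\<^sub>R (z - x)" by (simp add: z'_def algebra_simps)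
    hence "norm (z - z') = \<bar>1 - r / r0\<bar> * r0" using xz by (simp add: dist_norm norm_minus_commute)
    also have "\<dots> = (1 - r / r0) * r0" using r r0 by simp
    also have "\<dots> = r0 - r" using r0 by (simp add: algebra_simps)
    finally have zz': "dist z z' = r0 - r" by (simp add: dist_norm)
    have "r \<le> dist z' y" if "y \<in> Q" for y
    proof -
      have "y \<notin> ball z r0" using b that by blast
      thus ?thesis using dist_triangle[of z y z'] zz' by simp
    qed
    thus ?thesis using assms(2) xz' by (auto simp: touching_def)
  qed
  thus ?thesis using r0 by blast
qed

text \<open>Near-optimal centres are chosen from a countable dense set, which makes the choice
  measurable; exact centres would require a measurable selection theorem.\<close>

lemma measurable_exterior_centre:
  fixes Q :: "'b::euclidean_space set"
  assumes "0 < \<eta>"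
  obtains g where "g \<in> borel_measurable borel" "\<And>x. x \<in> touching Q r \<Longrightarrow> dist x (g x) \<le> r + \<eta>"
    "\<And>x y. x \<in> touching Q r \<Longrightarrow> y \<in> Q \<Longrightarrow> r - \<eta> \<le> dist (g x) y"
proof -
  obtain D :: "'b set" where D: "countable D" "\<And>X. open X \<Longrightarrow> X \<noteq> {} \<Longrightarrow> \<exists>d\<in>D. d \<in> X"
    using countable_dense_setE by blast
  define e where "e = from_nat_into D"
  define ok where "ok = (\<lambda>k x. dist x (e k) \<le> r + \<eta> \<and> (\<forall>y\<in>Q. r - \<eta> \<le> dist (e k) y))"
  \<comment> \<open>Taking the first admissible index turns the choice into a countably valued Borel
    function; outside the touching set its value is unconstrained.\<close>
  define g where "g = (\<lambda>x. e (LEAST k. ok k x))"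
  have ex: "\<exists>k. ok k x" if "x \<in> touching Q r" for x
  proof -
    obtain z where z: "dist x z \<le> r" "\<forall>y\<in>Q. r \<le> dist z y" using \<open>x \<in> touching Q r\<close> by (auto simp: touching_def)
    obtain d where "d \<in> D" "d \<in> ball z \<eta>" using D(2)[of "ball z \<eta>"] assms by auto
    then obtain k where k: "e k = d" using from_nat_into_surj[OF D(1)] unfolding e_def by blast
    have zd: "dist z d < \<eta>" using \<open>d \<in> ball z \<eta>\<close> by simp
    have "dist x d \<le> r + \<eta>" using z(1) zd dist_triangle[of x d z] by linarith
    moreover have "r - \<eta> \<le> dist d y" if "y \<in> Q" for y
      using z(2) that zd dist_triangle[of z y d] by fastforce
    ultimately show ?thesis using k by (auto simp: ok_def)
  qed
  have "ok (LEAST k. ok k x) x" if "x \<in> touching Q r" for x using LeastI_ex[OF ex[OF that]] .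
  moreover have "g \<in> borel_measurable borel"
  proof -
    have [measurable]: "Measurable.pred borel (ok k)" for k unfolding ok_def by measurable
    have "(\<lambda>x. LEAST k. ok k x) \<in> measurable borel (count_space UNIV)" by measurable
    thus ?thesis unfolding g_def by (rule measurable_compose) simp
  qed
  ultimately show ?thesis using that[of g] by (auto simp: g_def ok_def)
qed

lemma le_dist_closure:
  fixes y :: "'b::metric_space"
  assumes "\<And>y. y \<in> Q \<Longrightarrow> c \<le> dist z y" "y \<in> closure Q"
  shows "c \<le> dist z y"
proof -
  have "closed {y. c \<le> dist z y}" by (intro closed_Collect_le continuous_intros)
  hence "closure Q \<subseteq> {y. c \<le> dist z y}" using assms(1) by (intro closure_minimal) auto
  thus ?thesis using assms(2) by blast
qed

text \<open>With \<open>U = \<bar>y + v\<bar>\<^sup>2 - \<bar>v\<bar>\<^sup>2\<close>, which is almost nonnegative, one has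
  \<open>v \<bullet> m = (U - \<bar>y\<bar>\<^sup>2) / 2 - v \<bullet> a\<close>: the square of \<open>v \<bullet> m\<close> is of smaller order than its
  quadratic variation would require.\<close>

lemma radial_estimate:
  fixes m a v y :: "'b::real_inner"
  assumes y: "y = m + a" and a: "\<epsilon> * norm a \<le> s" and s: "0 \<le> s" "s \<le> \<delta>" and y\<delta>: "norm y \<le> \<delta>"
    and v: "norm v \<le> 2 * r" and low: "norm v ^ 2 - 4 * r * \<eta> \<le> norm (y + v) ^ 2"
    and pos: "0 < \<epsilon>" "0 < r" "0 < \<eta>" "\<eta> \<le> \<delta>"
  shows "(v \<bullet> m)\<^sup>2 \<le> (\<delta>\<^sup>2 + 4 * r * \<delta>) * (2 * (m \<bullet> m) + 2 * (v \<bullet> m) + (2 * \<delta> / \<epsilon>\<^sup>2 + 4 * r / \<epsilon>) * s + 8 * r * \<eta>)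
      + \<delta>\<^sup>2 * (2 * (m \<bullet> m) + 2 * \<delta> / \<epsilon>\<^sup>2 * s) + 12 * r\<^sup>2 * \<delta> / \<epsilon>\<^sup>2 * s"
proof -
  define U where "U = y \<bullet> y + 2 * (v \<bullet> y)"
  define u0 where "u0 = \<delta>\<^sup>2 + 4 * r * \<delta>"
  have \<delta>: "0 < \<delta>" using pos by linarith
  have na: "norm a \<le> s / \<epsilon>" using a pos by (simp add: pos_le_divide_eq mult.commute)
  have aa: "a \<bullet> a \<le> \<delta> / \<epsilon>\<^sup>2 * s"
  proof -
    have "a \<bullet> a \<le> (s / \<epsilon>)\<^sup>2" using power_mono[OF na norm_ge_zero, of 2] by (simp only: power2_norm_eq_inner)
    also have "\<dots> = s * s / \<epsilon>\<^sup>2" by (simp add: power2_eq_square)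
    also have "\<dots> \<le> \<delta> * s / \<epsilon>\<^sup>2" using s by (intro divide_right_mono mult_right_mono) auto
    finally show ?thesis by simp
  qed
  have va: "\<bar>v \<bullet> a\<bar> \<le> 2 * r * norm a"
    using Cauchy_Schwarz_ineq2[of v a] mult_right_mono[OF v norm_ge_zero[of a]] by linarith
  have vy: "\<bar>v \<bullet> y\<bar> \<le> 2 * r * \<delta>"
    using Cauchy_Schwarz_ineq2[of v y] mult_mono[OF v y\<delta>] pos by fastforce
  have yy: "y \<bullet> y \<le> 2 * (m \<bullet> m) + 2 * \<delta> / \<epsilon>\<^sup>2 * s"
  proof -
    have "0 \<le> (m - a) \<bullet> (m - a)" by simp
    hence "y \<bullet> y \<le> 2 * (m \<bullet> m) + 2 * (a \<bullet> a)" unfolding y by (simp add: inner_add_left inner_add_right inner_diff_left inner_diff_right inner_commute)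
    moreover have "2 * \<delta> / \<epsilon>\<^sup>2 * s = 2 * (\<delta> / \<epsilon>\<^sup>2 * s)" by simp
    ultimately show ?thesis using aa by linarith
  qed
  have y2: "y \<bullet> y \<le> \<delta>\<^sup>2" using power_mono[OF y\<delta> norm_ge_zero, of 2] by (simp only: power2_norm_eq_inner)
  have U1: "U \<le> 2 * (m \<bullet> m) + 2 * (v \<bullet> m) + (2 * \<delta> / \<epsilon>\<^sup>2 + 4 * r / \<epsilon>) * s"
  proof -
    have "2 * (v \<bullet> a) \<le> 4 * r * (s / \<epsilon>)"
      using va mult_left_mono[OF na, of "2 * r"] pos by linarith
    moreover have "U = y \<bullet> y + 2 * (v \<bullet> m) + 2 * (v \<bullet> a)" by (simp add: U_def y inner_add_left inner_add_right inner_diff_left inner_diff_right)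
    ultimately show ?thesis using yy by (simp add: algebra_simps)
  qed
  have Ul: "- (4 * r * \<eta>) \<le> U"
    using low by (simp add: U_def power2_norm_eq_inner inner_add_left inner_add_right inner_diff_left inner_diff_right inner_commute)
  have Uu: "U \<le> u0" using y2 vy unfolding U_def u0_def by linarith
  have "r * \<eta> \<le> r * \<delta>" using pos by simp
  hence Ul': "- u0 \<le> U" using Ul zero_le_power2[of \<delta>] unfolding u0_def by linarith
  have u0: "0 \<le> u0" using \<delta> pos by (simp add: u0_def)
  have r\<eta>: "0 \<le> r * \<eta>" using pos by simp
  \<comment> \<open>From U \<ge> -4 r \<eta> follows |U| \<le> U + 8 r \<eta>, and |U| \<le> u0. The
    square is thus bounded by a small multiple of an expression linear in U, whose expectation can
    be computed.\<close>
  have UU: "U\<^sup>2 \<le> u0 * (U + 8 * r * \<eta>)"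
  proof -
    have "U\<^sup>2 = \<bar>U\<bar> * \<bar>U\<bar>" by (simp add: power2_eq_square)
    also have "\<dots> \<le> u0 * \<bar>U\<bar>" using Uu Ul' by (intro mult_right_mono) auto
    also have "\<dots> \<le> u0 * (U + 8 * r * \<eta>)" using Ul u0 r\<eta> by (intro mult_left_mono) auto
    finally show ?thesis .
  qed
  have "v \<bullet> m = U / 2 - (y \<bullet> y) / 2 - v \<bullet> a"
  proof -
    have "v \<bullet> y = v \<bullet> m + v \<bullet> a" by (simp add: y inner_add_right)
    thus ?thesis unfolding U_def by (simp add: field_simps)
  qed
  \<comment> \<open>Cauchy-Schwarz with weights, since 1/4 + 1/4 + 1/3 \<le> 1; the identity
    exhibits the difference as a sum of squares.\<close>
  moreover have "(p / 2 - q / 2 - w)\<^sup>2 \<le> p\<^sup>2 + q\<^sup>2 + 3 * w\<^sup>2" for p q w :: real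
  proof -
    have "p\<^sup>2 + q\<^sup>2 + 3 * w\<^sup>2 - (p / 2 - q / 2 - w)\<^sup>2 =
        (p + q)\<^sup>2 / 4 + (p / 2 + w)\<^sup>2 + (q / 2 - w)\<^sup>2 + (p\<^sup>2 + q\<^sup>2) / 4"
      by (simp add: power2_eq_square field_simps)
    moreover have "0 \<le> (p + q)\<^sup>2 / 4 + (p / 2 + w)\<^sup>2 + (q / 2 - w)\<^sup>2 + (p\<^sup>2 + q\<^sup>2) / 4" by simp
    ultimately show ?thesis by linarith
  qed
  ultimately have "(v \<bullet> m)\<^sup>2 \<le> U\<^sup>2 + (y \<bullet> y)\<^sup>2 + 3 * (v \<bullet> a)\<^sup>2" by metis
  moreover have "(y \<bullet> y)\<^sup>2 \<le> \<delta>\<^sup>2 * (2 * (m \<bullet> m) + 2 * \<delta> / \<epsilon>\<^sup>2 * s)"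
  proof -
    have "(y \<bullet> y)\<^sup>2 = (y \<bullet> y) * (y \<bullet> y)" by (simp add: power2_eq_square)
    also have "\<dots> \<le> \<delta>\<^sup>2 * (y \<bullet> y)" using y2 by (intro mult_right_mono) auto
    also have "\<dots> \<le> \<delta>\<^sup>2 * (2 * (m \<bullet> m) + 2 * \<delta> / \<epsilon>\<^sup>2 * s)" using yy by (intro mult_left_mono) auto
    finally show ?thesis .
  qed
  moreover have "3 * (v \<bullet> a)\<^sup>2 \<le> 12 * r\<^sup>2 * \<delta> / \<epsilon>\<^sup>2 * s"
  proof -
    have "(v \<bullet> a)\<^sup>2 \<le> (2 * r * norm a)\<^sup>2" using va by (metis abs_le_square_iff abs_of_nonneg abs_ge_zero order_trans)
    also have "\<dots> = 4 * r\<^sup>2 * (a \<bullet> a)" by (simp add: power_mult_distrib power2_norm_eq_inner)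
    also have "\<dots> \<le> 4 * r\<^sup>2 * (\<delta> / \<epsilon>\<^sup>2 * s)" using aa by (intro mult_left_mono) auto
    finally show ?thesis by simp
  qed
  moreover have "u0 * (U + 8 * r * \<eta>) \<le> u0 * (2 * (m \<bullet> m) + 2 * (v \<bullet> m) + (2 * \<delta> / \<epsilon>\<^sup>2 + 4 * r / \<epsilon>) * s + 8 * r * \<eta>)"
    using U1 u0 by (intro mult_left_mono) auto
  ultimately show ?thesis using UU unfolding u0_def[symmetric] by linarith
qed

section \<open>Exit times\<close>

lemma exit_time_less_iff:
  "exit_time Y D \<omega> < ennreal t \<longleftrightarrow> (\<exists>s\<ge>0. s < t \<and> Y s \<omega> \<notin> D)"
  unfolding exit_time_def INF_less_iff by (auto simp: ennreal_less_iff)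

lemma before_exit_time:
  assumes "0 \<le> t" "ennreal t < exit_time Y D \<omega>"
  shows "Y t \<omega> \<in> D"
  using assms INF_lower[of t "{t. 0 \<le> t \<and> Y t \<omega> \<in> - D}" ennreal]
  unfolding exit_time_def by force

lemma exit_time_mono: "D \<subseteq> E \<Longrightarrow> exit_time Y D \<omega> \<le> exit_time Y E \<omega>"
  unfolding exit_time_def by (intro INF_superset_mono) auto

lemma exit_time_attained:
  fixes Y :: "real \<Rightarrow> 'w \<Rightarrow> 'b::topological_space"
  assumes c: "continuous_on {0..} (\<lambda>t. Y t \<omega>)" and D: "open D" and fin: "exit_time Y D \<omega> < \<infinity>"
  obtains \<tau> where "0 \<le> \<tau>" "exit_time Y D \<omega> = ennreal \<tau>" "Y \<tau> \<omega> \<notin> D"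
proof -
  define E where "E = {t. 0 \<le> t \<and> Y t \<omega> \<in> - D}"
  have E: "E = {0..} \<inter> (\<lambda>t. Y t \<omega>) -` (- D)" by (auto simp: E_def)
  have cl: "closed E" unfolding E
    by (rule continuous_closed_preimage[OF c]) (use D in auto)
  have ne: "E \<noteq> {}"
  proof
    assume "E = {}"
    hence "exit_time Y D \<omega> = \<infinity>" unfolding exit_time_def E_def[symmetric] by simp
    thus False using fin by simp
  qed
  have bdd: "bdd_below E" by (auto simp: E_def bdd_below_def)
  have mem: "Inf E \<in> E" by (rule closed_contains_Inf[OF ne bdd cl])
  have "exit_time Y D \<omega> = ennreal (Inf E)"
    unfolding exit_time_def E_def[symmetric]
  proof (rule antisym)
    show "(INF t\<in>E. ennreal t) \<le> ennreal (Inf E)" by (rule INF_lower[OF mem])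
    show "ennreal (Inf E) \<le> (INF t\<in>E. ennreal t)"
      by (intro INF_greatest ennreal_leI cInf_lower bdd)
  qed
  thus ?thesis using that mem by (auto simp: E_def)
qed

text \<open>The exit from an open set is attained, so the path is already outside Q at that time,
  while the later exit from the closure keeps it in the closure.\<close>

lemma exit_before_closure:
  fixes Y :: "real \<Rightarrow> 'w \<Rightarrow> 'b::topological_space"
  assumes c: "continuous_on {0..} (\<lambda>t. Y t \<omega>)" and Q: "open Q"
    and less: "exit_time Y Q \<omega> < exit_time Y (closure Q) \<omega>"
  obtains \<tau> where "0 \<le> \<tau>" "exit_time Y Q \<omega> = ennreal \<tau>" "Y \<tau> \<omega> \<in> frontier Q"
proof -
  have "exit_time Y Q \<omega> < \<infinity>" using less by (metis infinity_ennreal_def order_less_le_trans top_greatest)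
  then obtain \<tau> where t: "0 \<le> \<tau>" "exit_time Y Q \<omega> = ennreal \<tau>" "Y \<tau> \<omega> \<notin> Q"
    by (rule exit_time_attained[where Y=Y and \<omega>=\<omega>, OF c Q])
  have "Y \<tau> \<omega> \<in> closure Q" using before_exit_time[OF t(1)] less t(2) by metis
  thus ?thesis using that[OF t(1,2)] t(3) Q by (simp add: frontier_def interior_open)
qed

lemma pred_countable_Ball:
  assumes "countable X" "\<And>i. i \<in> X \<Longrightarrow> Measurable.pred L (P i)"
  shows "Measurable.pred L (\<lambda>x. \<forall>i\<in>X. P i x)"
proof -
  have "{x \<in> space L. \<forall>i\<in>X. P i x} \<in> sets L"
    by (rule sets.sets_Collect_countable_All'[OF _ assms(1)]) (use assms(2) in \<open>simp add: pred_def\<close>)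
  thus ?thesis by (simp add: pred_def)
qed

section \<open>Exit times as optional times\<close>

context filtered_prob_space
begin

text \<open>Staying in the open set Q on [0, t) means that on each compact interval [0, t - 1/(n+1)]
  the distance to the complement has a positive minimum, hence a lower bound 1/(k+1). By continuity
  this bound need only be checked at rational times.\<close>

lemma exit_time_pred:
  fixes Y :: "real \<Rightarrow> 'a \<Rightarrow> 'b::metric_space"
  assumes Y: "continuous_adapted Y" and Q: "open Q" "Q \<noteq> UNIV" and t: "0 \<le> t"
  shows "Measurable.pred (H t) (\<lambda>\<omega>. exit_time Y Q \<omega> < ennreal t)"
proof -
  let ?d = "\<lambda>q \<omega>. infdist (Y q \<omega>) (- Q)"
  have ne: "- Q \<noteq> {}" using Q by auto
  have clQ: "closed (- Q)" using Q(1) by (rule closed_Compl)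
  have pos: "0 < infdist x (- Q) \<longleftrightarrow> x \<in> Q" for x
    using in_closed_iff_infdist_zero[OF clQ ne, of x] infdist_nonneg[of x "- Q"] by (auto simp: less_le)
  have eq: "exit_time Y Q \<omega> < ennreal t \<longleftrightarrow>
      \<not> (\<forall>n::nat. \<exists>k::nat. \<forall>q\<in>\<rat> \<inter> {0..t}. q \<le> t - 1 / (real n + 1) \<longrightarrow> 1 / (real k + 1) \<le> ?d q \<omega>)"
    if w: "\<omega> \<in> space P" for \<omega>
  proof -
    have c: "continuous_on {0..} (\<lambda>t. ?d t \<omega>)"
      using Y w by (intro continuous_intros) (auto simp: continuous_adapted_def)
    have "(\<forall>s\<ge>0. s < t \<longrightarrow> Y s \<omega> \<in> Q) \<longleftrightarrow>
      (\<forall>n::nat. \<exists>k::nat. \<forall>q\<in>\<rat> \<inter> {0..t}. q \<le> t - 1 / (real n + 1) \<longrightarrow> 1 / (real k + 1) \<le> ?d q \<omega>)"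
    proof (intro iffI allI impI)
      fix n :: nat assume in_Q: "\<forall>s\<ge>0. s < t \<longrightarrow> Y s \<omega> \<in> Q"
      let ?I = "{0..t - 1 / (real n + 1)}"
      show "\<exists>k::nat. \<forall>q\<in>\<rat> \<inter> {0..t}. q \<le> t - 1 / (real n + 1) \<longrightarrow> 1 / (real k + 1) \<le> ?d q \<omega>"
      proof (cases "?I = {}")
        case True
        thus ?thesis by fastforce
      next
        case False
        have "continuous_on ?I (\<lambda>t. ?d t \<omega>)" by (rule continuous_on_subset[OF c]) auto
        then obtain s where s: "s \<in> ?I" "\<And>q. q \<in> ?I \<Longrightarrow> ?d s \<omega> \<le> ?d q \<omega>"
          using continuous_attains_inf[OF compact_Icc False] by blast
        have "0 < 1 / (real n + 1)" by simp
        hence "Y s \<omega> \<in> Q" using in_Q s(1) by (metis atLeastAtMost_iff diff_less_eq less_add_same_cancel1 order_le_less_trans)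
        hence "0 < ?d s \<omega>" by (simp add: pos)
        then obtain k where "inverse (real (Suc k)) < ?d s \<omega>" using reals_Archimedean by blast
        hence "1 / (real k + 1) \<le> ?d s \<omega>" by (simp add: inverse_eq_divide add.commute)
        thus ?thesis using s(2) by (meson IntD2 atLeastAtMost_iff order_trans)
      qed
    next
      fix s assume A: "\<forall>n::nat. \<exists>k::nat. \<forall>q\<in>\<rat> \<inter> {0..t}. q \<le> t - 1 / (real n + 1) \<longrightarrow> 1 / (real k + 1) \<le> ?d q \<omega>"
        and s: "0 \<le> s" "s < t"
      obtain n where "inverse (real (Suc n)) < t - s" using reals_Archimedean[of "t - s"] s by auto
      hence n: "s < t - 1 / (real n + 1)" by (simp add: inverse_eq_divide add.commute)
      obtain k where k: "\<And>q. q \<in> \<rat> \<Longrightarrow> 0 \<le> q \<Longrightarrow> q \<le> t - 1 / (real n + 1) \<Longrightarrow> 1 / (real k + 1) \<le> ?d q \<omega>"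
      proof -
        obtain k where k: "\<forall>q\<in>\<rat> \<inter> {0..t}. q \<le> t - 1 / (real n + 1) \<longrightarrow> 1 / (real k + 1) \<le> ?d q \<omega>" using A by blast
        show ?thesis
        proof (rule that)
          fix q assume q: "q \<in> \<rat>" "0 \<le> q" "q \<le> t - 1 / (real n + 1)"
          have "0 \<le> 1 / (real n + 1)" by simp
          hence "q \<le> t" using q(3) by linarith
          thus "1 / (real k + 1) \<le> ?d q \<omega>" using k q by simp
        qed
      qed
      \<comment> \<open>A smaller value at s would persist, by right continuity, at rational times
        shortly after s.\<close>
      have "1 / (real k + 1) \<le> ?d s \<omega>"
      proof (rule ccontr)
        assume "\<not> ?thesis"
        hence "?d s \<omega> < 1 / (real k + 1)" by simp
        moreover have "((\<lambda>t. ?d t \<omega>) \<longlongrightarrow> ?d s \<omega>) (at s within {0..})" using c s by (simp add: continuous_on_def)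
        hence "((\<lambda>t. ?d t \<omega>) \<longlongrightarrow> ?d s \<omega>) (at_right s)" by (rule tendsto_within_subset) (use s in auto)
        ultimately have "\<forall>\<^sub>F q in at_right s. ?d q \<omega> < 1 / (real k + 1)" by (rule order_tendstoD(2)[rotated])
        then obtain b where b: "s < b" "\<And>q. s < q \<Longrightarrow> q < b \<Longrightarrow> ?d q \<omega> < 1 / (real k + 1)"
          unfolding eventually_at_right_field by blast
        obtain q where "q \<in> \<rat>" "s < q" "q < min b (t - 1 / (real n + 1))"
          using Rats_dense_in_real[of s "min b (t - 1 / (real n + 1))"] b(1) n by auto
        thus False using b(2)[of q] k[of q] s by simp
      qed
      moreover have "0 < 1 / (real k + 1)" by simp
      ultimately show "Y s \<omega> \<in> Q" using pos[of "Y s \<omega>"] by linarith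
    qed
    thus ?thesis unfolding exit_time_less_iff by blast
  qed
  have "Measurable.pred (H t) (\<lambda>\<omega>.
     \<not> (\<forall>n::nat. \<exists>k::nat. \<forall>q\<in>\<rat> \<inter> {0..t}. q \<le> t - 1 / (real n + 1) \<longrightarrow> 1 / (real k + 1) \<le> ?d q \<omega>))"
  proof -
    have p: "Measurable.pred (H t) (\<lambda>\<omega>. q \<le> u \<longrightarrow> 1 / (real k + 1) \<le> ?d q \<omega>)"
      if q: "q \<in> \<rat> \<inter> {0..t}" for q u and k :: nat
    proof -
      have "Y q \<in> borel_measurable (H q)" using Y q by (simp add: continuous_adapted_def)
      hence "Y q \<in> borel_measurable (H t)" by (rule measurable_H_mono[rotated 2]) (use q in auto)
      hence [measurable]: "(\<lambda>\<omega>. ?d q \<omega>) \<in> borel_measurable (H t)"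
        by (rule measurable_compose) (intro borel_measurable_continuous_onI continuous_intros)
      show ?thesis by measurable
    qed
    have "countable (\<rat> \<inter> {0..t})" using countable_rat by (rule countable_Int1)
    hence "Measurable.pred (H t) (\<lambda>\<omega>. \<forall>q\<in>\<rat> \<inter> {0..t}. q \<le> u \<longrightarrow> 1 / (real k + 1) \<le> ?d q \<omega>)"
      for u and k :: nat using p by (rule pred_countable_Ball)
    thus ?thesis by (intro pred_intros_logic(2) pred_intros_countable)
  qed
  thus ?thesis by (rule measurable_cong[THEN iffD1, rotated]) (simp add: space_H[OF t] eq)
qed

lemma exit_time_optional:
  fixes Y :: "real \<Rightarrow> 'a \<Rightarrow> 'b::metric_space"
  assumes Y: "continuous_adapted Y" and Q: "open Q" "Q \<noteq> UNIV" and K: "0 \<le> K"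
  shows "optional_time (\<lambda>\<omega>. enn2real (min (exit_time Y Q \<omega>) (ennreal K)))"
  unfolding optional_time_def
proof (intro conjI ballI allI impI)
  fix t :: real assume t: "0 \<le> t"
  have "enn2real (min x (ennreal K)) < t \<longleftrightarrow> x < ennreal t \<or> K < t" for x
  proof -
    have "min x (ennreal K) < top" by (simp add: min_less_iff_disj)
    hence "ennreal (enn2real (min x (ennreal K))) = min x (ennreal K)" by simp
    hence "enn2real (min x (ennreal K)) < t \<longleftrightarrow> min x (ennreal K) < ennreal t"
      by (metis ennreal_less_iff enn2real_nonneg)
    thus ?thesis using K by (simp add: min_less_iff_disj ennreal_less_iff)
  qed
  thus "Measurable.pred (H t) (\<lambda>\<omega>. enn2real (min (exit_time Y Q \<omega>) (ennreal K)) < t)"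
    using exit_time_pred[OF Y Q t] by (simp add: pred_intros_logic)
qed simp

end

section \<open>The quadratic variation after hitting the boundary\<close>

text \<open>The arguments D, a, y are increments of C, A, Y since \<tau>, and w is the current
  position. All inequalities are non-strict and the closure of Q is used, so that the good data form
  a closed set and goodness passes to limits of times.\<close>

definition good_increment ::
  "(real ^ 'd) set \<Rightarrow> real \<Rightarrow> real \<Rightarrow> real \<Rightarrow> real ^ 'd ^ 'd \<Rightarrow> real ^ 'd \<Rightarrow> real ^ 'd \<Rightarrow> real ^ 'd \<Rightarrow> bool" where
  "good_increment Q \<epsilon> l \<delta> D a y w \<longleftrightarrow> 0 \<le> trace D \<and> trace D \<le> \<delta> \<and> \<epsilon> * norm a \<le> trace D \<and>
     (\<forall>v. l * (v \<bullet> v) * trace D \<le> v \<bullet> (D *v v)) \<and> norm y \<le> \<delta> \<and> w \<in> closure Q"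

text \<open>The total coefficient of \<open>s\<close> in the bound of \<open>radial_estimate\<close> once \<open>m \<bullet> m\<close> is replaced by \<open>s\<close>,
  with which it agrees in expectation.\<close>

definition remainder_rate :: "real \<Rightarrow> real \<Rightarrow> real \<Rightarrow> real" where
  "remainder_rate \<epsilon> r \<delta> = 2 * (\<delta>\<^sup>2 + 4 * r * \<delta>) + 2 * \<delta>\<^sup>2 +
     (\<delta>\<^sup>2 + 4 * r * \<delta>) * (2 * \<delta> / \<epsilon>\<^sup>2 + 4 * r / \<epsilon>) + \<delta>\<^sup>2 * (2 * \<delta> / \<epsilon>\<^sup>2) + 12 * r\<^sup>2 * \<delta> / \<epsilon>\<^sup>2"

text \<open>Every summand carries a positive power of \<delta>.\<close>

lemma remainder_rate_small:
  assumes "0 < \<epsilon>" "0 < c"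
  shows "\<exists>\<delta>>0. remainder_rate \<epsilon> r \<delta> \<le> c"
proof -
  have "(remainder_rate \<epsilon> r \<longlongrightarrow> 0) (at_right 0)"
    unfolding remainder_rate_def[abs_def] using assms by (auto intro!: tendsto_eq_intros)
  hence "\<forall>\<^sub>F \<delta> in at_right 0. remainder_rate \<epsilon> r \<delta> < c" using assms by (intro order_tendstoD(2)) auto
  then obtain b where "0 < b" "\<And>\<delta>. 0 < \<delta> \<Longrightarrow> \<delta> < b \<Longrightarrow> remainder_rate \<epsilon> r \<delta> < c"
    unfolding eventually_at_right_field by blast
  thus ?thesis by (intro exI[of _ "b / 2"]) (auto intro: less_imp_le)
qed

section \<open>Expectations of increments and the main estimate\<close>

lemma inner_matrix_vector: "v \<bullet> (D *v v) = (\<Sum>i\<in>UNIV. \<Sum>j\<in>UNIV. v $ i * v $ j * D $ i $ j)"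
  for v :: "real ^ 'd"
  by (simp add: inner_vec_def matrix_vector_mult_def sum_distrib_left mult_ac)

lemma inner_square: "(v \<bullet> m)\<^sup>2 = (\<Sum>i\<in>UNIV. \<Sum>j\<in>UNIV. v $ i * v $ j * (m $ i * m $ j))"
  for v m :: "real ^ 'd"
  by (simp add: inner_vec_def power2_eq_square sum_product mult_ac)

context filtered_prob_space
begin

text \<open>The martingale N represents X only up to R, and Z is known at \<tau> but perhaps not at
  the minimum of \<tau> and R. Restricting Z to \<tau> < R repairs this at no cost, because
  elsewhere the increment is 0. Both sampled values, with this weight, have the expectation of the
  weighted terminal value, so the difference integrates to 0.\<close>

lemma sampled_increment:
  assumes N: "continuous_martingale N" and \<tau>: "optional_time \<tau>" and S: "optional_time S" and R: "optional_time R"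
    and \<tau>S: "\<And>\<omega>. \<tau> \<omega> \<le> S \<omega>" and K: "\<And>\<omega>. S \<omega> \<le> K" "0 \<le> K"
    and agree: "\<And>\<omega> t. \<omega> \<in> space P \<Longrightarrow> 0 \<le> t \<Longrightarrow> t \<le> R \<omega> \<Longrightarrow> N t \<omega> = X t \<omega> - X 0 \<omega>"
    and Z: "past \<tau> Z" "\<And>\<omega>. \<bar>Z \<omega>\<bar> \<le> z"
  shows "has_bochner_integral P
    (\<lambda>\<omega>. Z \<omega> * (X (min (S \<omega>) (R \<omega>)) \<omega> - X (min (\<tau> \<omega>) (R \<omega>)) \<omega>)) 0"
proof -
  define \<tau>' where "\<tau>' = (\<lambda>\<omega>. min (\<tau> \<omega>) (R \<omega>))"
  define S' where "S' = (\<lambda>\<omega>. min (S \<omega>) (R \<omega>))"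
  define Z' where "Z' = (\<lambda>\<omega>. if \<tau> \<omega> < R \<omega> then Z \<omega> else 0)"
  have o: "optional_time \<tau>'" "optional_time S'"
    unfolding \<tau>'_def S'_def by (intro optional_time_min \<tau> S R)+
  have le: "\<tau>' \<omega> \<le> S' \<omega>" "S' \<omega> \<le> K" "\<tau>' \<omega> \<le> K" for \<omega>
    using \<tau>S[of \<omega>] K(1)[of \<omega>] by (auto simp: \<tau>'_def S'_def)
  have p: "past \<tau>' Z'" unfolding \<tau>'_def Z'_def by (rule past_restrict_less[OF Z(1) \<tau> R])
  have p': "past S' Z'" by (rule past_mono[OF p o(2) le(1)])
  have b: "\<bar>Z' \<omega>\<bar> \<le> z" for \<omega> using Z(2)[of \<omega>] by (auto simp: Z'_def)
  note s1 = optional_sampling[OF N o(1) le(3) K(2) p b] and s2 = optional_sampling[OF N o(2) le(2) K(2) p' b]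
  have "has_bochner_integral P (\<lambda>\<omega>. Z' \<omega> * N (S' \<omega>) \<omega> - Z' \<omega> * N (\<tau>' \<omega>) \<omega>) 0"
    using s1 s2 by (simp add: has_bochner_integral_iff)
  moreover have "Z' \<omega> * N (S' \<omega>) \<omega> - Z' \<omega> * N (\<tau>' \<omega>) \<omega> =
      Z \<omega> * (X (min (S \<omega>) (R \<omega>)) \<omega> - X (min (\<tau> \<omega>) (R \<omega>)) \<omega>)" if w: "\<omega> \<in> space P" for \<omega>
  proof (cases "\<tau> \<omega> < R \<omega>")
    case True
    have "0 \<le> \<tau>' \<omega>" "0 \<le> S' \<omega>" using o w by (auto intro: optional_time_nonneg)
    hence "N (S' \<omega>) \<omega> = X (S' \<omega>) \<omega> - X 0 \<omega>" "N (\<tau>' \<omega>) \<omega> = X (\<tau>' \<omega>) \<omega> - X 0 \<omega>"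
      by (auto intro!: agree[OF w] simp: \<tau>'_def S'_def)
    hence "N (S' \<omega>) \<omega> - N (\<tau>' \<omega>) \<omega> = X (S' \<omega>) \<omega> - X (\<tau>' \<omega>) \<omega>" by simp
    thus ?thesis using True unfolding S'_def \<tau>'_def
      by (simp add: Z'_def right_diff_distrib[symmetric] del: min.absorb1 min.absorb3)
  next
    case False
    hence "min (S \<omega>) (R \<omega>) = min (\<tau> \<omega>) (R \<omega>)" using \<tau>S[of \<omega>] by (auto simp: min_def)
    thus ?thesis using False by (simp add: Z'_def)
  qed
  ultimately show ?thesis by (subst (asm) has_bochner_integral_cong) auto
qed

text \<open>The constant in \<open>small\<close> is half of l r^2 / 4. The centre being approximate,
  |v| is bounded below by r / 2 rather than r, so v \<bullet> (D v) is at least l r^2 / 4 times s;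
  half of this is spent on the remainder. The bound b on M at \<tau> keeps the weights bounded when
  the square of M is expanded around its value at \<tau>.\<close>

lemma no_quadratic_variation:
  fixes Y M :: "real \<Rightarrow> 'a \<Rightarrow> real ^ 'd" and C :: "real \<Rightarrow> 'a \<Rightarrow> real ^ 'd ^ 'd"
  assumes Y: "continuous_adapted Y" and M: "continuous_adapted M" and C: "continuous_adapted C"
    and N1: "\<And>i. continuous_martingale (N1 i)"
    and N1_eq: "\<And>i \<omega> t. \<omega> \<in> space P \<Longrightarrow> 0 \<le> t \<Longrightarrow> t \<le> R \<omega> \<Longrightarrow> N1 i t \<omega> = M t \<omega> $ i - M 0 \<omega> $ i"
    and N2: "\<And>i j. continuous_martingale (N2 i j)"
    and N2_eq: "\<And>i j \<omega> t. \<omega> \<in> space P \<Longrightarrow> 0 \<le> t \<Longrightarrow> t \<le> R \<omega> \<Longrightarrow> N2 i j t \<omega> =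
      (M t \<omega> $ i * M t \<omega> $ j - C t \<omega> $ i $ j) - (M 0 \<omega> $ i * M 0 \<omega> $ j - C 0 \<omega> $ i $ j)"
    and \<tau>: "optional_time \<tau>" and S: "optional_time S" and R: "optional_time R"
    and \<tau>S: "\<And>\<omega>. \<tau> \<omega> \<le> S \<omega>" and K: "\<And>\<omega>. S \<omega> \<le> K" "0 \<le> K"
    and B: "past \<tau> (\<lambda>\<omega>. of_bool (B \<omega>))"
    and B_touching: "\<And>\<omega>. B \<omega> \<Longrightarrow> Y (\<tau> \<omega>) \<omega> \<in> touching Q r"
    and B_bound: "\<And>\<omega>. B \<omega> \<Longrightarrow> norm (M (\<tau> \<omega>) \<omega>) \<le> b"
    and good: "\<And>\<omega> u. \<omega> \<in> space P \<Longrightarrow> B \<omega> \<Longrightarrow> \<tau> \<omega> \<le> u \<Longrightarrow> u \<le> S \<omega> \<Longrightarrow>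
      good_increment Q \<epsilon> l \<delta> (C u \<omega> - C (\<tau> \<omega>) \<omega>)
        ((Y u \<omega> - M u \<omega>) - (Y (\<tau> \<omega>) \<omega> - M (\<tau> \<omega>) \<omega>)) (Y u \<omega> - Y (\<tau> \<omega>) \<omega>) (Y u \<omega>)"
    and pos: "0 < \<epsilon>" "0 < l" "0 < r" "0 < \<delta>"
    and small: "remainder_rate \<epsilon> r \<delta> \<le> l * r\<^sup>2 / 8"
  shows "AE \<omega> in P. B \<omega> \<longrightarrow> trace (C (min (S \<omega>) (R \<omega>)) \<omega> - C (min (\<tau> \<omega>) (R \<omega>)) \<omega>) = 0"
proof -
  define \<tau>' where "\<tau>' = (\<lambda>\<omega>. min (\<tau> \<omega>) (R \<omega>))"
  define S' where "S' = (\<lambda>\<omega>. min (S \<omega>) (R \<omega>))"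
  define m where "m = (\<lambda>\<omega>. M (S' \<omega>) \<omega> - M (\<tau>' \<omega>) \<omega>)"
  define y where "y = (\<lambda>\<omega>. Y (S' \<omega>) \<omega> - Y (\<tau>' \<omega>) \<omega>)"
  define D where "D = (\<lambda>\<omega>. C (S' \<omega>) \<omega> - C (\<tau>' \<omega>) \<omega>)"
  define s where "s = (\<lambda>\<omega>. trace (D \<omega>))"
  define \<beta> where "\<beta> = (\<lambda>\<omega>. of_bool (B \<omega>) :: real)"
  have stuck: "S' \<omega> = \<tau>' \<omega>" if "\<not> \<tau> \<omega> < R \<omega>" for \<omega>
    using that \<tau>S[of \<omega>] by (auto simp: S'_def \<tau>'_def min_def)
  have free: "\<tau>' \<omega> = \<tau> \<omega>" "\<tau> \<omega> \<le> S' \<omega>" "S' \<omega> \<le> S \<omega>" if "\<tau> \<omega> < R \<omega>" for \<omega>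
    using that \<tau>S[of \<omega>] by (auto simp: S'_def \<tau>'_def)
  have S'K: "S' \<omega> \<le> K" "\<tau>' \<omega> \<le> K" for \<omega> using \<tau>S[of \<omega>] K(1)[of \<omega>] by (auto simp: S'_def \<tau>'_def)
  have oS': "optional_time S'" "optional_time \<tau>'" unfolding S'_def \<tau>'_def by (intro optional_time_min \<tau> S R)+
  have [measurable]: "D \<in> borel_measurable P"
    unfolding D_def
    by (intro borel_measurable_diff path_at_optional_measurable_P[OF C oS'(1) S'K(1) K(2)]
          path_at_optional_measurable_P[OF C oS'(2) S'K(2) K(2)])
  have s_meas[measurable]: "s \<in> borel_measurable P"
  proof -
    have "(\<lambda>A. trace A) \<in> borel_measurable (borel :: (real ^ 'd ^ 'd) measure)"
      unfolding trace_def by (intro borel_measurable_continuous_onI continuous_intros)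
    thus ?thesis unfolding s_def by measurable
  qed
  have p\<beta>: "past \<tau> \<beta>" unfolding \<beta>_def by (rule B)
  have \<beta>_meas[measurable]: "\<beta> \<in> borel_measurable P"
  proof -
    have "(\<lambda>\<omega>. if \<tau> \<omega> < K + 1 then \<beta> \<omega> else 0) \<in> borel_measurable P"
      by (rule measurable_H_P[of "K + 1"]) (use p\<beta> K(2) in \<open>simp_all add: past_def\<close>)
    moreover have "\<tau> \<omega> < K + 1" for \<omega> using \<tau>S[of \<omega>] K(1)[of \<omega>] by simp
    ultimately show ?thesis by simp
  qed
  have linear: "has_bochner_integral P (\<lambda>\<omega>. Z \<omega> * m \<omega> $ i) 0"
    if "past \<tau> Z" "\<And>\<omega>. \<bar>Z \<omega>\<bar> \<le> z" for Z z i
    using sampled_increment[where N="N1 i" and X="\<lambda>t \<omega>. M t \<omega> $ i", OF N1 \<tau> S R \<tau>S K N1_eq that]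
    by (simp add: m_def S'_def \<tau>'_def)
  \<comment> \<open>The product of increments is the increment of the product minus two cross terms,
    each an increment of M weighted by its value at \<tau>. On \<open>B\<close> these weights are
    bounded, so the cross terms integrate to 0 by \<open>linear\<close>.\<close>
  have quadratic: "has_bochner_integral P (\<lambda>\<omega>. Z \<omega> * (m \<omega> $ i * m \<omega> $ j - D \<omega> $ i $ j)) 0"
    if Z: "past \<tau> Z" "\<And>\<omega>. \<bar>Z \<omega>\<bar> \<le> z" and ZB: "\<And>\<omega>. \<not> B \<omega> \<Longrightarrow> Z \<omega> = 0" for Z z i j
  proof -
    have pM: "past \<tau> (\<lambda>\<omega>. Z \<omega> * M (\<tau> \<omega>) \<omega> $ k)" for k
      by (rule past_mult[OF Z(1) past_path[OF M \<tau>, of "\<lambda>x. x $ k"]])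
         (intro borel_measurable_continuous_onI continuous_intros)
    have bM: "\<bar>Z \<omega> * M (\<tau> \<omega>) \<omega> $ k\<bar> \<le> z * \<bar>b\<bar>" for k \<omega>
    proof (cases "B \<omega>")
      case True
      have "\<bar>M (\<tau> \<omega>) \<omega> $ k\<bar> \<le> \<bar>b\<bar>"
        using B_bound[OF True] component_le_norm_cart[of "M (\<tau> \<omega>) \<omega>" k] by linarith
      thus ?thesis using Z(2)[of \<omega>] by (auto simp: abs_mult intro!: mult_mono order_trans[OF abs_ge_zero])
    next
      case False
      have "0 \<le> z" using Z(2)[of \<omega>] by linarith
      thus ?thesis using ZB[OF False] by simp
    qed
    have "has_bochner_integral P (\<lambda>\<omega>.
       Z \<omega> * ((M (S' \<omega>) \<omega> $ i * M (S' \<omega>) \<omega> $ j - C (S' \<omega>) \<omega> $ i $ j)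
            - (M (\<tau>' \<omega>) \<omega> $ i * M (\<tau>' \<omega>) \<omega> $ j - C (\<tau>' \<omega>) \<omega> $ i $ j))
       - (Z \<omega> * M (\<tau> \<omega>) \<omega> $ i) * m \<omega> $ j - (Z \<omega> * M (\<tau> \<omega>) \<omega> $ j) * m \<omega> $ i) (0 - 0 - 0)"
      unfolding S'_def \<tau>'_def
      by (intro has_bochner_integral_diff linear[OF pM bM])
         (rule sampled_increment[where N="N2 i j" and X="\<lambda>t \<omega>. M t \<omega> $ i * M t \<omega> $ j - C t \<omega> $ i $ j",
             OF N2 \<tau> S R \<tau>S K N2_eq Z])
    moreover have "(\<lambda>\<omega>. Z \<omega> * ((M (S' \<omega>) \<omega> $ i * M (S' \<omega>) \<omega> $ j - C (S' \<omega>) \<omega> $ i $ j)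
            - (M (\<tau>' \<omega>) \<omega> $ i * M (\<tau>' \<omega>) \<omega> $ j - C (\<tau>' \<omega>) \<omega> $ i $ j))
       - (Z \<omega> * M (\<tau> \<omega>) \<omega> $ i) * m \<omega> $ j - (Z \<omega> * M (\<tau> \<omega>) \<omega> $ j) * m \<omega> $ i) =
       (\<lambda>\<omega>. Z \<omega> * (m \<omega> $ i * m \<omega> $ j - D \<omega> $ i $ j))"
    proof
      fix \<omega>
      show "Z \<omega> * ((M (S' \<omega>) \<omega> $ i * M (S' \<omega>) \<omega> $ j - C (S' \<omega>) \<omega> $ i $ j)
            - (M (\<tau>' \<omega>) \<omega> $ i * M (\<tau>' \<omega>) \<omega> $ j - C (\<tau>' \<omega>) \<omega> $ i $ j))
       - (Z \<omega> * M (\<tau> \<omega>) \<omega> $ i) * m \<omega> $ j - (Z \<omega> * M (\<tau> \<omega>) \<omega> $ j) * m \<omega> $ i =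
         Z \<omega> * (m \<omega> $ i * m \<omega> $ j - D \<omega> $ i $ j)"
      proof (cases "\<tau> \<omega> < R \<omega>")
        case True
        show ?thesis unfolding m_def D_def free(1)[OF True] by (simp add: algebra_simps)
      next
        case False
        show ?thesis unfolding m_def D_def stuck[OF False] by simp
      qed
    qed
    ultimately show ?thesis by simp
  qed
  have \<beta>1: "\<bar>\<beta> \<omega>\<bar> \<le> 1" for \<omega> by (simp add: \<beta>_def)
  have s_range: "0 \<le> s \<omega>" "s \<omega> \<le> \<delta>" if "\<omega> \<in> space P" "B \<omega>" for \<omega>
  proof -
    have "0 \<le> s \<omega> \<and> s \<omega> \<le> \<delta>"
    proof (cases "\<tau> \<omega> < R \<omega>")
      case True
      show ?thesis using good[OF that free(2,3)[OF True]] free(1)[OF True]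
        by (simp add: good_increment_def s_def D_def)
    next
      case False
      show ?thesis using pos unfolding s_def D_def stuck[OF False] by (simp add: trace_def)
    qed
    thus "0 \<le> s \<omega>" "s \<omega> \<le> \<delta>" by auto
  qed
  have int_s: "integrable P (\<lambda>\<omega>. \<beta> \<omega> * s \<omega>)"
  proof (rule integrable_const_bound[of _ \<delta>])
    show "AE \<omega> in P. norm (\<beta> \<omega> * s \<omega>) \<le> \<delta>" using s_range pos by (intro AE_I2) (auto simp: \<beta>_def)
  qed measurable
  define u0 where "u0 = \<delta>\<^sup>2 + 4 * r * \<delta>"
  have u0: "0 \<le> u0" using pos by (simp add: u0_def)
  \<comment> \<open>The error of the approximate centre is the only term not proportional to s. As
    u0 depends on \<delta> and r alone, it disappears when \<eta> tends to 0 with \<delta>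
    fixed.\<close>
  have estimate: "l * r\<^sup>2 / 8 * (\<integral>\<omega>. \<beta> \<omega> * s \<omega> \<partial>P) \<le> 8 * r * u0 * \<eta>"
    if \<eta>: "0 < \<eta>" "\<eta> \<le> \<delta>" "\<eta> \<le> r / 2" for \<eta>
  proof -
    obtain g :: "real ^ 'd \<Rightarrow> real ^ 'd" where g[measurable]: "g \<in> borel_measurable borel"
      and g1: "\<And>x. x \<in> touching Q r \<Longrightarrow> dist x (g x) \<le> r + \<eta>"
      and g2: "\<And>x y. x \<in> touching Q r \<Longrightarrow> y \<in> Q \<Longrightarrow> r - \<eta> \<le> dist (g x) y"
      using measurable_exterior_centre[OF \<eta>(1), of Q r] by blast
    define v where "v = (\<lambda>\<omega>. Y (\<tau> \<omega>) \<omega> - g (Y (\<tau> \<omega>) \<omega>))"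
    \<comment> \<open>Components of the radial vector, cut off outside \<open>B\<close>: known at
      \<tau> and bounded by 2 r, hence admissible weights.\<close>
    define \<zeta> where "\<zeta> = (\<lambda>i \<omega>. \<beta> \<omega> * v \<omega> $ i)"
    have v2: "norm (v \<omega>) \<le> r + \<eta>" if "B \<omega>" for \<omega>
      using g1[OF B_touching[OF that]] by (simp add: v_def dist_norm)
    have \<zeta>p: "past \<tau> (\<zeta> i)" for i
      unfolding \<zeta>_def v_def \<beta>_def
    proof (rule past_mult[OF B past_path[OF Y \<tau>, of "\<lambda>x. (x - g x) $ i"]])
      have "(\<lambda>x. x $ i) \<in> borel_measurable (borel :: (real ^ 'd) measure)"
        by (intro borel_measurable_continuous_onI continuous_intros)
      from measurable_compose[OF _ this, of "\<lambda>x. x - g x"]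
      show "(\<lambda>x. (x - g x) $ i) \<in> borel_measurable borel" by measurable
    qed
    have \<zeta>b: "\<bar>\<zeta> i \<omega>\<bar> \<le> 2 * r" for i \<omega>
    proof (cases "B \<omega>")
      case True
      thus ?thesis using v2[OF True] component_le_norm_cart[of "v \<omega>" i] \<eta> by (simp add: \<zeta>_def \<beta>_def)
    qed (use pos in \<open>simp add: \<zeta>_def \<beta>_def\<close>)
    have \<beta>\<beta>: "\<beta> \<omega> * \<beta> \<omega> = \<beta> \<omega>" for \<omega> by (simp add: \<beta>_def)
    have Q1: "has_bochner_integral P (\<lambda>\<omega>. \<beta> \<omega> * (v \<omega> \<bullet> m \<omega>)) 0"
    proof -
      have "has_bochner_integral P (\<lambda>\<omega>. \<Sum>i\<in>UNIV. \<zeta> i \<omega> * m \<omega> $ i) (\<Sum>i\<in>(UNIV :: 'd set). 0)"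
        by (intro has_bochner_integral_sum linear[OF \<zeta>p \<zeta>b])
      thus ?thesis by (simp add: \<zeta>_def inner_vec_def sum_distrib_left mult.assoc)
    qed
    have Q2: "has_bochner_integral P (\<lambda>\<omega>. \<beta> \<omega> * (m \<omega> \<bullet> m \<omega> - s \<omega>)) 0"
    proof -
      have "has_bochner_integral P (\<lambda>\<omega>. \<Sum>i\<in>UNIV. \<beta> \<omega> * (m \<omega> $ i * m \<omega> $ i - D \<omega> $ i $ i)) (\<Sum>i\<in>(UNIV :: 'd set). 0)"
        by (intro has_bochner_integral_sum quadratic[OF p\<beta> \<beta>1]) (simp add: \<beta>_def)
      thus ?thesis by (simp add: inner_vec_def s_def trace_def sum_distrib_left[symmetric] sum_subtractf)
    qed
    have Q3: "has_bochner_integral P (\<lambda>\<omega>. \<beta> \<omega> * ((v \<omega> \<bullet> m \<omega>)\<^sup>2 - v \<omega> \<bullet> (D \<omega> *v v \<omega>))) 0"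
    proof -
      have b: "\<bar>\<zeta> i \<omega> * \<zeta> j \<omega>\<bar> \<le> 2 * r * (2 * r)" for i j \<omega>
        unfolding abs_mult using pos by (intro mult_mono \<zeta>b) auto
      have "has_bochner_integral P (\<lambda>\<omega>. \<Sum>i\<in>UNIV. \<Sum>j\<in>UNIV. (\<zeta> i \<omega> * \<zeta> j \<omega>) * (m \<omega> $ i * m \<omega> $ j - D \<omega> $ i $ j))
          (\<Sum>i\<in>(UNIV :: 'd set). \<Sum>j\<in>(UNIV :: 'd set). 0)"
        by (intro has_bochner_integral_sum quadratic[OF past_mult[OF \<zeta>p \<zeta>p] b]) (simp add: \<zeta>_def \<beta>_def)
      moreover have "(\<Sum>i\<in>UNIV. \<Sum>j\<in>UNIV. (\<zeta> i \<omega> * \<zeta> j \<omega>) * (m \<omega> $ i * m \<omega> $ j - D \<omega> $ i $ j)) =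
         \<beta> \<omega> * ((v \<omega> \<bullet> m \<omega>)\<^sup>2 - v \<omega> \<bullet> (D \<omega> *v v \<omega>))" for \<omega>
      proof -
        have "\<zeta> i \<omega> * \<zeta> j \<omega> = \<beta> \<omega> * (v \<omega> $ i * v \<omega> $ j)" for i j
          unfolding \<zeta>_def using \<beta>\<beta>[of \<omega>] by (metis mult.assoc mult.left_commute)
        thus ?thesis unfolding inner_square inner_matrix_vector
          by (simp add: sum_subtractf[symmetric] sum_distrib_left right_diff_distrib mult.assoc)
      qed
      ultimately show ?thesis by simp
    qed
    \<comment> \<open>Pathwise form of the estimate, arranged so that every summand on the right
      except the constant one integrates to 0: m \<bullet> m is written as s plus its compensated
      part, and the square of v \<bullet> m is compared with v \<bullet> (D v), to which ellipticity
      applies.\<close>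
    have point: "l * r\<^sup>2 / 8 * (\<beta> \<omega> * s \<omega>) \<le> 8 * r * u0 * \<eta> + 2 * u0 * (\<beta> \<omega> * (v \<omega> \<bullet> m \<omega>))
        + (2 * u0 + 2 * \<delta>\<^sup>2) * (\<beta> \<omega> * (m \<omega> \<bullet> m \<omega> - s \<omega>))
        - \<beta> \<omega> * ((v \<omega> \<bullet> m \<omega>)\<^sup>2 - v \<omega> \<bullet> (D \<omega> *v v \<omega>))" if w: "\<omega> \<in> space P" for \<omega>
    proof (cases "B \<omega>")
      case False
      thus ?thesis using pos u0 \<eta> by (simp add: \<beta>_def)
    next
      case True
      note xt = B_touching[OF True]
      have x_cl: "Y (\<tau> \<omega>) \<omega> \<in> closure Q" using xt by (auto simp: touching_def frontier_def)
      have v1: "r - \<eta> \<le> norm (v \<omega>)"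
        using le_dist_closure[OF g2[OF xt] x_cl] by (simp add: v_def dist_norm norm_minus_commute)
      have v3: "norm (v \<omega>) \<le> 2 * r" using v2[OF True] \<eta> by linarith
      have vv: "r\<^sup>2 / 4 \<le> v \<omega> \<bullet> v \<omega>"
      proof -
        have "(r / 2)\<^sup>2 \<le> (norm (v \<omega>))\<^sup>2" using v1 \<eta> pos by (intro power_mono) auto
        thus ?thesis by (simp add: power2_norm_eq_inner power_divide)
      qed
      have "l * (v \<omega> \<bullet> v \<omega>) * s \<omega> \<le> v \<omega> \<bullet> (D \<omega> *v v \<omega>) \<and> \<epsilon> * norm (y \<omega> - m \<omega>) \<le> s \<omega> \<and> norm (y \<omega>) \<le> \<delta> \<and>
          norm (v \<omega>) ^ 2 - 4 * r * \<eta> \<le> norm (y \<omega> + v \<omega>) ^ 2"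
      proof (cases "\<tau> \<omega> < R \<omega>")
        case R: True
        have "Y (S' \<omega>) \<omega> - M (S' \<omega>) \<omega> - (Y (\<tau>' \<omega>) \<omega> - M (\<tau>' \<omega>) \<omega>) = y \<omega> - m \<omega>"
          by (simp add: y_def m_def algebra_simps)
        with good[OF w True free(2,3)[OF R], folded free(1)[OF R]]
        have G: "good_increment Q \<epsilon> l \<delta> (D \<omega>) (y \<omega> - m \<omega>) (y \<omega>) (Y (S' \<omega>) \<omega>)"
          by (simp add: D_def y_def)
        have "norm (v \<omega>) ^ 2 - 4 * r * \<eta> \<le> norm (y \<omega> + v \<omega>) ^ 2"
        proof -
          have "Y (S' \<omega>) \<omega> \<in> closure Q" using G by (simp add: good_increment_def)
          hence "r - \<eta> \<le> dist (g (Y (\<tau> \<omega>) \<omega>)) (Y (S' \<omega>) \<omega>)" by (intro le_dist_closure[of Q, OF g2[OF xt]])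
          moreover have "y \<omega> + v \<omega> = Y (S' \<omega>) \<omega> - g (Y (\<tau> \<omega>) \<omega>)" by (simp add: y_def v_def free(1)[OF R])
          ultimately have "r - \<eta> \<le> norm (y \<omega> + v \<omega>)" by (simp add: dist_norm norm_minus_commute)
          hence 1: "(r - \<eta>)\<^sup>2 \<le> (norm (y \<omega> + v \<omega>))\<^sup>2" using \<eta> pos by (intro power_mono) auto
          have 2: "(norm (v \<omega>))\<^sup>2 \<le> (r + \<eta>)\<^sup>2" using v2[OF True] by (intro power_mono) auto
          have "(r + \<eta>)\<^sup>2 - 4 * r * \<eta> = (r - \<eta>)\<^sup>2" by (simp add: power2_eq_square algebra_simps)
          thus ?thesis using 1 2 by linarith
        qed
        thus ?thesis using G unfolding good_increment_def s_def by blast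
      next
        \<comment> \<open>Localization ends no later than \<tau>: all increments vanish.\<close>
        case False
        show ?thesis using pos \<eta> unfolding s_def D_def y_def m_def stuck[OF False]
          by (simp add: trace_def inner_matrix_vector)
      qed
      hence G: "l * (v \<omega> \<bullet> v \<omega>) * s \<omega> \<le> v \<omega> \<bullet> (D \<omega> *v v \<omega>)" "\<epsilon> * norm (y \<omega> - m \<omega>) \<le> s \<omega>" "norm (y \<omega>) \<le> \<delta>"
          "norm (v \<omega>) ^ 2 - 4 * r * \<eta> \<le> norm (y \<omega> + v \<omega>) ^ 2" by auto
      have "y \<omega> = m \<omega> + (y \<omega> - m \<omega>)" by simp
      note rad = radial_estimate[OF this G(2) s_range[OF w True] G(3) v3 G(4) pos(1,3) \<eta>(1,2), folded u0_def]
      have "l * (r\<^sup>2 / 4) * s \<omega> \<le> l * (v \<omega> \<bullet> v \<omega>) * s \<omega>"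
        using vv pos s_range[OF w True] by (intro mult_right_mono mult_left_mono) auto
      hence low: "l * r\<^sup>2 / 4 * s \<omega> \<le> v \<omega> \<bullet> (D \<omega> *v v \<omega>)" using G(1) by simp
      have rem: "remainder_rate \<epsilon> r \<delta> * s \<omega> \<le> l * r\<^sup>2 / 8 * s \<omega>"
        using small s_range[OF w True] by (intro mult_right_mono) auto
      have split: "u0 * (2 * (m \<omega> \<bullet> m \<omega>) + 2 * (v \<omega> \<bullet> m \<omega>) + (2 * \<delta> / \<epsilon>\<^sup>2 + 4 * r / \<epsilon>) * s \<omega> + 8 * r * \<eta>)
          + \<delta>\<^sup>2 * (2 * (m \<omega> \<bullet> m \<omega>) + 2 * \<delta> / \<epsilon>\<^sup>2 * s \<omega>) + 12 * r\<^sup>2 * \<delta> / \<epsilon>\<^sup>2 * s \<omega> =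
          8 * r * u0 * \<eta> + 2 * u0 * (v \<omega> \<bullet> m \<omega>) + (2 * u0 + 2 * \<delta>\<^sup>2) * (m \<omega> \<bullet> m \<omega> - s \<omega>)
          + remainder_rate \<epsilon> r \<delta> * s \<omega>"
        unfolding remainder_rate_def u0_def[symmetric] by (simp add: algebra_simps)
      have "l * r\<^sup>2 / 4 * s \<omega> - l * r\<^sup>2 / 8 * s \<omega> = l * r\<^sup>2 / 8 * s \<omega>" by (simp add: algebra_simps)
      hence "l * r\<^sup>2 / 8 * s \<omega> \<le> 8 * r * u0 * \<eta> + 2 * u0 * (v \<omega> \<bullet> m \<omega>)
        + (2 * u0 + 2 * \<delta>\<^sup>2) * (m \<omega> \<bullet> m \<omega> - s \<omega>)
        - ((v \<omega> \<bullet> m \<omega>)\<^sup>2 - v \<omega> \<bullet> (D \<omega> *v v \<omega>))" using rad low rem unfolding split by linarith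
      thus ?thesis using True by (simp add: \<beta>_def)
    qed
    have "l * r\<^sup>2 / 8 * (\<integral>\<omega>. \<beta> \<omega> * s \<omega> \<partial>P) = (\<integral>\<omega>. l * r\<^sup>2 / 8 * (\<beta> \<omega> * s \<omega>) \<partial>P)" by simp
    also have "\<dots> \<le> (\<integral>\<omega>. 8 * r * u0 * \<eta> + 2 * u0 * (\<beta> \<omega> * (v \<omega> \<bullet> m \<omega>))
        + (2 * u0 + 2 * \<delta>\<^sup>2) * (\<beta> \<omega> * (m \<omega> \<bullet> m \<omega> - s \<omega>))
        - \<beta> \<omega> * ((v \<omega> \<bullet> m \<omega>)\<^sup>2 - v \<omega> \<bullet> (D \<omega> *v v \<omega>)) \<partial>P)"
      by (rule integral_mono) (use int_s Q1 Q2 Q3 point in \<open>auto simp: has_bochner_integral_iff\<close>)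
    also have "\<dots> = 8 * r * u0 * \<eta>"
    proof (rule has_bochner_integral_integral_eq)
      have "has_bochner_integral P (\<lambda>\<omega>. 8 * r * u0 * \<eta>) (8 * r * u0 * \<eta>)"
        by (simp add: has_bochner_integral_iff prob_space)
      from has_bochner_integral_diff[OF has_bochner_integral_add[OF has_bochner_integral_add[OF this
           has_bochner_integral_mult_right[OF Q1, of "2 * u0"]]
           has_bochner_integral_mult_right[OF Q2, of "2 * u0 + 2 * \<delta>\<^sup>2"]] Q3]
      show "has_bochner_integral P (\<lambda>\<omega>. 8 * r * u0 * \<eta> + 2 * u0 * (\<beta> \<omega> * (v \<omega> \<bullet> m \<omega>))
        + (2 * u0 + 2 * \<delta>\<^sup>2) * (\<beta> \<omega> * (m \<omega> \<bullet> m \<omega> - s \<omega>))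
        - \<beta> \<omega> * ((v \<omega> \<bullet> m \<omega>)\<^sup>2 - v \<omega> \<bullet> (D \<omega> *v v \<omega>))) (8 * r * u0 * \<eta>)" by simp
    qed
    finally show ?thesis .
  qed
  have "l * r\<^sup>2 / 8 * (\<integral>\<omega>. \<beta> \<omega> * s \<omega> \<partial>P) \<le> 0"
  proof (rule tendsto_lowerbound)
    show "((\<lambda>\<eta>. 8 * r * u0 * \<eta>) \<longlongrightarrow> 0) (at_right 0)" by (auto intro!: tendsto_eq_intros)
    have "\<forall>\<^sub>F \<eta> in at_right 0. \<eta> \<in> {0<..<min \<delta> (r / 2)}"
      using pos by (intro eventually_at_rightI[of 0 "min \<delta> (r / 2)"]) auto
    thus "\<forall>\<^sub>F \<eta> in at_right 0. l * r\<^sup>2 / 8 * (\<integral>\<omega>. \<beta> \<omega> * s \<omega> \<partial>P) \<le> 8 * r * u0 * \<eta>"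
    proof eventually_elim
      case (elim \<eta>)
      show ?case by (rule estimate) (use elim in auto)
    qed
  qed simp
  moreover have "0 < l * r\<^sup>2 / 8" using pos by simp
  ultimately have le0: "(\<integral>\<omega>. \<beta> \<omega> * s \<omega> \<partial>P) \<le> 0" by (meson mult_pos_pos not_le)
  have nn: "AE \<omega> in P. 0 \<le> \<beta> \<omega> * s \<omega>" using s_range by (intro AE_I2) (auto simp: \<beta>_def)
  have "(\<integral>\<omega>. \<beta> \<omega> * s \<omega> \<partial>P) = 0" using le0 integral_nonneg_AE[OF nn] by simp
  hence "AE \<omega> in P. \<beta> \<omega> * s \<omega> = 0" using integral_nonneg_eq_0_iff_AE[OF int_s nn] by simp
  thus ?thesis
  proof (rule AE_mp, intro AE_I2 impI)
    fix \<omega> assume "\<beta> \<omega> * s \<omega> = 0" "B \<omega>"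
    thus "trace (C (min (S \<omega>) (R \<omega>)) \<omega> - C (min (\<tau> \<omega>) (R \<omega>)) \<omega>) = 0"
      by (simp add: \<beta>_def s_def D_def S'_def \<tau>'_def)
  qed
qed

end

section \<open>Immediate failure after the exit time\<close>

lemma closed_good_increment:
  fixes Q :: "(real ^ 'd) set"
  shows "closed {p. good_increment Q \<epsilon> l \<delta> (fst p) (fst (snd p)) (fst (snd (snd p))) (snd (snd (snd p)))}"
  unfolding good_increment_def inner_matrix_vector
  unfolding trace_def
proof (intro closed_Collect_conj closed_Collect_all)
  have "continuous_on UNIV (\<lambda>p :: (real ^ 'd ^ 'd) \<times> (real ^ 'd) \<times> (real ^ 'd) \<times> (real ^ 'd). snd (snd (snd p)))"
    by (intro continuous_intros)
  from closed_vimage[OF closed_closure this]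
  show "closed {p :: (real ^ 'd ^ 'd) \<times> (real ^ 'd) \<times> (real ^ 'd) \<times> (real ^ 'd). snd (snd (snd p)) \<in> closure Q}"
    by (simp only: vimage_def)
qed (intro closed_Collect_le continuous_intros)+

context filtered_prob_space
begin

text \<open>Otherwise the first time at which the increments since \<open>\<tau>\<close> fail to be good would exceed \<open>\<tau>\<close>,
  contradicting \<open>no_quadratic_variation\<close>. The infimum is taken over rational times, so that it is
  an optional time.\<close>

lemma instant_failure:
  fixes Y M :: "real \<Rightarrow> 'a \<Rightarrow> real ^ 'd" and C :: "real \<Rightarrow> 'a \<Rightarrow> real ^ 'd ^ 'd"
    and R :: "nat \<Rightarrow> 'a \<Rightarrow> real"
  assumes Y: "continuous_adapted Y" and M: "continuous_adapted M" and C: "continuous_adapted C"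
    and N1: "\<And>n i. continuous_martingale (N1 n i)"
    and N1_eq: "\<And>n i \<omega> t. \<omega> \<in> space P \<Longrightarrow> 0 \<le> t \<Longrightarrow> t \<le> R n \<omega> \<Longrightarrow> N1 n i t \<omega> = M t \<omega> $ i - M 0 \<omega> $ i"
    and N2: "\<And>n i j. continuous_martingale (N2 n i j)"
    and N2_eq: "\<And>n i j \<omega> t. \<omega> \<in> space P \<Longrightarrow> 0 \<le> t \<Longrightarrow> t \<le> R n \<omega> \<Longrightarrow> N2 n i j t \<omega> =
      (M t \<omega> $ i * M t \<omega> $ j - C t \<omega> $ i $ j) - (M 0 \<omega> $ i * M 0 \<omega> $ j - C 0 \<omega> $ i $ j)"
    and \<tau>: "optional_time \<tau>" and R: "\<And>n. optional_time (R n)"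
    and K: "\<And>\<omega>. \<tau> \<omega> + h \<le> K" "0 \<le> K"
    and R_large: "AE \<omega> in P. \<exists>n. K \<le> R n \<omega>"
    and B: "past \<tau> (\<lambda>\<omega>. of_bool (B \<omega>))"
    and B_touching: "\<And>\<omega>. B \<omega> \<Longrightarrow> Y (\<tau> \<omega>) \<omega> \<in> touching Q r"
    and B_bound: "\<And>\<omega>. B \<omega> \<Longrightarrow> norm (M (\<tau> \<omega>) \<omega>) \<le> b"
    and pos: "0 < \<epsilon>" "0 < l" "0 < r" "0 < \<delta>" "0 < h"
    and small: "remainder_rate \<epsilon> r \<delta> \<le> l * r\<^sup>2 / 8"
  shows "AE \<omega> in P. B \<omega> \<longrightarrow> (\<forall>u. \<tau> \<omega> < u \<longrightarrow> u \<le> \<tau> \<omega> + h \<longrightarrow> trace (C u \<omega> - C (\<tau> \<omega>) \<omega>) \<noteq> 0) \<longrightarrow>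
    (\<forall>u0>\<tau> \<omega>. \<exists>u. \<tau> \<omega> < u \<and> u < u0 \<and> \<not> good_increment Q \<epsilon> l \<delta> (C u \<omega> - C (\<tau> \<omega>) \<omega>)
        ((Y u \<omega> - M u \<omega>) - (Y (\<tau> \<omega>) \<omega> - M (\<tau> \<omega>) \<omega>)) (Y u \<omega> - Y (\<tau> \<omega>) \<omega>) (Y u \<omega>))"
proof -
  define p where "p = (\<lambda>s u \<omega>. (C u \<omega> - C s \<omega>, (Y u \<omega> - M u \<omega>) - (Y s \<omega> - M s \<omega>), Y u \<omega> - Y s \<omega>, Y u \<omega>))"
  define GS where "GS = {p. good_increment Q \<epsilon> l \<delta> (fst p) (fst (snd p)) (fst (snd (snd p))) (snd (snd (snd p)))}"
  \<comment> \<open>For q > \<tau> the minimum with q changes nothing, but it makes the data at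
    \<tau> measurable in \<open>H q\<close>. The element \<tau> + h keeps the set nonempty and S
    bounded.\<close>
  define V where "V = (\<lambda>\<omega>. insert (\<tau> \<omega> + h) {q \<in> \<rat>. \<tau> \<omega> < q \<and> p (min (\<tau> \<omega>) q) q \<omega> \<notin> GS})"
  define S where "S = (\<lambda>\<omega>. Inf (V \<omega>))"
  have GS: "closed GS" unfolding GS_def by (rule closed_good_increment)
  have V_ne: "V \<omega> \<noteq> {}" for \<omega> by (simp add: V_def)
  have V_low: "\<tau> \<omega> \<le> x" if "x \<in> V \<omega>" for x \<omega> using that pos(5) by (auto simp: V_def)
  have V_bdd: "bdd_below (V \<omega>)" for \<omega> using V_low by (auto simp: bdd_below_def)
  have \<tau>S: "\<tau> \<omega> \<le> S \<omega>" for \<omega> unfolding S_def by (intro cInf_greatest V_ne V_low)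
  have Sh: "S \<omega> \<le> \<tau> \<omega> + h" for \<omega> unfolding S_def by (intro cInf_lower V_bdd) (simp add: V_def)
  have SK: "S \<omega> \<le> K" for \<omega> using Sh[of \<omega>] K(1)[of \<omega>] by linarith
  have S_opt: "optional_time S"
    unfolding optional_time_def
  proof (intro conjI ballI allI impI)
    fix \<omega> assume "\<omega> \<in> space P"
    thus "0 \<le> S \<omega>" using optional_time_nonneg[OF \<tau>] \<tau>S[of \<omega>] by fastforce
  next
    fix t :: real assume t: "0 \<le> t"
    have eq: "S \<omega> < t \<longleftrightarrow> \<tau> \<omega> + h < t \<or> (\<exists>q\<in>\<rat> \<inter> {0..<t}. \<tau> \<omega> < q \<and> p (min (\<tau> \<omega>) q) q \<omega> \<notin> GS)"
      if w: "\<omega> \<in> space P" for \<omega>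
    proof -
      have "S \<omega> < t \<longleftrightarrow> (\<exists>x\<in>V \<omega>. x < t)" unfolding S_def by (rule cInf_less_iff[OF V_ne V_bdd])
      also have "\<dots> \<longleftrightarrow> \<tau> \<omega> + h < t \<or> (\<exists>q\<in>\<rat> \<inter> {0..<t}. \<tau> \<omega> < q \<and> p (min (\<tau> \<omega>) q) q \<omega> \<notin> GS)"
        using optional_time_nonneg[OF \<tau> w] unfolding V_def by fastforce
      finally show ?thesis .
    qed
    have m1: "Measurable.pred (H t) (\<lambda>\<omega>. \<tau> \<omega> + h < t)"
    proof (cases "h \<le> t")
      case True
      have "Measurable.pred (H t) (\<lambda>\<omega>. \<tau> \<omega> < t - h)"
        by (rule measurable_H_mono[OF _ _ optional_time_pred[OF \<tau>], of "t - h"]) (use True pos(5) in auto)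
      moreover have "(\<lambda>\<omega>. \<tau> \<omega> < t - h) = (\<lambda>\<omega>. \<tau> \<omega> + h < t)" by (auto simp: less_diff_eq)
      ultimately show ?thesis by simp
    next
      case False
      have "Measurable.pred (H t) (\<lambda>\<omega>. False)" by simp
      thus ?thesis
      proof (rule measurable_cong[THEN iffD1, rotated])
        fix \<omega> assume "\<omega> \<in> space (H t)"
        hence "0 \<le> \<tau> \<omega>" using optional_time_nonneg[OF \<tau>] t by (simp add: space_H)
        thus "False = (\<tau> \<omega> + h < t)" using False by simp
      qed
    qed
    have m2: "Measurable.pred (H t) (\<lambda>\<omega>. \<not> (\<tau> \<omega> < q \<and> p (min (\<tau> \<omega>) q) q \<omega> \<notin> GS))" if q: "q \<in> \<rat> \<inter> {0..<t}" for q
    proof -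
      have q0: "0 \<le> q" and qt: "q \<le> t" using q by auto
      have [measurable]: "C q \<in> borel_measurable (H q)" "Y q \<in> borel_measurable (H q)" "M q \<in> borel_measurable (H q)"
        using Y M C q0 by (auto simp: continuous_adapted_def)
      note [measurable] = path_at_optional_measurable[OF Y \<tau> q0] path_at_optional_measurable[OF M \<tau> q0]
        path_at_optional_measurable[OF C \<tau> q0] optional_time_pred[OF \<tau> q0]
      have [measurable]: "(\<lambda>\<omega>. p (min (\<tau> \<omega>) q) q \<omega>) \<in> borel_measurable (H q)"
        unfolding p_def by (intro borel_measurable_Pair borel_measurable_diff) measurable
      have [measurable]: "GS \<in> sets borel" using GS by simp
      have "Measurable.pred (H q) (\<lambda>\<omega>. \<not> (\<tau> \<omega> < q \<and> p (min (\<tau> \<omega>) q) q \<omega> \<notin> GS))" by measurable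
      thus ?thesis by (rule measurable_H_mono[OF q0 qt])
    qed
    have "countable (\<rat> \<inter> {0..<t})" using countable_rat by (rule countable_Int1)
    from pred_countable_Ball[OF this m2]
    have "Measurable.pred (H t) (\<lambda>\<omega>. \<tau> \<omega> + h < t \<or>
        \<not> (\<forall>q\<in>\<rat> \<inter> {0..<t}. \<not> (\<tau> \<omega> < q \<and> p (min (\<tau> \<omega>) q) q \<omega> \<notin> GS)))"
      by (intro pred_intros_logic(5) pred_intros_logic(2) m1)
    thus "Measurable.pred (H t) (\<lambda>\<omega>. S \<omega> < t)"
    proof (rule measurable_cong[THEN iffD1, rotated])
      fix \<omega> assume "\<omega> \<in> space (H t)"
      hence "\<omega> \<in> space P" by (simp only: space_H[OF t])
      from eq[OF this] show "(\<tau> \<omega> + h < t \<or>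
        \<not> (\<forall>q\<in>\<rat> \<inter> {0..<t}. \<not> (\<tau> \<omega> < q \<and> p (min (\<tau> \<omega>) q) q \<omega> \<notin> GS))) = (S \<omega> < t)" by blast
    qed
  qed
  \<comment> \<open>No rational time strictly between \<tau> and S is bad. Continuity and closedness
    of \<open>GS\<close> carry goodness to all real times up to and including S; at \<tau> itself
    the increments are 0.\<close>
  have good: "p (\<tau> \<omega>) u \<omega> \<in> GS" if w: "\<omega> \<in> space P" and b: "B \<omega>" and u: "\<tau> \<omega> \<le> u" "u \<le> S \<omega>" for \<omega> u
  proof (cases "u = \<tau> \<omega>")
    case True
    have "Y (\<tau> \<omega>) \<omega> \<in> closure Q" using B_touching[OF b] by (auto simp: touching_def frontier_def)
    thus ?thesis unfolding True using pos
      by (simp add: GS_def p_def good_increment_def trace_def inner_matrix_vector)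
  next
    case False
    hence lt: "\<tau> \<omega> < u" using u by simp
    have "\<exists>q. q \<in> \<rat> \<and> max (\<tau> \<omega>) (u - 1 / (real n + 1)) < q \<and> q < u" for n
      using Rats_dense_in_real[of "max (\<tau> \<omega>) (u - 1 / (real n + 1))" u] lt by auto
    then obtain q where q: "\<And>n. q n \<in> \<rat>" "\<And>n. max (\<tau> \<omega>) (u - 1 / (real n + 1)) < q n" "\<And>n. q n < u" by metis
    have \<tau>0: "0 \<le> \<tau> \<omega>" by (rule optional_time_nonneg[OF \<tau> w])
    have mem: "p (\<tau> \<omega>) (q n) \<omega> \<in> GS" for n
    proof (rule ccontr)
      assume "p (\<tau> \<omega>) (q n) \<omega> \<notin> GS"
      hence "q n \<in> V \<omega>" using q[of n] by (simp add: V_def min_def)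
      hence "S \<omega> \<le> q n" unfolding S_def by (rule cInf_lower[OF _ V_bdd])
      thus False using q(3)[of n] u by simp
    qed
    have lim: "q \<longlonglongrightarrow> u"
    proof (rule tendsto_sandwich[OF _ _ _ tendsto_const])
      show "\<forall>\<^sub>F n in sequentially. u - 1 / (real n + 1) \<le> q n" "\<forall>\<^sub>F n in sequentially. q n \<le> u"
        using q(2,3) by (auto intro!: always_eventually less_imp_le)
      show "(\<lambda>n. u - 1 / (real n + 1)) \<longlonglongrightarrow> u"
        using LIMSEQ_inverse_real_of_nat_add_minus[of u] by (simp add: inverse_eq_divide add.commute)
    qed
    have u0: "u \<in> {0..}" using lt \<tau>0 by simp
    have "0 \<le> q n" for n using q(2)[of n] \<tau>0 by simp
    hence q0: "\<forall>\<^sub>F n in sequentially. q n \<in> {0..}" by simp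
    have c: "continuous_on {0..} (\<lambda>t. C t \<omega>)" "continuous_on {0..} (\<lambda>t. Y t \<omega>)" "continuous_on {0..} (\<lambda>t. M t \<omega>)"
      using Y M C w by (auto simp: continuous_adapted_def)
    have "(\<lambda>n. p (\<tau> \<omega>) (q n) \<omega>) \<longlonglongrightarrow> p (\<tau> \<omega>) u \<omega>"
      unfolding p_def
      by (intro tendsto_Pair tendsto_diff tendsto_const continuous_on_tendsto_compose[OF c(1) lim u0 q0]
          continuous_on_tendsto_compose[OF c(2) lim u0 q0] continuous_on_tendsto_compose[OF c(3) lim u0 q0])
    thus ?thesis by (rule Lim_in_closed_set[OF GS _ sequentially_bot, rotated]) (simp add: mem)
  qed
  have "AE \<omega> in P. B \<omega> \<longrightarrow> trace (C (min (S \<omega>) (R n \<omega>)) \<omega> - C (min (\<tau> \<omega>) (R n \<omega>)) \<omega>) = 0" for n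
  proof (rule no_quadratic_variation[OF Y M C N1[of n] N1_eq N2[of n] N2_eq \<tau> S_opt R[of n] \<tau>S SK K(2) B
        B_touching B_bound _ pos(1-4) small])
    fix \<omega> u assume "\<omega> \<in> space P" "B \<omega>" "\<tau> \<omega> \<le> u" "u \<le> S \<omega>"
    from good[OF this] show "good_increment Q \<epsilon> l \<delta> (C u \<omega> - C (\<tau> \<omega>) \<omega>)
        ((Y u \<omega> - M u \<omega>) - (Y (\<tau> \<omega>) \<omega> - M (\<tau> \<omega>) \<omega>)) (Y u \<omega> - Y (\<tau> \<omega>) \<omega>) (Y u \<omega>)"
      by (simp add: GS_def p_def)
  qed
  hence "AE \<omega> in P. \<forall>n. B \<omega> \<longrightarrow> trace (C (min (S \<omega>) (R n \<omega>)) \<omega> - C (min (\<tau> \<omega>) (R n \<omega>)) \<omega>) = 0"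
    unfolding AE_all_countable by blast
  thus ?thesis using R_large
  proof eventually_elim
    case (elim \<omega>)
    show ?case
    proof (intro impI allI, rule ccontr)
      fix u0 assume b: "B \<omega>" and tr: "\<forall>u. \<tau> \<omega> < u \<longrightarrow> u \<le> \<tau> \<omega> + h \<longrightarrow> trace (C u \<omega> - C (\<tau> \<omega>) \<omega>) \<noteq> 0"
        and u0: "\<tau> \<omega> < u0"
        and "\<not> (\<exists>u. \<tau> \<omega> < u \<and> u < u0 \<and> \<not> good_increment Q \<epsilon> l \<delta> (C u \<omega> - C (\<tau> \<omega>) \<omega>)
        ((Y u \<omega> - M u \<omega>) - (Y (\<tau> \<omega>) \<omega> - M (\<tau> \<omega>) \<omega>)) (Y u \<omega> - Y (\<tau> \<omega>) \<omega>) (Y u \<omega>))"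
      hence g: "p (\<tau> \<omega>) u \<omega> \<in> GS" if "\<tau> \<omega> < u" "u < u0" for u
        using that by (auto simp: GS_def p_def)
      obtain n where n: "K \<le> R n \<omega>" using elim(2) by blast
      have "min (S \<omega>) (R n \<omega>) = S \<omega>" "min (\<tau> \<omega>) (R n \<omega>) = \<tau> \<omega>"
        using n SK[of \<omega>] \<tau>S[of \<omega>] by auto
      hence "trace (C (S \<omega>) \<omega> - C (\<tau> \<omega>) \<omega>) = 0" using elim(1) b by metis
      \<comment> \<open>Without bad times before u0 the infimum S lies strictly above \<tau>, and
        the vanishing trace increment at S contradicts the assumption on the trace.\<close>
      moreover have "min u0 (\<tau> \<omega> + h) \<le> S \<omega>"
        unfolding S_def
      proof (rule cInf_greatest[OF V_ne])
        fix x assume "x \<in> V \<omega>"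
        thus "min u0 (\<tau> \<omega> + h) \<le> x" using g[of x] by (auto simp: V_def min_def not_less[symmetric])
      qed
      hence "\<tau> \<omega> < S \<omega>" using u0 pos(5) by linarith
      ultimately show False using tr Sh[of \<omega>] by blast
    qed
  qed
qed

end

text \<open>The inequalities between measures are tested on the set (0, t], where the measures
  reduce to increments. Strict positivity comes from strict monotonicity of the trace between the
  times 0 and t, both of which lie in J.\<close>

lemma increments_of_conditions:
  fixes c :: "real \<Rightarrow> real ^ 'd ^ 'd" and a :: "real \<Rightarrow> real ^ 'd"
  assumes fc: "finite_variation c" "continuous_on {0..} c" and fa: "finite_variation a" "continuous_on {0..} a"
    and \<tau>: "0 \<le> \<tau>" and t: "0 < t" "{0..t} \<subseteq> J"
    and ell: "uniformly_elliptic_on l J (\<lambda>t. c (\<tau> + t))"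
    and drift: "drift_dominated_on e J (\<lambda>t. c (\<tau> + t)) (\<lambda>t. a (\<tau> + t))" and e: "0 < e"
  shows "0 < trace (c (\<tau> + t) - c \<tau>)"
    "l * (v \<bullet> v) * trace (c (\<tau> + t) - c \<tau>) \<le> v \<bullet> ((c (\<tau> + t) - c \<tau>) *v v)"
    "e * norm (a (\<tau> + t) - a \<tau>) \<le> trace (c (\<tau> + t) - c \<tau>)"
proof -
  have I: "{0<..t} \<in> bounded_borel_subsets J"
    using t(2) by (auto simp: bounded_borel_subsets_def intro: bounded_subset[of "{0..t}"])
  have "matrix_diff_measure (\<lambda>t. c (\<tau> + t)) {0<..t} $ i $ j = (c (\<tau> + t) - c \<tau>) $ i $ j" for i j
  proof -
    have "finite_variation (\<lambda>t. c (\<tau> + t) $ i $ j)"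
    proof (rule finite_variation_shift[OF fc(1) \<tau>])
      fix s t
      show "norm (c (\<tau> + s) $ i $ j - c (\<tau> + t) $ i $ j) \<le> norm (c (\<tau> + s) - c (\<tau> + t))"
        using order_trans[OF Finite_Cartesian_Product.norm_nth_le Finite_Cartesian_Product.norm_nth_le,
            of "c (\<tau> + s) - c (\<tau> + t)" i j] by simp
    qed
    moreover have "continuous_on {0..} (\<lambda>t. c (\<tau> + t) $ i $ j)"
      by (intro continuous_intros continuous_on_compose2[OF fc(2)]) (use \<tau> in auto)
    ultimately show ?thesis using diff_measure_Ioc[of "\<lambda>t. c (\<tau> + t) $ i $ j" t] t
      by (simp add: matrix_diff_measure_def)
  qed
  hence D: "matrix_diff_measure (\<lambda>t. c (\<tau> + t)) {0<..t} = c (\<tau> + t) - c \<tau>" by (simp add: vec_eq_iff)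
  have "trace (c (\<tau> + 0)) < trace (c (\<tau> + t))"
    using ell t unfolding uniformly_elliptic_on_def by (intro strict_mono_onD[of J "\<lambda>t. trace (c (\<tau> + t))"]) auto
  thus "0 < trace (c (\<tau> + t) - c \<tau>)" by (simp add: trace_def sum_subtractf)
  have "matrix_le ((l * trace (c (\<tau> + t) - c \<tau>)) *\<^sub>R mat 1) (c (\<tau> + t) - c \<tau>)"
    using ell I unfolding uniformly_elliptic_on_def D[symmetric] by blast
  hence "0 \<le> v \<bullet> ((c (\<tau> + t) - c \<tau> - (l * trace (c (\<tau> + t) - c \<tau>)) *\<^sub>R mat 1) *v v)"
    by (simp add: matrix_le_def)
  also have "\<dots> = v \<bullet> ((c (\<tau> + t) - c \<tau>) *v v) - l * trace (c (\<tau> + t) - c \<tau>) * (v \<bullet> v)"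
    by (simp add: matrix_vector_mult_diff_rdistrib scaleR_matrix_vector_assoc[symmetric] inner_diff_right)
  finally show "l * (v \<bullet> v) * trace (c (\<tau> + t) - c \<tau>) \<le> v \<bullet> ((c (\<tau> + t) - c \<tau>) *v v)"
    by (simp add: mult_ac)
  have "finite_variation (\<lambda>t. a (\<tau> + t))" by (rule finite_variation_shift[OF fa(1) \<tau>]) simp
  moreover have "continuous_on {0..} (\<lambda>t. a (\<tau> + t))"
    by (intro continuous_on_compose2[OF fa(2)] continuous_intros) (use \<tau> in auto)
  ultimately have "norm (a (\<tau> + t) - a \<tau>) \<le> measure (abs_diff_measure (\<lambda>t. a (\<tau> + t))) {0<..t}"
    using abs_diff_measure_Ioc[of "\<lambda>t. a (\<tau> + t)" t] t by simp
  hence "e * norm (a (\<tau> + t) - a \<tau>) \<le> e * measure (abs_diff_measure (\<lambda>t. a (\<tau> + t))) {0<..t}"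
    using e by simp
  also have "\<dots> \<le> trace (c (\<tau> + t) - c \<tau>)" using drift I unfolding drift_dominated_on_def D[symmetric] by blast
  finally show "e * norm (a (\<tau> + t) - a \<tau>) \<le> trace (c (\<tau> + t) - c \<tau>)" .
qed

section \<open>The augmented filtration\<close>

text \<open>Adding the null sets allows one to redefine processes that are only almost surely continuous
  so that all their paths are continuous.\<close>

definition augmented :: "'k::finite cpath measure \<Rightarrow> real \<Rightarrow> 'k cpath measure" where
  "augmented P t = sigma UNIV (sets (\<F> (ennreal t)) \<union> null_sets P)"

lemma continuous_coord:
  assumes "0 \<le> s"
  shows "continuous_on UNIV (\<lambda>\<omega> :: 'k::finite cpath. coord \<omega> s)"
  unfolding continuous_on_iff
proof (intro ballI allI impI)
  fix v :: "'k cpath" and e :: real assume e: "0 < e"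
  obtain n where n: "s \<le> real (Suc n)" by (meson real_arch_simple le_SucI of_nat_le_iff order_trans)
  \<comment> \<open>A single summand of the metric controls the supremum over [0, n + 1]; its cap at
    1 is the reason for min e 1.\<close>
  define d where "d = (1/2) ^ Suc n * min e 1"
  have "dist (coord w s) (coord v s) < e" if "dist w v < d" for w
  proof -
    have "(1/2) ^ Suc n * min (sup_dist (real (Suc n)) w v) 1 \<le> dist w v"
    proof -
      have "(\<Sum>m\<in>{n}. (1/2) ^ Suc m * min (sup_dist (real (Suc m)) w v) 1) \<le> dist w v"
        unfolding dist_cpath_def
        by (rule sum_le_suminf[OF summable_dist_cpath])
           (auto simp: sup_dist_nonneg simp del: of_nat_Suc intro!: mult_nonneg_nonneg)
      thus ?thesis by (simp del: of_nat_Suc power_Suc)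
    qed
    hence "(1/2) ^ Suc n * min (sup_dist (real (Suc n)) w v) 1 < (1/2) ^ Suc n * min e 1"
      using that unfolding d_def by linarith
    hence "min (sup_dist (real (Suc n)) w v) 1 < min e 1"
      by (rule mult_less_cancel_left_pos[THEN iffD1, rotated]) simp
    hence "sup_dist (real (Suc n)) w v < e" by (auto simp: min_def split: if_splits)
    thus ?thesis using norm_le_sup_dist[OF assms n, of w v] by (simp add: dist_norm)
  qed
  moreover have "0 < d" using e by (simp add: d_def)
  ultimately show "\<exists>d>0. \<forall>w\<in>UNIV. dist w v < d \<longrightarrow> dist (coord w s) (coord v s) < e" by blast
qed

lemma space_F: "space (\<F> t) = UNIV"
  by (simp add: \<F>_def space_measure_of_conv)

lemma sets_F:
  "sets (\<F> t) = sigma_sets UNIV {(\<lambda>\<omega>. coord \<omega> s) -` U | s U. 0 \<le> s \<and> ennreal s \<le> t \<and> U \<in> sets borel}"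
  by (simp add: \<F>_def)

lemma sets_F_borel: "sets (\<F> t) \<subseteq> sets (borel :: 'k::finite cpath measure)"
proof -
  have "(\<lambda>\<omega>. coord \<omega> s) -` U \<in> sets (borel :: 'k cpath measure)" if "0 \<le> s" "U \<in> sets borel" for s U
    using borel_measurable_continuous_onI[OF continuous_coord[OF that(1)], THEN measurable_sets, OF that(2)]
    by simp
  hence "{(\<lambda>\<omega>. coord \<omega> s) -` U | s U. 0 \<le> s \<and> ennreal s \<le> t \<and> U \<in> sets borel} \<subseteq> sets (borel :: 'k cpath measure)"
    by blast
  from sets.sigma_sets_subset[OF this] show ?thesis by (simp add: sets_F)
qed

lemma sets_F_mono: "s \<le> t \<Longrightarrow> sets (\<F> s) \<subseteq> sets (\<F> t)"
  unfolding sets_F by (intro sigma_sets_mono') (blast intro: order_trans)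

lemma space_augmented: "space (augmented P t) = UNIV"
  by (simp add: augmented_def space_measure_of_conv)

lemma sets_augmented: "sets (augmented P t) = sigma_sets UNIV (sets (\<F> (ennreal t)) \<union> null_sets P)"
  by (simp add: augmented_def)

lemma F_in_augmented: "sets (\<F> (ennreal t)) \<subseteq> sets (augmented P t)"
  and null_in_augmented: "null_sets P \<subseteq> sets (augmented P t)"
  unfolding sets_augmented by (auto intro: sigma_sets.Basic)

lemma measurable_augmented: "f \<in> measurable (\<F> (ennreal t)) L \<Longrightarrow> f \<in> measurable (augmented P t) L"
  using F_in_augmented[of t P] by (auto simp: measurable_def space_F space_augmented)

text \<open>The sets that agree with a set of the raw filtration up to a subset of a null set form a
  \<sigma>-algebra, and it contains both kinds of generators.\<close>

lemma augmented_approx: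
  assumes P: "sets P = sets (borel :: 'k::finite cpath measure)" and B: "B \<in> sets (augmented P t)"
  shows "\<exists>B'\<in>sets (\<F> (ennreal t)). \<exists>N\<in>null_sets P. (B - B') \<union> (B' - B) \<subseteq> N"
  using B unfolding sets_augmented
proof (induction rule: sigma_sets.induct)
  case (Basic a)
  thus ?case
  proof
    assume "a \<in> null_sets P"
    thus ?thesis by (intro bexI[of _ "{}"] bexI[of _ a]) auto
  next
    assume "a \<in> sets (\<F> (ennreal t))"
    thus ?thesis by (intro bexI[of _ a] bexI[of _ "{}"]) auto
  qed
next
  case Empty
  show ?case by (intro bexI[of _ "{}"]) auto
next
  case (Compl a)
  then obtain B' N where *: "B' \<in> sets (\<F> (ennreal t))" "N \<in> null_sets P" "(a - B') \<union> (B' - a) \<subseteq> N" by blast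
  have "UNIV - B' \<in> sets (\<F> (ennreal t))" using sets.compl_sets[OF *(1)] by (simp add: space_F)
  moreover have "((UNIV - a) - (UNIV - B')) \<union> ((UNIV - B') - (UNIV - a)) \<subseteq> N" using *(3) by blast
  ultimately show ?case using *(2) by blast
next
  case (Union a)
  then obtain B' N where *: "\<And>i. B' i \<in> sets (\<F> (ennreal t))" "\<And>i. N i \<in> null_sets P"
      "\<And>i::nat. (a i - B' i) \<union> (B' i - a i) \<subseteq> N i" by metis
  have "(\<Union>i. B' i) \<in> sets (\<F> (ennreal t))" "(\<Union>i. N i) \<in> null_sets P"
    using *(1,2) by (auto intro: sets.countable_UN null_sets_UN')
  moreover have "((\<Union>i. a i) - (\<Union>i. B' i)) \<union> ((\<Union>i. B' i) - (\<Union>i. a i)) \<subseteq> (\<Union>i. N i)" using *(3) by blast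
  ultimately show ?case by blast
qed

lemma filtered_augmented:
  assumes "prob_space P" "sets P = sets (borel :: 'k::finite cpath measure)"
  shows "filtered_prob_space P (augmented P)"
proof -
  have sp: "space P = UNIV" using sets_eq_imp_space_eq[OF assms(2)] by simp
  show ?thesis
  proof (intro filtered_prob_space.intro assms(1) filtered_prob_space_axioms.intro)
    fix t :: real
    have "sets (\<F> (ennreal t)) \<union> null_sets P \<subseteq> sets P" using sets_F_borel assms(2) by auto
    hence "sets (augmented P t) \<subseteq> sets P" unfolding sets_augmented
      using sets.sigma_sets_subset[of "sets (\<F> (ennreal t)) \<union> null_sets P" P] by (simp add: sp)
    thus "subalgebra P (augmented P t)" by (simp add: subalgebra_def sp space_augmented)
  next
    fix s t :: real assume "s \<le> t"
    hence "sets (\<F> (ennreal s)) \<subseteq> sets (\<F> (ennreal t))" by (intro sets_F_mono ennreal_leI)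
    hence "sets (augmented P s) \<subseteq> sets (augmented P t)" unfolding sets_augmented
      by (intro sigma_sets_mono') auto
    thus "subalgebra (augmented P t) (augmented P s)" by (simp add: subalgebra_def space_augmented)
  qed
qed

lemma augmented_measurable_If:
  assumes X: "f \<in> borel_measurable (\<F> (ennreal t))" and N: "N \<in> null_sets P"
  shows "(\<lambda>\<omega>. if \<omega> \<in> N then c else f \<omega>) \<in> borel_measurable (augmented P t)"
proof -
  note [measurable] = measurable_augmented[OF X, of P]
  have [measurable]: "N \<in> sets (augmented P t)" using null_in_augmented N by blast
  show ?thesis by measurable
qed

text \<open>Conditional expectation is characterized by integrals over the sets of the
  \<sigma>-algebra. Each augmented set may be exchanged there for a raw set from which it differs by
  a null set, and changing X on N does not affect the integrals.\<close>

lemma augmented_martingale: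
  assumes P: "prob_space P" "sets P = sets (borel :: 'k::finite cpath measure)"
    and X: "martingale P X" and N: "N \<in> null_sets P"
    and c: "\<And>\<omega>. \<omega> \<notin> N \<Longrightarrow> continuous_on {0..} (\<lambda>t. X t \<omega>)"
  shows "filtered_prob_space.continuous_martingale P (augmented P) (\<lambda>t \<omega>. if \<omega> \<in> N then 0 else X t \<omega>)"
proof -
  interpret filtered_prob_space P "augmented P" by (rule filtered_augmented[OF P])
  let ?X = "\<lambda>t \<omega>. if \<omega> \<in> N then 0 else X t \<omega>"
  have sp: "space P = UNIV" using sets_eq_imp_space_eq[OF P(2)] by simp
  have XF: "X t \<in> borel_measurable (\<F> (ennreal t))" and Xi: "integrable P (X t)" if "0 \<le> t" for t
    using X that by (auto simp: martingale_def adapted_def)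
  have m: "?X t \<in> borel_measurable (augmented P t)" if "0 \<le> t" for t
    by (rule augmented_measurable_If[OF XF[OF that] N])
  have eq: "AE \<omega> in P. ?X t \<omega> = X t \<omega>" for t using AE_not_in[OF N] by auto
  have i: "integrable P (?X t)" if "0 \<le> t" for t
    by (rule integrable_cong_AE_imp[OF Xi[OF that] measurable_H_P[OF that m[OF that]]])
       (use eq[of t] in \<open>eventually_elim, simp\<close>)
  have cond: "AE \<omega> in P. real_cond_exp P (augmented P s) (?X t) \<omega> = ?X s \<omega>" if st: "0 \<le> s" "s \<le> t" for s t
  proof -
    have t: "0 \<le> t" using st by simp
    interpret a: finite_measure_subalgebra P "augmented P s"
      by unfold_locales (rule subalgebra_H[OF st(1)])
    interpret f: finite_measure_subalgebra P "\<F> (ennreal s)"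
      by unfold_locales (use sets_F_borel P(2) in \<open>simp add: subalgebra_def space_F sp\<close>)
    show ?thesis
    proof (rule a.real_cond_exp_charact[OF _ i[OF t] i[OF st(1)] m[OF st(1)]])
      fix A assume "A \<in> sets (augmented P s)"
      then obtain A' N' where A': "A' \<in> sets (\<F> (ennreal s))" "N' \<in> null_sets P" "(A - A') \<union> (A' - A) \<subseteq> N'"
        using augmented_approx[OF P(2)] by meson
      have AP: "A \<in> sets P" "A' \<in> sets P"
        using \<open>A \<in> sets (augmented P s)\<close> subalgebra_H[OF st(1)] A'(1) sets_F_borel P(2)
        by (auto simp: subalgebra_def)
      have trans: "(\<integral>\<omega>\<in>A. ?X u \<omega> \<partial>P) = (\<integral>\<omega>\<in>A'. X u \<omega> \<partial>P)" if u: "0 \<le> u" for u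
        unfolding set_lebesgue_integral_def
      proof (rule integral_cong_AE)
        note [measurable] = AP borel_measurable_integrable[OF Xi[OF u]] borel_measurable_integrable[OF i[OF u]]
        show "(\<lambda>\<omega>. indicator A \<omega> *\<^sub>R ?X u \<omega>) \<in> borel_measurable P"
          "(\<lambda>\<omega>. indicator A' \<omega> *\<^sub>R X u \<omega>) \<in> borel_measurable P" by measurable
        show "AE \<omega> in P. indicator A \<omega> *\<^sub>R ?X u \<omega> = indicator A' \<omega> *\<^sub>R X u \<omega>"
          using AE_not_in[OF N] AE_not_in[OF A'(2)]
        proof eventually_elim
          case (elim \<omega>)
          hence "\<omega> \<in> A \<longleftrightarrow> \<omega> \<in> A'" using A'(3) by blast
          thus ?case using elim by (simp add: indicator_def)
        qed
      qed
      have "(\<integral>\<omega>\<in>A'. X t \<omega> \<partial>P) = (\<integral>\<omega>\<in>A'. real_cond_exp P (\<F> (ennreal s)) (X t) \<omega> \<partial>P)"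
        by (rule f.real_cond_exp_intA[OF Xi[OF t] A'(1)])
      also have "\<dots> = (\<integral>\<omega>\<in>A'. X s \<omega> \<partial>P)"
        unfolding set_lebesgue_integral_def
      proof (rule integral_cong_AE)
        note [measurable] = AP borel_measurable_integrable[OF Xi[OF st(1)]]
        show "(\<lambda>\<omega>. indicator A' \<omega> *\<^sub>R real_cond_exp P (\<F> (ennreal s)) (X t) \<omega>) \<in> borel_measurable P"
          "(\<lambda>\<omega>. indicator A' \<omega> *\<^sub>R X s \<omega>) \<in> borel_measurable P" by measurable
        have "AE \<omega> in P. real_cond_exp P (\<F> (ennreal s)) (X t) \<omega> = X s \<omega>"
          using X st by (simp add: martingale_def)
        thus "AE \<omega> in P. indicator A' \<omega> *\<^sub>R real_cond_exp P (\<F> (ennreal s)) (X t) \<omega> = indicator A' \<omega> *\<^sub>R X s \<omega>"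
          by eventually_elim simp
      qed
      finally show "(\<integral>\<omega>\<in>A. ?X t \<omega> \<partial>P) = (\<integral>\<omega>\<in>A. ?X s \<omega> \<partial>P)" using trans[OF t] trans[OF st(1)] by simp
    qed
  qed
  show ?thesis
    unfolding continuous_martingale_def continuous_adapted_def
  proof (intro conjI allI impI ballI)
    fix \<omega> show "continuous_on {0..} (\<lambda>t. ?X t \<omega>)" using c by (cases "\<omega> \<in> N") auto
  qed (use m i cond in auto)
qed

text \<open>If T < t, some rational q < t satisfies T \<le> q; this leads from the non-strict
  definition of a stopping time to optional times.\<close>

lemma stopping_time_less:
  assumes "stopping_time \<F> T" "0 \<le> t"
  shows "Measurable.pred (augmented P t) (\<lambda>\<omega>. T \<omega> < ennreal t)"
proof -
  have eq: "T \<omega> < ennreal t \<longleftrightarrow> \<not> (\<forall>q\<in>\<rat> \<inter> {0..<t}. \<not> T \<omega> \<le> ennreal q)" for \<omega>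
  proof
    assume lt: "T \<omega> < ennreal t"
    then obtain x where x: "0 \<le> x" "T \<omega> = ennreal x" by (cases "T \<omega>") auto
    hence "x < t" using lt by (simp add: ennreal_less_iff)
    then obtain q where "q \<in> \<rat>" "x < q" "q < t" using Rats_dense_in_real by blast
    thus "\<not> (\<forall>q\<in>\<rat> \<inter> {0..<t}. \<not> T \<omega> \<le> ennreal q)" using x by (auto intro!: bexI[of _ q] ennreal_leI)
  next
    assume "\<not> (\<forall>q\<in>\<rat> \<inter> {0..<t}. \<not> T \<omega> \<le> ennreal q)"
    then obtain q where "0 \<le> q" "q < t" "T \<omega> \<le> ennreal q" by auto
    thus "T \<omega> < ennreal t" by (meson ennreal_lessI le_less_trans)
  qed
  have "Measurable.pred (augmented P t) (\<lambda>\<omega>. \<not> T \<omega> \<le> ennreal q)" if q: "q \<in> \<rat> \<inter> {0..<t}" for q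
  proof (rule pred_intros_logic(2))
    have "Measurable.pred (\<F> (ennreal q)) (\<lambda>\<omega>. T \<omega> \<le> ennreal q)" by (rule stopping_timeD[OF assms(1)])
    moreover have "sets (\<F> (ennreal q)) \<subseteq> sets (\<F> (ennreal t))" using q by (intro sets_F_mono ennreal_leI) auto
    ultimately show "Measurable.pred (augmented P t) (\<lambda>\<omega>. T \<omega> \<le> ennreal q)"
      using F_in_augmented[of t P] by (auto simp: pred_def space_F space_augmented)
  qed
  moreover have "countable (\<rat> \<inter> {0..<t})" using countable_rat by (rule countable_Int1)
  ultimately have "Measurable.pred (augmented P t) (\<lambda>\<omega>. \<forall>q\<in>\<rat> \<inter> {0..<t}. \<not> T \<omega> \<le> ennreal q)"
    by (intro pred_countable_Ball)
  thus ?thesis unfolding eq by (rule pred_intros_logic(2))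
qed

section \<open>Localization\<close>

lemma continuous_on_stopped:
  assumes "continuous_on {0..} (\<lambda>t. X t \<omega>)"
  shows "continuous_on {0..} (\<lambda>t. stopped X T t \<omega>)"
proof -
  have "continuous_on {0..} (\<lambda>t. enn2real (min (ennreal t) (T \<omega>)))"
  proof (cases "T \<omega>")
    case (real x)
    have "continuous_on {0..} (\<lambda>t. min t x)" by (intro continuous_intros)
    thus ?thesis
    proof (rule continuous_on_cong[THEN iffD1, OF refl, rotated])
      fix t :: real assume "t \<in> {0..}"
      thus "min t x = enn2real (min (ennreal t) (T \<omega>))" using real by (simp add: min_def)
    qed
  next
    case top
    have "continuous_on {0..} (\<lambda>t. t :: real)" by (intro continuous_intros)
    thus ?thesis
      by (rule continuous_on_cong[THEN iffD1, OF refl, rotated]) (simp add: top)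
  qed
  thus ?thesis unfolding stopped_def by (rule continuous_on_compose2[OF assms]) auto
qed

lemma stopped_before: "0 \<le> t \<Longrightarrow> ennreal t \<le> T \<omega> \<Longrightarrow> stopped X T t \<omega> = X t \<omega>"
  by (simp add: stopped_def)

text \<open>Agreement with X before \<open>T n\<close> is asserted on every path, with both sides 0
  on N, because it is evaluated at random times, for which an exceptional null set for each fixed
  time would not suffice.\<close>

lemma localizing_martingales:
  assumes P: "prob_space P" "sets P = sets (borel :: 'k::finite cpath measure)"
    and X: "continuous_local_martingale P X" and N: "N \<in> null_sets P"
    and c: "\<And>\<omega>. \<omega> \<notin> N \<Longrightarrow> continuous_on {0..} (\<lambda>t. X t \<omega>)"
  shows "\<exists>T L. (\<forall>n::nat. stopping_time \<F> (T n)) \<and> (AE \<omega> in P. (\<lambda>n. T n \<omega>) \<longlonglongrightarrow> \<infinity>) \<and>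
    (\<forall>n. filtered_prob_space.continuous_martingale P (augmented P) (L n)) \<and>
    (\<forall>n t \<omega>. 0 \<le> t \<longrightarrow> ennreal t \<le> T n \<omega> \<longrightarrow> L n t \<omega> = (if \<omega> \<in> N then 0 else X t \<omega> - X 0 \<omega>))"
proof -
  obtain T :: "nat \<Rightarrow> 'k cpath \<Rightarrow> ennreal" where T: "\<And>n. stopping_time \<F> (T n)"
    and lim: "AE \<omega> in P. incseq (\<lambda>n. T n \<omega>) \<and> (\<lambda>n. T n \<omega>) \<longlonglongrightarrow> \<infinity>"
    and mart: "\<And>n. martingale P (\<lambda>t \<omega>. stopped X (T n) t \<omega> - X 0 \<omega>)"
    using X unfolding continuous_local_martingale_def by blast
  define L where "L = (\<lambda>n t \<omega>. if \<omega> \<in> N then 0 else stopped X (T n) t \<omega> - X 0 \<omega>)"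
  have "filtered_prob_space.continuous_martingale P (augmented P) (L n)" for n
    unfolding L_def
    by (rule augmented_martingale[OF P mart N]) (intro continuous_intros continuous_on_stopped c)
  moreover have "AE \<omega> in P. (\<lambda>n. T n \<omega>) \<longlonglongrightarrow> \<infinity>" using lim by eventually_elim simp
  moreover have "L n t \<omega> = (if \<omega> \<in> N then 0 else X t \<omega> - X 0 \<omega>)" if "0 \<le> t" "ennreal t \<le> T n \<omega>" for n t \<omega>
    using stopped_before[where T="T n" and X=X, OF that] by (simp add: L_def)
  ultimately show ?thesis using T by blast
qed

text \<open>Finitely many sequences tending to infinity eventually exceed K simultaneously, so their
  minimum capped at K reaches K at some n. The cap also makes the times real-valued.\<close>

lemma common_localizing_times:
  fixes T1 :: "'i::finite \<Rightarrow> nat \<Rightarrow> 'k::finite cpath \<Rightarrow> ennreal"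
  assumes T: "\<And>i n. stopping_time \<F> (T1 i n)" and lim: "\<And>i. AE \<omega> in P. (\<lambda>n. T1 i n \<omega>) \<longlonglongrightarrow> \<infinity>"
    and P: "prob_space P" "sets P = sets borel" and K: "0 \<le> K"
  obtains R :: "nat \<Rightarrow> 'k cpath \<Rightarrow> real" where
    "\<And>n. filtered_prob_space.optional_time P (augmented P) (R n)"
    "AE \<omega> in P. \<exists>n. K \<le> R n \<omega>" "\<And>i n \<omega>. ennreal (R n \<omega>) \<le> T1 i n \<omega>"
proof -
  interpret filtered_prob_space P "augmented P" by (rule filtered_augmented[OF P])
  define R where "R = (\<lambda>n \<omega>. enn2real (min (ennreal K) (INF i. T1 i n \<omega>)))"
  have R: "ennreal (R n \<omega>) = min (ennreal K) (INF i. T1 i n \<omega>)" for n \<omega>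
    unfolding R_def by (subst ennreal_enn2real) (auto simp: min_less_iff_disj)
  show thesis
  proof (rule that)
    fix n
    show "optional_time (R n)"
      unfolding optional_time_def
    proof (intro conjI ballI allI impI)
      show "0 \<le> R n \<omega>" for \<omega> by (simp add: R_def)
      fix t :: real assume t: "0 \<le> t"
      have "R n \<omega> < t \<longleftrightarrow> K < t \<or> (\<exists>i. T1 i n \<omega> < ennreal t)" for \<omega>
      proof -
        have "R n \<omega> < t \<longleftrightarrow> ennreal (R n \<omega>) < ennreal t" by (simp add: R_def ennreal_less_iff)
        also have "\<dots> \<longleftrightarrow> K < t \<or> (\<exists>i. T1 i n \<omega> < ennreal t)"
          unfolding R min_less_iff_disj INF_less_iff using K by (simp add: ennreal_less_iff)
        finally show ?thesis .
      qed
      moreover have "Measurable.pred (augmented P t) (\<lambda>\<omega>. K < t \<or> (\<exists>i. T1 i n \<omega> < ennreal t))"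
        using stopping_time_less[where P=P, OF T t] by measurable
      ultimately show "Measurable.pred (augmented P t) (\<lambda>\<omega>. R n \<omega> < t)" by (simp only:)
    qed
  next
    have "AE \<omega> in P. \<forall>i\<in>UNIV. (\<lambda>n. T1 i n \<omega>) \<longlonglongrightarrow> \<infinity>"
      by (rule AE_finite_allI) (use lim in auto)
    thus "AE \<omega> in P. \<exists>n. K \<le> R n \<omega>"
    proof eventually_elim
      case (elim \<omega>)
      have "\<forall>\<^sub>F n in sequentially. ennreal K < T1 i n \<omega>" for i
        using elim by (intro order_tendstoD(1)[of _ \<infinity>]) auto
      hence "\<forall>\<^sub>F n in sequentially. \<forall>i. ennreal K < T1 i n \<omega>" by (rule eventually_all_finite)
      then obtain n where n: "\<And>i. ennreal K < T1 i n \<omega>" using eventually_happens'[OF sequentially_bot] by blast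
      hence "ennreal K \<le> (INF i. T1 i n \<omega>)" by (intro INF_greatest less_imp_le)
      hence "ennreal (R n \<omega>) = ennreal K" unfolding R by (simp add: min_absorb1)
      hence "R n \<omega> = K" using K by (simp add: R_def)
      thus ?case by auto
    qed
  next
    fix i n \<omega>
    show "ennreal (R n \<omega>) \<le> T1 i n \<omega>" unfolding R by (intro min.coboundedI2 INF_lower) simp
  qed
qed

section \<open>Exit from the closure\<close>

lemma ennreal_pos_lower_bound: "0 < x \<Longrightarrow> \<exists>c>0. ennreal c \<le> x"
  by (cases x) (auto intro: exI[of _ 1])

text \<open>Subtraction is truncated at 0; positivity of b excludes the case in which x lies below
  a.\<close>

lemma ennreal_add_le:
  assumes "0 \<le> a" "0 < b" "ennreal b \<le> x - ennreal a"
  shows "ennreal (a + b) \<le> x"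
proof (cases x)
  case (real y)
  hence "ennreal b \<le> ennreal (y - a)" using assms by (simp add: ennreal_minus)
  hence "b \<le> y - a" using assms by (simp add: ennreal_le_iff2)
  thus ?thesis using real by (simp add: ennreal_leI)
qed simp

theorem proposition3p11:
  fixes \<P> :: "('k::finite) cpath measure set"
    and Y :: "real \<Rightarrow> 'k cpath \<Rightarrow> real ^ ('d::finite)"
    and M A :: "'k cpath measure \<Rightarrow> real \<Rightarrow> 'k cpath \<Rightarrow> real ^ 'd"
    and C :: "'k cpath measure \<Rightarrow> real \<Rightarrow> 'k cpath \<Rightarrow> real ^ 'd ^ 'd"
    and Q :: "(real ^ 'd) set"
  assumes "compactin weak_topology \<P>"
    and "adapted Y"
    and "\<And>\<omega>. continuous_on {0..} (\<lambda>t. Y t \<omega>)"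
    and "\<And>P. P \<in> \<P> \<Longrightarrow> semimartingale_decomposition P Y (M P) (A P)"
    and "\<And>P. P \<in> \<P> \<Longrightarrow> quadratic_variation P (M P) (C P)"
    and "open Q"
    and "exterior_ball_condition Q"
    and "quasi_continuous \<P> Y"
    and "\<And>P. P \<in> \<P> \<Longrightarrow>
      AE \<omega> in P. exit_time Y Q \<omega> < \<infinity> \<longrightarrow>
        (\<exists>\<sigma> l e. stopping_time \<F> \<sigma> \<and> 0 < l \<and> 0 < e \<and>
          (\<forall>\<omega>'\<in>paths_agreeing_upto (exit_time Y Q \<omega>) \<omega>.
            let \<tau> = enn2real (exit_time Y Q \<omega>);
                J = {t. 0 \<le> t \<and>
                      ennreal t \<le> min (\<sigma> \<omega>') (exit_time Y (closure Q) \<omega>' - exit_time Y Q \<omega>')}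
            in 0 < \<sigma> \<omega>' \<and>
               uniformly_elliptic_on l J (\<lambda>t. C P (\<tau> + t) \<omega>') \<and>
               drift_dominated_on e J (\<lambda>t. C P (\<tau> + t) \<omega>') (\<lambda>t. A P (\<tau> + t) \<omega>')))"
  shows "quasi_surely \<P> (\<lambda>\<omega>. exit_time Y Q \<omega> = exit_time Y (closure Q) \<omega>)"
  unfolding quasi_surely_def
proof (cases "Q = UNIV")
  \<comment> \<open>Measurability of the exit time rests on the distance to the complement of Q, so
    an empty complement is treated apart; both exit times are then infinite.\<close>
  case True
  thus "\<forall>P\<in>\<P>. AE \<omega> in P. exit_time Y Q \<omega> = exit_time Y (closure Q) \<omega>" by simp
next
  case not_UNIV: False
  show "\<forall>P\<in>\<P>. AE \<omega> in P. exit_time Y Q \<omega> = exit_time Y (closure Q) \<omega>"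
  proof
    fix P assume PP: "P \<in> \<P>"
    have "P \<in> topspace weak_topology" using compactin_subset_topspace[OF assms(1)] PP by blast
    hence P: "prob_space P" "sets P = sets borel" by (auto simp: topspace_weak_topology)
    interpret filtered_prob_space P "augmented P" by (rule filtered_augmented[OF P])
    have M_loc: "continuous_local_martingale P (\<lambda>t \<omega>. M P t \<omega> $ i)" for i
      using assms(4)[OF PP] by (simp add: semimartingale_decomposition_def vec_continuous_local_martingale_def)
    have MM_loc: "continuous_local_martingale P (\<lambda>t \<omega>. M P t \<omega> $ i * M P t \<omega> $ j - C P t \<omega> $ i $ j)" for i j
      using assms(5)[OF PP] by (simp add: quadratic_variation_def)
    have A_ad: "adapted (A P)" and C_ad: "adapted (C P)"
      using assms(4,5)[OF PP]
      by (auto simp: semimartingale_decomposition_def quadratic_variation_def finite_variation_process_def)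
    define \<Phi> where "\<Phi> = (\<lambda>\<omega>. (\<forall>i. continuous_on {0..} (\<lambda>t. M P t \<omega> $ i)) \<and> continuous_on {0..} (\<lambda>t. C P t \<omega>) \<and>
       (\<forall>t\<ge>0. Y t \<omega> = M P t \<omega> + A P t \<omega>) \<and> finite_variation (\<lambda>t. C P t \<omega>) \<and> finite_variation (\<lambda>t. A P t \<omega>))"
    have "AE \<omega> in P. \<Phi> \<omega>"
    proof -
      have 1: "AE \<omega> in P. \<forall>i. continuous_on {0..} (\<lambda>t. M P t \<omega> $ i)"
        unfolding AE_all_countable using M_loc by (simp add: continuous_local_martingale_def)
      have 2: "AE \<omega> in P. C P 0 \<omega> = 0 \<and> continuous_on {0..} (\<lambda>t. C P t \<omega>)"
        "AE \<omega> in P. finite_variation (\<lambda>t. C P t \<omega>)"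
        using assms(5)[OF PP] by (auto simp: quadratic_variation_def finite_variation_process_def)
      have 3: "AE \<omega> in P. \<forall>t\<ge>0. Y t \<omega> = M P t \<omega> + A P t \<omega>" "AE \<omega> in P. finite_variation (\<lambda>t. A P t \<omega>)"
        using assms(4)[OF PP] by (auto simp: semimartingale_decomposition_def finite_variation_process_def)
      show ?thesis using 1 2 3 by eventually_elim (simp add: \<Phi>_def)
    qed
    then obtain N where N: "N \<in> null_sets P" and "{\<omega> \<in> space P. \<not> \<Phi> \<omega>} \<subseteq> N"
      by (auto elim!: AE_E simp: null_sets_def)
    hence \<Phi>: "\<Phi> \<omega>" if "\<omega> \<notin> N" for \<omega>
      using that sets_eq_imp_space_eq[OF P(2)] by auto
    define M1 where "M1 = (\<lambda>t \<omega>. if \<omega> \<in> N then 0 else M P t \<omega>)"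
    define C1 where "C1 = (\<lambda>t \<omega>. if \<omega> \<in> N then 0 else C P t \<omega>)"
    have Y_ca: "continuous_adapted Y"
      unfolding continuous_adapted_def
    proof (intro conjI allI impI ballI assms(3))
      fix t :: real assume "0 \<le> t"
      thus "Y t \<in> borel_measurable (augmented P t)"
        using assms(2) by (intro measurable_augmented) (simp add: adapted_def)
    qed
    have C1_ca: "continuous_adapted C1"
      unfolding continuous_adapted_def
    proof (intro conjI allI impI ballI)
      fix t :: real assume "0 \<le> t"
      thus "C1 t \<in> borel_measurable (augmented P t)"
        unfolding C1_def using C_ad by (intro augmented_measurable_If[OF _ N]) (simp add: adapted_def)
    next
      fix \<omega> show "continuous_on {0..} (\<lambda>t. C1 t \<omega>)"
        unfolding C1_def using \<Phi>[of \<omega>] by (cases "\<omega> \<in> N") (auto simp: \<Phi>_def)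
    qed
    have M1_ca: "continuous_adapted M1"
      unfolding continuous_adapted_def
    proof (intro conjI allI impI ballI)
      fix t :: real assume t: "0 \<le> t"
      \<comment> \<open>The local martingale property gives adaptedness of M only component by
        component; as a vector it is obtained from Y - A, with which it coincides off N.\<close>
      have "(\<lambda>\<omega>. Y t \<omega> - A P t \<omega>) \<in> borel_measurable (\<F> (ennreal t))"
        using assms(2) A_ad t by (intro borel_measurable_diff) (auto simp: adapted_def)
      moreover have "M1 t = (\<lambda>\<omega>. if \<omega> \<in> N then 0 else Y t \<omega> - A P t \<omega>)"
        unfolding M1_def using \<Phi> t by (auto simp: \<Phi>_def)
      ultimately show "M1 t \<in> borel_measurable (augmented P t)"
        using augmented_measurable_If[OF _ N] by simp
    next
      fix \<omega> show "continuous_on {0..} (\<lambda>t. M1 t \<omega>)"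
      proof (cases "\<omega> \<in> N")
        case False
        have "continuous_on {0..} (\<lambda>t. \<chi> i. M P t \<omega> $ i)"
          using \<Phi>[OF False] by (intro continuous_on_vec_lambda) (simp add: \<Phi>_def)
        thus ?thesis using False by (simp add: M1_def)
      qed (simp add: M1_def)
    qed
    \<comment> \<open>A single finite index type for the components of M and the entries of the
      compensated products, so that one minimum of localizing times serves them all.\<close>
    define X where "X = (\<lambda>x t \<omega>. case x of Inl i \<Rightarrow> M P t \<omega> $ i
        | Inr (i, j) \<Rightarrow> M P t \<omega> $ i * M P t \<omega> $ j - C P t \<omega> $ i $ j)"
    have "\<exists>T L. (\<forall>n::nat. stopping_time \<F> (T n)) \<and> (AE \<omega> in P. (\<lambda>n. T n \<omega>) \<longlonglongrightarrow> \<infinity>) \<and>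
      (\<forall>n. continuous_martingale (L n)) \<and>
      (\<forall>n t \<omega>. 0 \<le> t \<longrightarrow> ennreal t \<le> T n \<omega> \<longrightarrow> L n t \<omega> = (if \<omega> \<in> N then 0 else X x t \<omega> - X x 0 \<omega>))" for x
    proof (rule localizing_martingales[OF P _ N])
      show "continuous_local_martingale P (X x)"
        using M_loc MM_loc by (cases x) (auto simp: X_def)
      fix \<omega> assume "\<omega> \<notin> N"
      note \<Phi>\<omega> = \<Phi>[OF this, unfolded \<Phi>_def]
      have m: "continuous_on {0..} (\<lambda>t. M P t \<omega> $ i)" for i using \<Phi>\<omega> by blast
      have c: "continuous_on {0..} (\<lambda>t. C P t \<omega> $ i $ j)" for i j using \<Phi>\<omega> by (intro continuous_intros) blast
      show "continuous_on {0..} (\<lambda>t. X x t \<omega>)"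
      proof (cases x)
        case (Inl i)
        show ?thesis using m[of i] by (simp add: X_def Inl)
      next
        case (Inr ij)
        obtain i j where ij: "ij = (i, j)" by (cases ij)
        have "continuous_on {0..} (\<lambda>t. M P t \<omega> $ i * M P t \<omega> $ j - C P t \<omega> $ i $ j)"
          by (rule continuous_on_diff[OF continuous_on_mult[OF m m] c])
        thus ?thesis by (simp add: X_def Inr ij)
      qed
    qed
    hence "\<forall>x. \<exists>T L. (\<forall>n::nat. stopping_time \<F> (T n)) \<and> (AE \<omega> in P. (\<lambda>n. T n \<omega>) \<longlonglongrightarrow> \<infinity>) \<and>
      (\<forall>n. continuous_martingale (L n)) \<and>
      (\<forall>n t \<omega>. 0 \<le> t \<longrightarrow> ennreal t \<le> T n \<omega> \<longrightarrow> L n t \<omega> = (if \<omega> \<in> N then 0 else X x t \<omega> - X x 0 \<omega>))" ..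
    from choice[OF this] obtain T1 where "\<forall>x. \<exists>L. (\<forall>n::nat. stopping_time \<F> (T1 x n)) \<and> (AE \<omega> in P. (\<lambda>n. T1 x n \<omega>) \<longlonglongrightarrow> \<infinity>) \<and>
      (\<forall>n. continuous_martingale (L n)) \<and>
      (\<forall>n t \<omega>. 0 \<le> t \<longrightarrow> ennreal t \<le> T1 x n \<omega> \<longrightarrow> L n t \<omega> = (if \<omega> \<in> N then 0 else X x t \<omega> - X x 0 \<omega>))" ..
    from choice[OF this] obtain L where TL: "\<And>x n. stopping_time \<F> (T1 x n)"
      "\<And>x. AE \<omega> in P. (\<lambda>n. T1 x n \<omega>) \<longlonglongrightarrow> \<infinity>" "\<And>x n. continuous_martingale (L x n)"
      "\<And>x n t \<omega>. 0 \<le> t \<Longrightarrow> ennreal t \<le> T1 x n \<omega> \<Longrightarrow> L x n t \<omega> = (if \<omega> \<in> N then 0 else X x t \<omega> - X x 0 \<omega>)"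
      by blast
    \<comment> \<open>The cap is applied before the conversion, which would send an infinite exit
      time to 0.\<close>
    define \<tau> where "\<tau> = (\<lambda>k \<omega>. enn2real (min (exit_time Y Q \<omega>) (ennreal (real (Suc k)))))"
    \<comment> \<open>One number serves at stage k as ellipticity constant, drift constant, radius
      of the exterior ball and length of time after the exit. The countably many stages cover all
      path-dependent constants.\<close>
    define h where "h = (\<lambda>k. 1 / real (Suc k))"
    have h: "0 < h k" for k by (simp add: h_def)
    \<comment> \<open>The strict inequality says that the cap is not reached, so that
      \<open>\<tau> k\<close> is the true exit time. All three conditions are known at that
      time.\<close>
    define B where "B = (\<lambda>k \<omega>. \<tau> k \<omega> < real (Suc k) \<and> Y (\<tau> k \<omega>) \<omega> \<in> touching Q (h k) \<and>
        norm (M1 (\<tau> k \<omega>) \<omega>) \<le> real (Suc k))"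
    define bad where "bad = (\<lambda>k \<delta> u \<omega>. \<not> good_increment Q (h k) (h k) \<delta> (C1 u \<omega> - C1 (\<tau> k \<omega>) \<omega>)
          ((Y u \<omega> - M1 u \<omega>) - (Y (\<tau> k \<omega>) \<omega> - M1 (\<tau> k \<omega>) \<omega>)) (Y u \<omega> - Y (\<tau> k \<omega>) \<omega>) (Y u \<omega>))"
    define fails where "fails = (\<lambda>k \<delta>. AE \<omega> in P. B k \<omega> \<longrightarrow>
      (\<forall>u. \<tau> k \<omega> < u \<longrightarrow> u \<le> \<tau> k \<omega> + h k \<longrightarrow> trace (C1 u \<omega> - C1 (\<tau> k \<omega>) \<omega>) \<noteq> 0) \<longrightarrow>
      (\<forall>u0>\<tau> k \<omega>. \<exists>u. \<tau> k \<omega> < u \<and> u < u0 \<and> bad k \<delta> u \<omega>))"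
    have "\<exists>\<delta>>0. fails k \<delta>" for k
    proof -
      have "0 < h k * (h k)\<^sup>2 / 8" using h[of k] by simp
      from remainder_rate_small[OF h[of k] this, of "h k"]
      obtain \<delta> where \<delta>: "0 < \<delta>" "remainder_rate (h k) (h k) \<delta> \<le> h k * (h k)\<^sup>2 / 8" by blast
      have \<tau>_opt: "optional_time (\<tau> k)"
        unfolding \<tau>_def by (rule exit_time_optional[OF Y_ca assms(6) not_UNIV]) simp
      have \<tau>K: "\<tau> k \<omega> \<le> real (Suc k)" for \<omega>
      proof -
        have "min (exit_time Y Q \<omega>) (ennreal (real (Suc k))) \<le> ennreal (real (Suc k))" by simp
        thus ?thesis unfolding \<tau>_def by (rule enn2real_leI[rotated]) simp
      qed
      obtain R :: "nat \<Rightarrow> 'k cpath \<Rightarrow> real" where R: "\<And>n. optional_time (R n)"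
        "AE \<omega> in P. \<exists>n. real (Suc k) + h k \<le> R n \<omega>" "\<And>x n \<omega>. ennreal (R n \<omega>) \<le> T1 x n \<omega>"
        by (rule common_localizing_times[where ?T1.0=T1 and P=P and K="real (Suc k) + h k", OF TL(1,2) P])
           (use h[of k] in auto)
      have L_eq: "L x n t \<omega> = (if \<omega> \<in> N then 0 else X x t \<omega> - X x 0 \<omega>)" if "0 \<le> t" "t \<le> R n \<omega>" for x n t \<omega>
        by (rule TL(4)[OF that(1) order_trans[OF ennreal_leI[OF that(2)] R(3)]])
      have B_past: "past (\<tau> k) (\<lambda>\<omega>. of_bool (B k \<omega>))"
      proof -
        have [measurable]: "touching Q (h k) \<in> sets borel" using closed_touching by (rule borel_closed)
        have "past (\<tau> k) (\<lambda>\<omega>. (if \<tau> k \<omega> < real (Suc k) then 1 else 0) *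
            (indicat_real (touching Q (h k)) (Y (\<tau> k \<omega>) \<omega>) * indicat_real {x. norm x \<le> real (Suc k)} (M1 (\<tau> k \<omega>) \<omega>)))"
          by (intro past_mult past_less_const \<tau>_opt past_path[OF Y_ca \<tau>_opt] past_path[OF M1_ca \<tau>_opt]
                borel_measurable_indicator) measurable
        moreover have "(\<lambda>\<omega>. (if \<tau> k \<omega> < real (Suc k) then 1 else 0) *
            (indicat_real (touching Q (h k)) (Y (\<tau> k \<omega>) \<omega>) * indicat_real {x. norm x \<le> real (Suc k)} (M1 (\<tau> k \<omega>) \<omega>)))
            = (\<lambda>\<omega>. of_bool (B k \<omega>))"
          by (intro ext) (simp add: B_def indicator_def)
        ultimately show ?thesis by simp
      qed
      have "fails k \<delta>"
        unfolding fails_def bad_def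
      proof (rule instant_failure[where ?N1.0="\<lambda>n i. L (Inl i) n" and ?N2.0="\<lambda>n i j. L (Inr (i, j)) n" and R=R
            and K="real (Suc k) + h k" and r="h k" and b="real (Suc k)",
            OF Y_ca M1_ca C1_ca TL(3) _ TL(3) _ \<tau>_opt R(1) _ _ R(2) B_past _ _ h h h \<delta>(1) h \<delta>(2)])
        show "\<tau> k \<omega> + h k \<le> real (Suc k) + h k" for \<omega> using \<tau>K[of \<omega>] by simp
        show "0 \<le> real (Suc k) + h k" using h[of k] by simp
        show "Y (\<tau> k \<omega>) \<omega> \<in> touching Q (h k)" "norm (M1 (\<tau> k \<omega>) \<omega>) \<le> real (Suc k)" if "B k \<omega>" for \<omega>
          using that by (auto simp: B_def)
        fix n \<omega> and t :: real assume "0 \<le> t" "t \<le> R n \<omega>"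
        note e = L_eq[OF this]
        show "L (Inl i) n t \<omega> = M1 t \<omega> $ i - M1 0 \<omega> $ i" for i
          unfolding e by (simp add: M1_def X_def)
        show "L (Inr (i, j)) n t \<omega> = (M1 t \<omega> $ i * M1 t \<omega> $ j - C1 t \<omega> $ i $ j) -
            (M1 0 \<omega> $ i * M1 0 \<omega> $ j - C1 0 \<omega> $ i $ j)" for i j
          unfolding e by (simp add: M1_def C1_def X_def)
      qed
      thus ?thesis using \<delta>(1) by blast
    qed
    then obtain \<delta> where \<delta>: "\<And>k. 0 < \<delta> k" and fail: "\<And>k. fails k (\<delta> k)" by metis
    from fail have "AE \<omega> in P. \<forall>k. B k \<omega> \<longrightarrow>
      (\<forall>u. \<tau> k \<omega> < u \<longrightarrow> u \<le> \<tau> k \<omega> + h k \<longrightarrow> trace (C1 u \<omega> - C1 (\<tau> k \<omega>) \<omega>) \<noteq> 0) \<longrightarrow>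
      (\<forall>u0>\<tau> k \<omega>. \<exists>u. \<tau> k \<omega> < u \<and> u < u0 \<and> bad k (\<delta> k) u \<omega>)"
      unfolding AE_all_countable fails_def by blast
    thus "AE \<omega> in P. exit_time Y Q \<omega> = exit_time Y (closure Q) \<omega>"
      using AE_not_in[OF N] assms(9)[OF PP]
    proof eventually_elim
      case (elim \<omega>)
      show ?case
      proof (rule ccontr)
        assume "exit_time Y Q \<omega> \<noteq> exit_time Y (closure Q) \<omega>"
        hence less: "exit_time Y Q \<omega> < exit_time Y (closure Q) \<omega>"
          using exit_time_mono[OF closure_subset, of Y Q \<omega>] by (simp add: less_le)
        obtain t0 where t0: "0 \<le> t0" "exit_time Y Q \<omega> = ennreal t0" "Y t0 \<omega> \<in> frontier Q"
          by (rule exit_before_closure[where Y=Y and \<omega>=\<omega>, OF assms(3) assms(6) less])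
        have fin: "exit_time Y Q \<omega> < \<infinity>" using t0(2) by simp
        define J where "J = (\<lambda>\<sigma>. {t. 0 \<le> t \<and>
                        ennreal t \<le> min (\<sigma> \<omega>) (exit_time Y (closure Q) \<omega> - exit_time Y Q \<omega>)})"
        \<comment> \<open>The path belongs to its own class, so the hypothesis may be read on
          \<omega> itself.\<close>
        have self: "\<omega> \<in> paths_agreeing_upto (exit_time Y Q \<omega>) \<omega>" by (simp add: paths_agreeing_upto_def)
        obtain \<sigma> l e where le: "0 < l" "0 < e" "0 < \<sigma> \<omega>"
          and ell: "uniformly_elliptic_on l (J \<sigma>) (\<lambda>t. C P (t0 + t) \<omega>)"
          and drift: "drift_dominated_on e (J \<sigma>) (\<lambda>t. C P (t0 + t) \<omega>) (\<lambda>t. A P (t0 + t) \<omega>)"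
        proof -
          obtain \<sigma> l e where "0 < l" "0 < e" and all: "\<forall>\<omega>'\<in>paths_agreeing_upto (exit_time Y Q \<omega>) \<omega>.
              let \<tau> = enn2real (exit_time Y Q \<omega>);
                  J = {t. 0 \<le> t \<and>
                        ennreal t \<le> min (\<sigma> \<omega>') (exit_time Y (closure Q) \<omega>' - exit_time Y Q \<omega>')}
              in 0 < \<sigma> \<omega>' \<and>
                 uniformly_elliptic_on l J (\<lambda>t. C P (\<tau> + t) \<omega>') \<and>
                 drift_dominated_on e J (\<lambda>t. C P (\<tau> + t) \<omega>') (\<lambda>t. A P (\<tau> + t) \<omega>')"
            using elim(3) fin by blast
          have "enn2real (exit_time Y Q \<omega>) = t0" using t0 by simp
          with bspec[OF all self] show thesis
            using that[of l e \<sigma>] \<open>0 < l\<close> \<open>0 < e\<close> unfolding Let_def J_def by simp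
        qed
        have "0 < exit_time Y (closure Q) \<omega> - exit_time Y Q \<omega>" using less by (simp add: diff_gr0_ennreal)
        hence "0 < min (\<sigma> \<omega>) (exit_time Y (closure Q) \<omega> - exit_time Y Q \<omega>)" using le(3) by simp
        then obtain c where c: "0 < c" "ennreal c \<le> min (\<sigma> \<omega>) (exit_time Y (closure Q) \<omega> - exit_time Y Q \<omega>)"
          using ennreal_pos_lower_bound by blast
        obtain r0 where r0: "0 < r0" "\<And>r. 0 < r \<Longrightarrow> r \<le> r0 \<Longrightarrow> Y t0 \<omega> \<in> touching Q r"
          using exterior_ball_touching[OF assms(7) t0(3)] by blast
        \<comment> \<open>The stage is chosen so that 1/(k+1) lies below l, e, the radius r0 and the
          available time c, while k+1 exceeds the exit time and the size of M there.\<close>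
        obtain k :: nat where "max (max t0 (norm (M1 t0 \<omega>))) (max (max (1 / l) (1 / e)) (max (1 / r0) (1 / c))) < real k"
          using reals_Archimedean2 by blast
        hence k: "t0 < real (Suc k)" "norm (M1 t0 \<omega>) \<le> real (Suc k)"
          and k': "1 / l < real (Suc k)" "1 / e < real (Suc k)" "1 / r0 < real (Suc k)" "1 / c < real (Suc k)" by auto
        have inv: "h k \<le> x" if "1 / x < real (Suc k)" "0 < x" for x
          using that unfolding h_def by (simp add: field_simps del: of_nat_Suc)
        have hk: "h k \<le> l" "h k \<le> e" "h k \<le> r0" "h k \<le> c"
          using inv[OF k'(1) le(1)] inv[OF k'(2) le(2)] inv[OF k'(3) r0(1)] inv[OF k'(4) c(1)] by auto
        have \<tau>: "\<tau> k \<omega> = t0" using t0 k(1) by (simp add: \<tau>_def min_def ennreal_leI del: of_nat_Suc)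
        have Bk: "B k \<omega>" using k r0(2)[OF h hk(3)] by (simp add: B_def \<tau> del: of_nat_Suc)
        note \<Phi>\<omega> = \<Phi>[OF elim(2), unfolded \<Phi>_def]
        have C1: "C1 t \<omega> = C P t \<omega>" and M1: "M1 t \<omega> = M P t \<omega>" for t using elim(2) by (auto simp: C1_def M1_def)
        have A: "Y t \<omega> - M1 t \<omega> = A P t \<omega>" if "0 \<le> t" for t using \<Phi>\<omega> that by (simp add: M1)
        \<comment> \<open>A is given only with finite variation; its continuity, which the formulas
          for its differential require, comes from Y and M being continuous.\<close>
        have A_cont: "continuous_on {0..} (\<lambda>t. A P t \<omega>)"
        proof (rule continuous_on_eq)
          show "continuous_on {0..} (\<lambda>t. Y t \<omega> - M1 t \<omega>)"
            using M1_ca sets_eq_imp_space_eq[OF P(2)]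
            by (intro continuous_intros assms(3)) (auto simp: continuous_adapted_def)
        qed (simp add: A)
        have J: "{0..t} \<subseteq> J \<sigma>" if "t \<le> h k" for t
          unfolding J_def using order_trans[OF ennreal_leI c(2)] that hk(4) by auto
        have inc: "0 < trace (C1 u \<omega> - C1 t0 \<omega>)"
          "h k * (v \<bullet> v) * trace (C1 u \<omega> - C1 t0 \<omega>) \<le> v \<bullet> ((C1 u \<omega> - C1 t0 \<omega>) *v v)"
          "h k * norm ((Y u \<omega> - M1 u \<omega>) - (Y t0 \<omega> - M1 t0 \<omega>)) \<le> trace (C1 u \<omega> - C1 t0 \<omega>)"
          if u: "t0 < u" "u \<le> t0 + h k" for u v
        proof -
          have t: "0 < u - t0" "{0..u - t0} \<subseteq> J \<sigma>" using u J[of "u - t0"] by auto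
          have C_reg: "finite_variation (\<lambda>t. C P t \<omega>)" "continuous_on {0..} (\<lambda>t. C P t \<omega>)"
            and A_fv: "finite_variation (\<lambda>t. A P t \<omega>)" using \<Phi>\<omega> by auto
          note i = increments_of_conditions[where c="\<lambda>t. C P t \<omega>" and a="\<lambda>t. A P t \<omega>",
              OF C_reg A_fv A_cont t0(1) t ell drift le(2)]
          have i: "0 < trace (C1 u \<omega> - C1 t0 \<omega>)"
            "l * (v \<bullet> v) * trace (C1 u \<omega> - C1 t0 \<omega>) \<le> v \<bullet> ((C1 u \<omega> - C1 t0 \<omega>) *v v)"
            "e * norm (A P u \<omega> - A P t0 \<omega>) \<le> trace (C1 u \<omega> - C1 t0 \<omega>)"
            using i(1) i(2)[of v] i(3) by (simp_all add: C1)
          show "0 < trace (C1 u \<omega> - C1 t0 \<omega>)" by (rule i(1))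
          have "h k * (v \<bullet> v) * trace (C1 u \<omega> - C1 t0 \<omega>) \<le> l * (v \<bullet> v) * trace (C1 u \<omega> - C1 t0 \<omega>)"
            using hk(1) i(1) by (intro mult_right_mono) auto
          thus "h k * (v \<bullet> v) * trace (C1 u \<omega> - C1 t0 \<omega>) \<le> v \<bullet> ((C1 u \<omega> - C1 t0 \<omega>) *v v)" using i(2) by linarith
          have "h k * norm (A P u \<omega> - A P t0 \<omega>) \<le> e * norm (A P u \<omega> - A P t0 \<omega>)"
            using hk(2) by (intro mult_right_mono) auto
          thus "h k * norm ((Y u \<omega> - M1 u \<omega>) - (Y t0 \<omega> - M1 t0 \<omega>)) \<le> trace (C1 u \<omega> - C1 t0 \<omega>)"
            using i(3) A[of u] A[OF t0(1)] u t0(1) by simp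
        qed
        have "\<forall>u. t0 < u \<longrightarrow> u \<le> t0 + h k \<longrightarrow> trace (C1 u \<omega> - C1 t0 \<omega>) \<noteq> 0" using inc(1) by force
        hence bad: "\<exists>u. t0 < u \<and> u < u0 \<and> bad k (\<delta> k) u \<omega>" if "t0 < u0" for u0
          using elim(1)[rule_format, of k] Bk that unfolding \<tau> by blast
        have right: "((\<lambda>u. f u) \<longlongrightarrow> f t0) (at_right t0)" if "continuous_on {0..} f" for f :: "real \<Rightarrow> real"
        proof -
          have "(f \<longlongrightarrow> f t0) (at t0 within {0..})" using that t0(1) by (simp add: continuous_on_def)
          thus ?thesis by (rule tendsto_within_subset) (use t0(1) in auto)
        qed
        have "continuous_on {0..} (\<lambda>u. trace (C1 u \<omega> - C1 t0 \<omega>))"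
          using C1_ca sets_eq_imp_space_eq[OF P(2)] unfolding trace_def
          by (intro continuous_intros) (auto simp: continuous_adapted_def)
        from order_tendstoD(2)[OF right[OF this], of "\<delta> k"]
        have e1: "\<forall>\<^sub>F u in at_right t0. trace (C1 u \<omega> - C1 t0 \<omega>) < \<delta> k" using \<delta>[of k] by (simp add: trace_def)
        have "continuous_on {0..} (\<lambda>u. norm (Y u \<omega> - Y t0 \<omega>))" by (intro continuous_intros assms(3))
        from order_tendstoD(2)[OF right[OF this], of "\<delta> k"]
        have e2: "\<forall>\<^sub>F u in at_right t0. norm (Y u \<omega> - Y t0 \<omega>) < \<delta> k" using \<delta>[of k] by simp
        have "\<forall>\<^sub>F u in at_right t0. trace (C1 u \<omega> - C1 t0 \<omega>) < \<delta> k \<and> norm (Y u \<omega> - Y t0 \<omega>) < \<delta> k"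
          using e1 e2 by (rule eventually_conj)
        then obtain u1 where u1: "t0 < u1" "\<And>u. t0 < u \<Longrightarrow> u < u1 \<Longrightarrow>
            trace (C1 u \<omega> - C1 t0 \<omega>) < \<delta> k \<and> norm (Y u \<omega> - Y t0 \<omega>) < \<delta> k"
          unfolding eventually_at_right_field by blast
        obtain u where u: "t0 < u" "u < min u1 (t0 + h k)" "bad k (\<delta> k) u \<omega>"
          using bad[of "min u1 (t0 + h k)"] u1(1) h[of k] by auto
        have "ennreal (h k) \<le> exit_time Y (closure Q) \<omega> - ennreal t0"
          using order_trans[OF ennreal_leI[OF hk(4)] c(2)] t0(2) by simp
        hence "ennreal (t0 + h k) \<le> exit_time Y (closure Q) \<omega>" by (rule ennreal_add_le[OF t0(1) h])
        moreover have "ennreal u < ennreal (t0 + h k)" using u t0(1) by (intro ennreal_lessI) auto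
        ultimately have "Y u \<omega> \<in> closure Q" using u t0(1) by (intro before_exit_time[of u Y]) auto
        \<comment> \<open>Every way to fail is excluded at u: ellipticity and drift bound by
          \<open>inc\<close>, large increments by right continuity at the exit time, and departure
          from the closure by the choice of c.\<close>
        hence "\<not> bad k (\<delta> k) u \<omega>"
          using inc[of u] u1(2)[of u] u unfolding bad_def good_increment_def \<tau>
          by (auto intro: less_imp_le)
        thus False using u(3) by simp
      qed
    qed
  qed
qed

end
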